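(* Let $\Omega\subset\mathbb{R}^n$ be a domain and let $u\in C^4(\Omega)$ be a convex solution of $\det D^2u=1$ in $\Omega$. Suppose that there is a function $w\in C^2(\Omega)$ such that $w>u$ in $\Omega$ and $w=u$ on $\partial\Omega$, and that there is a constant $C_0$, depending only on $n$, $\|u\|_{C^{0,1}(\Omega)}$ and $\|w\|_{C^{0,1}(\Omega)}$, such that $$\sum_{i,j=1}^n u^{ij}w_{ij}\ \ge\ -C_0\quad\text{in }\Omega,$$ where $[u^{ij}]$ is the inverse matrix of $D^2u$. Then $$(w-u)^{(2^n+1)(2n+1)}\,|D^2u|\ \le\ C\quad\text{in }\Omega,$$ where $C$ is a constant depending only on $n$, $\|u\|_{C^{0,1}(\Omega)}$ and $\|w\|_{C^{0,1}(\Omega)}$.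
   Context: Subscripts denote partial derivatives: $w_{ij}=\partial_{x_i}\partial_{x_j}w$. $\|\cdot\|_{C^{0,1}(\Omega)}$ is the Lipschitz norm (supremum norm plus Lipschitz constant), assumed finite for $u$ and $w$; the boundary condition $w=u$ on $\partial\Omega$ refers to the continuous extensions to $\overline\Omega$. $|D^2u|$ is a norm of the Hessian matrix. A constant is called universal if it depends only on $n$, $\|u\|_{C^{0,1}(\Omega)}$ and $\|w\|_{C^{0,1}(\Omega)}$. The constant $C_0$ in the hypothesis is universal, so the precise meaning is: for each value of $n$, $\|u\|_{C^{0,1}(\Omega)}$, $\|w\|_{C^{0,1}(\Omega)}$ and $C_0$, there is a single $C$ (independent of $\Omega$, $u$, $w$ otherwise) for which the conclusion holds. *)

theory Defs
  imports "HOL-Analysis.Analysis"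
begin

definition partial_deriv :: "'n::finite \<Rightarrow> (real^'n \<Rightarrow> real) \<Rightarrow> real^'n \<Rightarrow> real" where
  "partial_deriv i f x = frechet_derivative f (at x) (axis i 1)"

text \<open>\<open>Ck_on k f S\<close> is the usual \<open>f \<in> C\<^sup>k(S)\<close>. It is only used for open \<open>S\<close>, where it does
  not depend on the values of \<open>f\<close> outside \<open>S\<close>.\<close>

primrec Ck_on :: "nat \<Rightarrow> (real^'n::finite \<Rightarrow> real) \<Rightarrow> (real^'n) set \<Rightarrow> bool" where
  "Ck_on 0 f S \<longleftrightarrow> continuous_on S f"
| "Ck_on (Suc k) f S \<longleftrightarrow>
     (\<forall>x\<in>S. f differentiable (at x)) \<and> (\<forall>i. Ck_on k (partial_deriv i f) S)"

definition hessian :: "(real^'n::finite \<Rightarrow> real) \<Rightarrow> real^'n \<Rightarrow> real^'n^'n" where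
  "hessian f x = (\<chi> i j. partial_deriv i (partial_deriv j f) x)"

text \<open>Convexity of a function on a domain that need not itself be convex (the library's
  \<^const>\<open>convex_on\<close> includes convexity of the set): convexity on every convex subset, equivalently
  along every segment contained in the domain. If \<open>S\<close> is convex, this is just \<open>convex_on S f\<close>.\<close>

definition convex_within :: "(real^'n::finite) set \<Rightarrow> (real^'n \<Rightarrow> real) \<Rightarrow> bool" where
  "convex_within S f \<longleftrightarrow> (\<forall>K. convex K \<and> K \<subseteq> S \<longrightarrow> convex_on K f)"

lemma convex_within_iff_convex_on: "convex S \<Longrightarrow> convex_within S f \<longleftrightarrow> convex_on S f"
  unfolding convex_within_def using convex_on_subset by blast

definition C01_on :: "(real^'n::finite) set \<Rightarrow> (real^'n \<Rightarrow> real) \<Rightarrow> bool" where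
  "C01_on S f \<longleftrightarrow> bounded (f ` S) \<and> (\<exists>L. L-lipschitz_on S f)"

text \<open>The next two are meaningful only under \<^const>\<open>C01_on\<close>, since suprema and infima of
  unbounded or empty sets of reals are unspecified.\<close>

definition lipschitz_const :: "(real^'n::finite) set \<Rightarrow> (real^'n \<Rightarrow> real) \<Rightarrow> real" where
  "lipschitz_const S f = Inf {L. L-lipschitz_on S f}"

definition C01_norm :: "(real^'n::finite) set \<Rightarrow> (real^'n \<Rightarrow> real) \<Rightarrow> real" where
  "C01_norm S f = (SUP x\<in>S. \<bar>f x\<bar>) + lipschitz_const S f"

text \<open>The value at \<open>y \<in> closure S\<close> of the continuous extension of \<open>f\<close> from \<open>S\<close> to \<open>closure S\<close>;
  the limit exists when \<open>f\<close> is Lipschitz on \<open>S\<close> and \<open>y\<close> is a limit point of \<open>S\<close>.\<close>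

definition continuous_ext :: "(real^'n::finite) set \<Rightarrow> (real^'n \<Rightarrow> real) \<Rightarrow> real^'n \<Rightarrow> real" where
  "continuous_ext S f y = Lim (at y within S) f"

end

theory Submission
  imports Defs
begin

text \<open>Put \<open>\<eta> = w - u\<close>. Choose at each point a frame \<open>E\<close> that is orthonormal for \<open>D\<^sup>2u\<close>. Then
  \<open>u\<^sup>i\<^sup>jf\<^sub>i\<^sub>j\<close> is the sum of the second derivatives of \<open>f\<close> along the frame, and the hypothesis says that
  this sum is at least \<open>- C0 - n\<close> for \<open>\<eta>\<close>. Pogorelov's computation applies at an interior maximum of
  \<open>2 ln \<eta> + ln u\<^sub>e\<^sub>e + u\<^sub>e\<^sup>2 / 2\<close> (lemma \<open>pogorelov_at_max\<close>) and bounds \<open>\<eta>\<^sup>2 u\<^sub>e\<^sub>e\<close> for every unit vector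
  \<open>e\<close> by a universal constant. Since \<open>\<eta>\<close> is bounded and the exponent in the theorem is at least 2,
  the theorem follows.

  The gap in this argument is that the maximum need not be attained: \<open>u\<^sub>e\<^sub>e\<close> may blow up at the boundary
  at an unknown rate, and the domain may be unbounded. It is filled in two steps. If \<open>D\<^sup>2u\<close> has
  \<^emph>\<open>some\<close> bound on every set \<open>{\<eta> \<ge> \<epsilon>}\<close>, then the function with \<open>\<eta> - \<epsilon>\<close> in place of \<open>\<eta>\<close> and an
  additional factor \<open>exp (- \<sigma> |x|\<^sup>2)\<close> attains its maximum over \<open>{\<eta> \<ge> \<epsilon>}\<close> in the interior. The resulting
  bound does not see the size of that auxiliary bound when first \<open>\<sigma>\<close> and then \<open>\<epsilon>\<close> tend to 0
  (\<open>penalized_estimate\<close>, \<open>second_derivative_estimate\<close>).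

  To bound \<open>D\<^sup>2u\<close> on \<open>{\<eta> \<ge> 2m}\<close>, subtract from \<open>u\<close> its tangent plane at \<open>x\<close> and follow the segments
  from \<open>x\<close> inside \<open>{\<eta> > m}\<close>. The points that are reached while the excess over the tangent plane stays
  below its minimum over the points of \<open>{\<eta> = m}\<close> visible from \<open>x\<close> form a convex section of \<open>u\<close>, relatively
  compact in the domain; that minimum is the height of \<open>x\<close>. The classical interior estimate of
  Pogorelov in this section bounds \<open>D\<^sup>2u(x)\<close> by a constant over the height
  (\<open>hessian_le_inverse_height\<close>), so the heights have to be bounded below
  (\<open>height_bounded_below\<close>). Suppose they are not, and let \<open>M0\<close> be the limit superior of \<open>\<eta>\<close> along points of
  vanishing height. Take \<open>x\<close> of tiny height with \<open>\<eta> x\<close> close to \<open>M0\<close>. All points deep in the section of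
  \<open>x\<close> have small height too, so \<open>\<eta>\<close> cannot exceed \<open>M0\<close> by more than a small \<open>\<kappa>\<close> there, and
  \<open>g = M0 + \<kappa> - \<eta>\<close> is nonnegative and an almost supersolution. Some boundary point of the section has
  \<open>\<eta> = m\<close>, near which \<open>g\<close> is at least \<open>m / 2\<close>. A Harnack inequality (\<open>section_harnack\<close>) carries
  this lower bound to \<open>x\<close> with a constant independent of the height and of \<open>\<kappa>\<close>, although
  \<open>g x \<le> 2 \<kappa>\<close>: a contradiction.

  The Harnack inequality rests on estimates in a section that are uniform after an affine
  normalisation. The normalisation is by a simplex of maximal volume with a vertex at the base point;
  its volume and the gradient of the solution are controlled by comparison with explicit quadratic
  polynomials, and the second derivatives by Pogorelov's estimate again. The barrier is
  \<open>k (exp (\<alpha> t / k) - 1)\<close>, where \<open>t\<close> vanishes on a level set of the solution and \<open>k\<close> is the tangent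
  plane of \<open>t\<close> at the point near which the lower bound is known.\<close>

section \<open>Determinants and frames of a quadratic form\<close>

lemma row_eq_nth: "row i A = A $ i"
  by (simp add: row_def)

text \<open>Gram-Schmidt: replacing a row by its component orthogonal to the rows treated before adds a
  combination of other rows, which keeps the determinant, and is a projection, which does not
  increase the norm.\<close>

lemma orthogonalize_rows:
  fixes A :: "real^'n^'n"
  assumes "finite F"
  shows "\<exists>B. det B = det A \<and> (\<forall>i. norm (B $ i) \<le> norm (A $ i)) \<and>
     (\<forall>i\<in>F. \<forall>j\<in>F. i \<noteq> j \<longrightarrow> B $ i \<bullet> B $ j = 0)"
  using assms
proof (induction F)
  case empty
  show ?case by (rule exI[of _ A]) simp
next
  case (insert k F)
  then obtain B where B: "det B = det A" "\<And>i. norm (B $ i) \<le> norm (A $ i)"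
    "\<And>i j. i \<in> F \<Longrightarrow> j \<in> F \<Longrightarrow> i \<noteq> j \<Longrightarrow> B $ i \<bullet> B $ j = 0" by blast
  let ?S = "(\<lambda>i. B $ i) ` F"
  obtain y z where yz: "y \<in> span ?S" "\<And>w. w \<in> span ?S \<Longrightarrow> orthogonal z w" "B $ k = y + z"
    using orthogonal_subspace_decomp_exists[of ?S "B $ k"] by metis
  define B' where "B' = (\<chi> i. if i = k then row k B + (- y) else row i B)"
  have kF: "k \<notin> F" by fact
  have "?S \<subseteq> {row j B |j. j \<noteq> k}" using kF by (auto simp: row_eq_nth)
  then have "- y \<in> vec.span {row j B |j. j \<noteq> k}"
    using span_mono yz(1) unfolding span_vec_eq by (blast intro: span_neg)
  then have d: "det B' = det A" unfolding B'_def B(1)[symmetric] by (rule det_row_span)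
  have Bk: "B' $ k = z" and Bi: "\<And>i. i \<noteq> k \<Longrightarrow> B' $ i = B $ i"
    by (auto simp: B'_def row_eq_nth yz(3))
  have oyz: "orthogonal y z" using yz(1,2) orthogonal_commute by blast
  have "(norm (B $ k))\<^sup>2 = (norm y)\<^sup>2 + (norm z)\<^sup>2"
    using norm_add_Pythagorean[OF oyz] yz(3) by metis
  then have "(norm z)\<^sup>2 \<le> (norm (B $ k))\<^sup>2" by simp
  then have "norm z \<le> norm (B $ k)" by (rule power2_le_imp_le) simp
  then have n: "norm (B' $ i) \<le> norm (A $ i)" for i
    using B(2)[of i] Bk Bi[of i] by (cases "i = k") auto
  have zo: "z \<bullet> B $ i = 0" if "i \<in> F" for i
    using yz(2)[of "B $ i"] that by (simp add: orthogonal_def span_base)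
  have "B' $ i \<bullet> B' $ j = 0" if "i \<in> insert k F" "j \<in> insert k F" "i \<noteq> j" for i j
  proof (cases "i = k")
    case True
    then show ?thesis using that zo[of j] Bk Bi[of j] by auto
  next
    case False
    then show ?thesis using that zo[of i] Bk Bi[of i] Bi[of j] B(3)[of i j]
      by (cases "j = k") (auto simp: inner_commute)
  qed
  with d n show ?case by blast
qed

theorem hadamard_inequality:
  fixes A :: "real^'n^'n"
  shows "(det A)\<^sup>2 \<le> (\<Prod>i\<in>UNIV. (norm (A $ i))\<^sup>2)"
proof -
  obtain B where B: "det B = det A" "\<And>i. norm (B $ i) \<le> norm (A $ i)"
    "\<And>i j. i \<noteq> j \<Longrightarrow> B $ i \<bullet> B $ j = 0" using orthogonalize_rows[of UNIV A] by auto
  have e: "(B ** transpose B) $ i $ j = B $ i \<bullet> B $ j" for i j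
    by (simp add: matrix_matrix_mult_def transpose_def inner_vec_def)
  have "(det A)\<^sup>2 = det (B ** transpose B)"
    by (simp add: det_mul B(1) power2_eq_square)
  also have "\<dots> = (\<Prod>i\<in>UNIV. (norm (B $ i))\<^sup>2)"
    by (subst det_diagonal) (auto simp: e B(3) power2_norm_eq_inner)
  also have "\<dots> \<le> (\<Prod>i\<in>UNIV. (norm (A $ i))\<^sup>2)"
    by (intro prod_mono conjI power_mono B) auto
  finally show ?thesis .
qed

lemma prod_le_one_of_sum_le_card:
  fixes r :: "'n::finite \<Rightarrow> real"
  assumes "\<And>i. 0 \<le> r i" "(\<Sum>i\<in>UNIV. r i) \<le> CARD('n)"
  shows "(\<Prod>i\<in>UNIV. r i) \<le> 1"
proof -
  have "(\<Prod>i\<in>UNIV. r i) powr (1 / CARD('n)) \<le> (\<Sum>i\<in>UNIV. r i / CARD('n))"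
    by (rule arith_geom_mean) (use assms(1) in auto)
  also have "\<dots> \<le> 1" using assms(2) by (simp add: sum_divide_distrib[symmetric])
  finally have "(\<Prod>i\<in>UNIV. r i) powr (1 / CARD('n)) \<le> 1" .
  then have "((\<Prod>i\<in>UNIV. r i) powr (1 / CARD('n))) powr CARD('n) \<le> 1 powr CARD('n)"
    by (intro powr_mono2) auto
  moreover have "0 \<le> (\<Prod>i\<in>UNIV. r i)" by (simp add: assms(1) prod_nonneg)
  ultimately show ?thesis by (simp add: powr_powr)
qed

definition sym_posdef :: "real^'n^'n \<Rightarrow> bool" where
  "sym_posdef A \<longleftrightarrow> transpose A = A \<and> (\<forall>v. v \<noteq> 0 \<longrightarrow> 0 < v \<bullet> (A *v v))"

text \<open>A basis that is orthonormal for the form \<open>A\<close>. With \<open>A = D\<^sup>2u\<close>, tracing a matrix against the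
  inverse of \<open>A\<close> becomes a sum over the frame, so that the inverse Hessian never has to be
  differentiated.\<close>

definition orthoframe :: "real^'n^'n \<Rightarrow> ('n \<Rightarrow> real^'n) \<Rightarrow> bool" where
  "orthoframe A E \<longleftrightarrow> (\<forall>i j. E i \<bullet> (A *v E j) = (if i = j then 1 else 0))"

lemma sym_form_commute: "transpose A = A \<Longrightarrow> v \<bullet> (A *v w) = w \<bullet> (A *v v)" for A :: "real^'n^'n"
  by (metis dot_lmul_matrix inner_commute transpose_matrix_vector)

text \<open>One frame vector can be prescribed up to scaling: Pogorelov's computation uses a frame that
  contains the direction whose second derivative is estimated.\<close>

lemma orthoframe_exists:
  fixes A :: "real^'n^'n"
  assumes A: "sym_posdef A" and e: "e \<noteq> 0"
  shows "\<exists>E. orthoframe A E \<and> E i0 = (1 / sqrt (e \<bullet> (A *v e))) *\<^sub>R e"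
proof -
  have *: "\<exists>G. G i0 = e \<and> (\<forall>i\<in>insert i0 F. G i \<noteq> 0) \<and>
      (\<forall>i\<in>insert i0 F. \<forall>j\<in>insert i0 F. i \<noteq> j \<longrightarrow> G i \<bullet> (A *v G j) = 0)" if "finite F" for F :: "'n set"
    using that
  proof (induction F)
    case empty
    show ?case by (rule exI[of _ "\<lambda>_. e"]) (use e in auto)
  next
    case (insert k F)
    then obtain G where G: "G i0 = e" "\<And>i. i \<in> insert i0 F \<Longrightarrow> G i \<noteq> 0"
      "\<And>i j. i \<in> insert i0 F \<Longrightarrow> j \<in> insert i0 F \<Longrightarrow> i \<noteq> j \<Longrightarrow> G i \<bullet> (A *v G j) = 0"
      using insert.IH by (elim exE conjE) metis
    show ?case
    proof (cases "k = i0")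
      case True
      then show ?thesis using G by (intro exI[of _ G]) auto
    next
      case False
      let ?S = "(\<lambda>i. A *v G i) ` (insert i0 F)"
      have "card ?S \<le> card (insert i0 F)" by (rule card_image_le) (use insert in auto)
      also have "\<dots> < CARD('n)"
        using insert(2) False by (intro psubset_card_mono) auto
      finally have "dim ?S < DIM(real^'n)"
        using dim_le_card'[of ?S] insert(1) by simp
      then obtain x where x: "x \<noteq> 0" "\<And>y. y \<in> span ?S \<Longrightarrow> orthogonal x y"
        using orthogonal_to_subspace_exists[of ?S] by metis
      have xo: "x \<bullet> (A *v G i) = 0" if "i \<in> insert i0 F" for i
        using x(2)[of "A *v G i"] that by (auto simp: orthogonal_def intro: span_base)
      have xo': "G i \<bullet> (A *v x) = 0" if "i \<in> insert i0 F" for i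
        using xo[OF that] A sym_form_commute unfolding sym_posdef_def by metis
      define G' where "G' = G(k := x)"
      have "i \<noteq> j \<Longrightarrow> G' i \<bullet> (A *v G' j) = 0" if "i \<in> insert i0 (insert k F)" "j \<in> insert i0 (insert k F)" for i j
        using that xo xo' G(3) by (auto simp: G'_def)
      moreover have "G' i0 = e" "\<And>i. i \<in> insert i0 (insert k F) \<Longrightarrow> G' i \<noteq> 0"
        using G x False by (auto simp: G'_def)
      ultimately show ?thesis by blast
    qed
  qed
  obtain G where G: "G i0 = e" "\<And>i. G i \<noteq> 0" "\<And>i j. i \<noteq> j \<Longrightarrow> G i \<bullet> (A *v G j) = 0"
    using *[of UNIV] by auto
  have pos: "0 < G i \<bullet> (A *v G i)" for i using A G(2) by (auto simp: sym_posdef_def)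
  define E where "E = (\<lambda>i. (1 / sqrt (G i \<bullet> (A *v G i))) *\<^sub>R G i)"
  have "E i \<bullet> (A *v E j) = (if i = j then 1 else 0)" for i j
    using pos[of i] G(3)[of i j]
    by (auto simp: E_def matrix_vector_mult_scaleR inner_scaleR_left inner_scaleR_right less_imp_le)
  moreover have "E i0 = (1 / sqrt (e \<bullet> (A *v e))) *\<^sub>R e" by (simp add: E_def G(1))
  ultimately show ?thesis unfolding orthoframe_def by blast
qed

lemma orthoframe_matrix:
  fixes A :: "real^'n^'n"
  assumes "orthoframe A E"
  defines "M \<equiv> (\<chi> i. E i)"
  shows "M ** A ** transpose M = mat 1"
proof -
  have "(M ** (A ** transpose M)) $ i $ j = E i \<bullet> (A *v E j)" for i j
    by (simp add: M_def matrix_matrix_mult_def transpose_def inner_vec_def matrix_vector_mult_def)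
  then show ?thesis using assms(1)
    by (simp add: vec_eq_iff mat_def orthoframe_def matrix_mul_assoc)
qed

lemma orthoframe_inverse:
  fixes A :: "real^'n^'n"
  assumes "orthoframe A E"
  defines "M \<equiv> (\<chi> i. E i)"
  shows "transpose M ** M ** A = mat 1" "A ** (transpose M ** M) = mat 1"
proof -
  have "(M ** A) ** transpose M = mat 1" using orthoframe_matrix[OF assms(1)] by (simp add: M_def)
  then have "transpose M ** (M ** A) = mat 1" using matrix_left_right_inverse by blast
  then show "transpose M ** M ** A = mat 1" by (simp add: matrix_mul_assoc)
  then show "A ** (transpose M ** M) = mat 1" using matrix_left_right_inverse by blast
qed

lemma orthoframe_det:
  assumes "orthoframe A E" "det A = 1"
  shows "(det (\<chi> i. E i))\<^sup>2 = 1"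
proof -
  have "det ((\<chi> i. E i) ** A ** transpose (\<chi> i. E i)) = 1"
    using orthoframe_matrix[OF assms(1)] by simp
  then show ?thesis using assms(2) by (simp add: det_mul power2_eq_square)
qed

lemma orthoframe_matrix_inv:
  fixes A :: "real^'n^'n"
  assumes "orthoframe A E"
  shows "matrix_inv A $ i $ j = (\<Sum>k\<in>UNIV. E k $ i * E k $ j)"
proof -
  let ?M = "\<chi> i. E i"
  have "matrix_inv A = transpose ?M ** ?M"
  proof -
    have "\<exists>B. A ** B = mat 1 \<and> B ** A = mat 1" using orthoframe_inverse[OF assms] by blast
    then have "A ** matrix_inv A = mat 1" unfolding matrix_inv_def by (rule someI2_ex) simp
    then have "(transpose ?M ** ?M) ** (A ** matrix_inv A) = transpose ?M ** ?M" by simp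
    then show ?thesis using orthoframe_inverse(1)[OF assms] by (simp add: matrix_mul_assoc)
  qed
  then show ?thesis by (simp add: matrix_matrix_mult_def transpose_def)
qed

lemma orthoframe_expand:
  fixes A :: "real^'n^'n"
  assumes E: "orthoframe A E" and s: "transpose A = A"
  shows "v = (\<Sum>k\<in>UNIV. (v \<bullet> (A *v E k)) *\<^sub>R E k)"
proof -
  let ?M = "(\<chi> i. E i) :: real^'n^'n"
  have "v = (transpose ?M ** ?M ** A) *v v"
    using orthoframe_inverse(1)[OF E] by simp
  also have "\<dots> = transpose ?M *v (?M *v (A *v v))" by (simp add: matrix_vector_mul_assoc matrix_mul_assoc)
  also have "\<dots> = (\<Sum>k\<in>UNIV. (v \<bullet> (A *v E k)) *\<^sub>R E k)"
    by (simp add: vec_eq_iff matrix_vector_mul_component transpose_def row_def inner_vec_def[of "\<chi> j. E j $ i" for i]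
        sym_form_commute[OF s, of v] mult.commute)
  finally show ?thesis .
qed

lemma orthoframe_expand_component:
  fixes A :: "real^'n^'n"
  assumes E: "orthoframe A E" and s: "transpose A = A"
  shows "v $ j = (\<Sum>k\<in>UNIV. (v \<bullet> (A *v E k)) * E k $ j)"
  by (subst orthoframe_expand[OF E s, of v]) simp

lemma orthoframe_parseval:
  fixes A :: "real^'n^'n"
  assumes E: "orthoframe A E" and s: "transpose A = A"
  shows "(\<Sum>k\<in>UNIV. (v \<bullet> (A *v E k))\<^sup>2) = v \<bullet> (A *v v)"
proof -
  have "A *v v = A *v (\<Sum>k\<in>UNIV. (v \<bullet> (A *v E k)) *\<^sub>R E k)"
    using orthoframe_expand[OF E s] by metis
  also have "\<dots> = (\<Sum>k\<in>UNIV. (v \<bullet> (A *v E k)) *\<^sub>R (A *v E k))"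
    by (simp add: linear_sum[OF matrix_vector_mul_linear] matrix_vector_mult_scaleR)
  finally have "v \<bullet> (A *v v) = v \<bullet> (\<Sum>k\<in>UNIV. (v \<bullet> (A *v E k)) *\<^sub>R (A *v E k))" by simp
  then show ?thesis by (simp add: inner_sum_right power2_eq_square)
qed

text \<open>Frame coordinates preserve volume because \<open>det A = 1\<close>, and turn \<open>F i \<bullet> (A *v F i)\<close> into a
  squared Euclidean norm; what remains is Hadamard's inequality. Through it, upper bounds for the
  form along some directions become lower bounds along others.\<close>

lemma det_le_prod_form:
  fixes A :: "real^'n^'n"
  assumes A: "sym_posdef A" "det A = 1"
  shows "(det (\<chi> i. F i))\<^sup>2 \<le> (\<Prod>i\<in>UNIV. F i \<bullet> (A *v F i))"
proof -
  have "axis undefined 1 \<noteq> (0::real^'n)" by (simp add: axis_eq_0_iff)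
  then obtain E where E: "orthoframe A E" using orthoframe_exists[OF A(1)] by blast
  have s: "transpose A = A" using A(1) by (simp add: sym_posdef_def)
  let ?N = "(\<chi> i k. F i \<bullet> (A *v E k)) :: real^'n^'n"
  have "(\<chi> i. F i) = ?N ** (\<chi> i. E i)"
    by (simp add: vec_eq_iff matrix_matrix_mult_def orthoframe_expand_component[OF E s, symmetric])
  then have "(det (\<chi> i. F i))\<^sup>2 = (det ?N)\<^sup>2"
    using orthoframe_det[OF E A(2)] by (simp add: det_mul power_mult_distrib)
  also have "\<dots> \<le> (\<Prod>i\<in>UNIV. (norm (?N $ i))\<^sup>2)" by (rule hadamard_inequality)
  also have "\<dots> = (\<Prod>i\<in>UNIV. F i \<bullet> (A *v F i))"
    by (intro prod.cong refl, subst orthoframe_parseval[OF E s, symmetric])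
      (simp add: norm_vec_def L2_set_def sum_nonneg)
  finally show ?thesis .
qed

text \<open>The trace of \<open>La\<^sup>T La\<close> against the inverse of \<open>A\<close> dominates \<open>n\<close> times the \<open>n\<close>-th root of the
  determinant, by Hadamard's inequality and the inequality of arithmetic and geometric means.\<close>

lemma det_le_one_of_frame_sum_le:
  fixes A La :: "real^'n^'n"
  assumes E: "orthoframe A E" "det A = 1"
    and le: "(\<Sum>k\<in>UNIV. \<Sum>i\<in>UNIV. (La $ i \<bullet> E k)\<^sup>2) \<le> CARD('n)"
  shows "(det La)\<^sup>2 \<le> 1"
proof -
  let ?N = "La ** transpose (\<chi> i. E i)"
  have N: "?N $ i $ k = La $ i \<bullet> E k" for i k
    by (simp add: matrix_matrix_mult_def transpose_def inner_vec_def)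
  have "(det La)\<^sup>2 = (det ?N)\<^sup>2"
    using orthoframe_det[OF E] by (simp add: det_mul power_mult_distrib)
  also have "\<dots> \<le> (\<Prod>i\<in>UNIV. (norm (?N $ i))\<^sup>2)" by (rule hadamard_inequality)
  also have "\<dots> \<le> 1"
  proof (rule prod_le_one_of_sum_le_card)
    have "(\<Sum>i\<in>UNIV. (norm (?N $ i))\<^sup>2) = (\<Sum>i\<in>UNIV. \<Sum>k\<in>UNIV. (La $ i \<bullet> E k)\<^sup>2)"
      by (simp add: norm_vec_def L2_set_def sum_nonneg N)
    also have "\<dots> = (\<Sum>k\<in>UNIV. \<Sum>i\<in>UNIV. (La $ i \<bullet> E k)\<^sup>2)" by (rule sum.swap)
    finally show "(\<Sum>i\<in>UNIV. (norm (?N $ i))\<^sup>2) \<le> CARD('n)" using le by simp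
  qed simp
  finally show ?thesis .
qed

section \<open>Second-order expansions in one variable\<close>

text \<open>Value, slope and second derivative at \<open>0\<close>. The second derivative is asked for at \<open>0\<close> only,
  which is all that a second-order test at a maximum needs and what survives for functions that are
  merely \<open>C\<^sup>2\<close>. Every test in several variables below is made along lines.\<close>

definition jet2 :: "(real \<Rightarrow> real) \<Rightarrow> real \<Rightarrow> real \<Rightarrow> real \<Rightarrow> bool" where
  "jet2 f c a b \<longleftrightarrow> f 0 = c \<and> (\<exists>f'. (\<forall>\<^sub>F s in nhds 0. (f has_real_derivative f' s) (at s)) \<and>
     f' 0 = a \<and> (f' has_real_derivative b) (at 0))"

lemma jet2I:
  assumes "\<forall>\<^sub>F s in nhds 0. (f has_real_derivative f' s) (at s)" "(f' has_real_derivative b) (at 0)"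
    "f 0 = c" "f' 0 = a"
  shows "jet2 f c a b"
  using assms unfolding jet2_def by blast

lemma jet2_DERIV: "jet2 f c a b \<Longrightarrow> (f has_real_derivative a) (at 0)"
  unfolding jet2_def using eventually_nhds_x_imp_x by metis

lemma jet2_isCont: "jet2 f c a b \<Longrightarrow> isCont f 0"
  using jet2_DERIV DERIV_isCont by blast

lemma jet2_cong: "jet2 f c a b \<Longrightarrow> c = c' \<Longrightarrow> a = a' \<Longrightarrow> b = b' \<Longrightarrow> jet2 f c' a' b'"
  by simp

lemma jet2_const: "jet2 (\<lambda>_. c) c 0 0"
  by (rule jet2I[where f' = "\<lambda>_. 0"]) auto

lemma jet2_poly: "jet2 (\<lambda>s. c + a * s + b / 2 * s\<^sup>2) c a b"
  by (rule jet2I[where f' = "\<lambda>s. a + b * s"])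
    (auto intro!: always_eventually derivative_eq_intros)

lemma jet2_add:
  assumes "jet2 f c a b" "jet2 g c' a' b'"
  shows "jet2 (\<lambda>s. f s + g s) (c + c') (a + a') (b + b')"
proof -
  obtain f' where f: "\<forall>\<^sub>F s in nhds 0. (f has_real_derivative f' s) (at s)" "f' 0 = a" "(f' has_real_derivative b) (at 0)" "f 0 = c"
    using assms(1) unfolding jet2_def by blast
  obtain g' where g: "\<forall>\<^sub>F s in nhds 0. (g has_real_derivative g' s) (at s)" "g' 0 = a'" "(g' has_real_derivative b') (at 0)" "g 0 = c'"
    using assms(2) unfolding jet2_def by blast
  show ?thesis
  proof (rule jet2I[where f' = "\<lambda>s. f' s + g' s"])
    show "\<forall>\<^sub>F s in nhds 0. ((\<lambda>s. f s + g s) has_real_derivative f' s + g' s) (at s)"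
      using f(1) g(1) by eventually_elim (rule DERIV_add)
  qed (use f g in \<open>auto intro: DERIV_add\<close>)
qed

lemma jet2_mult:
  assumes "jet2 f c a b" "jet2 g c' a' b'"
  shows "jet2 (\<lambda>s. f s * g s) (c * c') (a * c' + c * a') (b * c' + 2 * a * a' + c * b')"
proof -
  obtain f' where f: "\<forall>\<^sub>F s in nhds 0. (f has_real_derivative f' s) (at s)" "f' 0 = a" "(f' has_real_derivative b) (at 0)" "f 0 = c"
    using assms(1) unfolding jet2_def by blast
  obtain g' where g: "\<forall>\<^sub>F s in nhds 0. (g has_real_derivative g' s) (at s)" "g' 0 = a'" "(g' has_real_derivative b') (at 0)" "g 0 = c'"
    using assms(2) unfolding jet2_def by blast
  note fd = jet2_DERIV[OF assms(1)] and gd = jet2_DERIV[OF assms(2)]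
  show ?thesis
  proof (rule jet2I[where f' = "\<lambda>s. f' s * g s + f s * g' s"])
    show "\<forall>\<^sub>F s in nhds 0. ((\<lambda>s. f s * g s) has_real_derivative f' s * g s + f s * g' s) (at s)"
      using f(1) g(1) by eventually_elim (auto intro!: derivative_eq_intros)
    show "((\<lambda>s. f' s * g s + f s * g' s) has_real_derivative b * c' + 2 * a * a' + c * b') (at 0)"
      by (auto intro!: derivative_eq_intros f(3) g(3) fd gd simp: f g)
  qed (use f g in auto)
qed

lemma jet2_cmult: "jet2 f c a b \<Longrightarrow> jet2 (\<lambda>s. k * f s) (k * c) (k * a) (k * b)"
  using jet2_mult[OF jet2_const, of f c a b k] by simp

lemma jet2_minus: "jet2 f c a b \<Longrightarrow> jet2 (\<lambda>s. - f s) (- c) (- a) (- b)"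
  using jet2_cmult[of f c a b "-1"] by simp

lemma jet2_diff:
  "jet2 f c a b \<Longrightarrow> jet2 g c' a' b' \<Longrightarrow> jet2 (\<lambda>s. f s - g s) (c - c') (a - a') (b - b')"
  using jet2_add[OF _ jet2_minus, of f c a b g c' a' b'] by simp

lemma jet2_sum:
  assumes "finite I" "\<And>i. i \<in> I \<Longrightarrow> jet2 (f i) (c i) (a i) (b i)"
  shows "jet2 (\<lambda>s. \<Sum>i\<in>I. f i s) (\<Sum>i\<in>I. c i) (\<Sum>i\<in>I. a i) (\<Sum>i\<in>I. b i)"
  using assms by (induction I) (auto intro: jet2_const jet2_add)

lemma jet2_chain:
  assumes f: "jet2 f c a b" and h: "\<forall>\<^sub>F y in nhds c. (h has_real_derivative h' y) (at y)"
    and h2: "(h' has_real_derivative h2) (at c)"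
  shows "jet2 (\<lambda>s. h (f s)) (h c) (h' c * a) (h2 * a\<^sup>2 + h' c * b)"
proof -
  obtain f' where f': "\<forall>\<^sub>F s in nhds 0. (f has_real_derivative f' s) (at s)" "f' 0 = a" "(f' has_real_derivative b) (at 0)" "f 0 = c"
    using f unfolding jet2_def by blast
  note fd = jet2_DERIV[OF f]
  have "(f \<longlongrightarrow> c) (nhds 0)"
    using jet2_isCont[OF f] f'(4) tendsto_at_iff_tendsto_nhds[of f 0] unfolding isCont_def by metis
  then have ev: "\<forall>\<^sub>F s in nhds 0. (h has_real_derivative h' (f s)) (at (f s))"
    using h filterlim_iff[of f "nhds c" "nhds 0"] by blast
  show ?thesis
  proof (rule jet2I[where f' = "\<lambda>s. h' (f s) * f' s"])
    show "\<forall>\<^sub>F s in nhds 0. ((\<lambda>s. h (f s)) has_real_derivative h' (f s) * f' s) (at s)"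
      using ev f'(1) by eventually_elim (rule DERIV_chain2)
    have "((\<lambda>s. h' (f s)) has_real_derivative h2 * a) (at 0)"
      by (rule DERIV_chain2[OF _ fd]) (use h2 f' in simp)
    then show "((\<lambda>s. h' (f s) * f' s) has_real_derivative h2 * a\<^sup>2 + h' c * b) (at 0)"
      by (auto intro!: derivative_eq_intros f'(3) simp: f' power2_eq_square)
  qed (use f' in auto)
qed

lemma jet2_ln:
  assumes "jet2 f c a b" "0 < c"
  shows "jet2 (\<lambda>s. ln (f s)) (ln c) (a / c) (b / c - a\<^sup>2 / c\<^sup>2)"
proof -
  have "jet2 (\<lambda>s. ln (f s)) (ln c) (inverse c * a) (- (inverse c)\<^sup>2 * a\<^sup>2 + inverse c * b)"
  proof (rule jet2_chain[OF assms(1)])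
    have "\<forall>\<^sub>F y in nhds c. y \<in> {0<..}" using assms(2) by (intro eventually_nhds_in_open) auto
    then show "\<forall>\<^sub>F y in nhds c. (ln has_real_derivative inverse y) (at y)"
      by eventually_elim (auto intro!: derivative_eq_intros simp: field_simps)
    show "(inverse has_real_derivative - (inverse c)\<^sup>2) (at c)"
      using assms(2) DERIV_inverse[of c UNIV] by (simp add: numeral_2_eq_2)
  qed
  then show ?thesis by (rule jet2_cong) (auto simp: field_simps)
qed

lemma jet2_inverse:
  assumes "jet2 f c a b" "c \<noteq> 0"
  shows "jet2 (\<lambda>s. inverse (f s)) (inverse c) (- a / c\<^sup>2) (2 * a\<^sup>2 / c ^ 3 - b / c\<^sup>2)"
proof -
  have "jet2 (\<lambda>s. inverse (f s)) (inverse c) (- (inverse c ^ 2) * a) (2 * inverse c ^ 3 * a\<^sup>2 + - (inverse c ^ 2) * b)"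
  proof (rule jet2_chain[OF assms(1)])
    have "\<forall>\<^sub>F y in nhds c. y \<in> - {0}" using assms(2) by (intro eventually_nhds_in_open) auto
    then show "\<forall>\<^sub>F y in nhds c. (inverse has_real_derivative - (inverse y ^ 2)) (at y)"
      by eventually_elim (use DERIV_inverse in \<open>auto simp: numeral_2_eq_2\<close>)
    show "((\<lambda>y. - (inverse y ^ 2)) has_real_derivative 2 * inverse c ^ 3) (at c)"
      using assms(2) by (auto intro!: derivative_eq_intros simp: power2_eq_square power3_eq_cube)
  qed
  then show ?thesis by (rule jet2_cong) (auto simp: field_simps)
qed

lemma jet2_divide:
  assumes "jet2 f c a b" "jet2 g c' a' b'" "c' \<noteq> 0"
  shows "jet2 (\<lambda>s. f s / g s) (c / c') (a / c' - c * a' / c'\<^sup>2)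
     (b / c' - 2 * a * a' / c'\<^sup>2 + c * (2 * a'\<^sup>2 / c' ^ 3 - b' / c'\<^sup>2))"
proof -
  have "jet2 (\<lambda>s. f s * inverse (g s)) (c / c') (a / c' - c * a' / c'\<^sup>2)
     (b / c' - 2 * a * a' / c'\<^sup>2 + c * (2 * a'\<^sup>2 / c' ^ 3 - b' / c'\<^sup>2))"
    by (rule jet2_cong[OF jet2_mult[OF assms(1) jet2_inverse[OF assms(2,3)]]])
      (auto simp: divide_inverse algebra_simps)
  then show ?thesis by (simp add: divide_inverse)
qed

lemma jet2_exp:
  assumes "jet2 f c a b"
  shows "jet2 (\<lambda>s. exp (f s)) (exp c) (exp c * a) (exp c * (a\<^sup>2 + b))"
  using jet2_chain[OF assms, of exp exp "exp c"] by (simp add: algebra_simps)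

lemma jet2_power2:
  assumes "jet2 f c a b"
  shows "jet2 (\<lambda>s. (f s)\<^sup>2) (c\<^sup>2) (2 * c * a) (2 * a\<^sup>2 + 2 * c * b)"
  using jet2_mult[OF assms assms] by (simp add: power2_eq_square algebra_simps)

lemma jet2_local_max:
  assumes f: "jet2 f c a b" and mx: "\<forall>\<^sub>F s in nhds 0. f s \<le> c"
  shows "a = 0" "b \<le> 0"
proof -
  obtain f' where f': "\<forall>\<^sub>F s in nhds 0. (f has_real_derivative f' s) (at s)" "f' 0 = a" "(f' has_real_derivative b) (at 0)" "f 0 = c"
    using f unfolding jet2_def by blast
  obtain d where d: "0 < d" "\<And>s. \<bar>s\<bar> < d \<Longrightarrow> f s \<le> c" "\<And>s. \<bar>s\<bar> < d \<Longrightarrow> (f has_real_derivative f' s) (at s)"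
  proof -
    have "\<forall>\<^sub>F s in nhds 0. f s \<le> c \<and> (f has_real_derivative f' s) (at s)"
      using mx f'(1) by (rule eventually_conj)
    then show ?thesis using that by (auto simp: eventually_nhds_metric dist_real_def)
  qed
  show a: "a = 0"
    by (rule DERIV_local_max[OF jet2_DERIV[OF f] d(1)]) (use d(2) f'(4) in auto)
  show "b \<le> 0"
  proof (rule ccontr)
    assume "\<not> b \<le> 0"
    then have "0 < b" by simp
    from DERIV_pos_inc_right[OF f'(3) this] obtain r where r: "0 < r" "\<And>h. 0 < h \<Longrightarrow> h < r \<Longrightarrow> f' 0 < f' h"
      by auto
    define h where "h = min d r / 2"
    have h: "0 < h" "h < d" "h < r" using d(1) r(1) by (auto simp: h_def)
    have "\<exists>z. 0 < z \<and> z < h \<and> f h - f 0 = (h - 0) * f' z"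
      by (rule MVT2) (use h d in auto)
    then obtain z where z: "0 < z" "z < h" "f h - f 0 = h * f' z" by auto
    then have "0 < f' z" using r(2)[of z] h f'(2) a by simp
    then have "f h > f 0" using z h using mult_pos_pos[of h "f' z"] by linarith
    then show False using d(2)[of h] h f'(4) by simp
  qed
qed

lemma jet2_local_min:
  assumes f: "jet2 f c a b" and mn: "\<forall>\<^sub>F s in nhds 0. c \<le> f s"
  shows "a = 0" "0 \<le> b"
  using jet2_local_max[OF jet2_minus[OF f]] mn by auto

section \<open>Directional derivatives\<close>

text \<open>Iterating directional derivatives with constant directions expresses derivatives of all orders
  without coordinates; this matters because the directions used are frame vectors and edges of a
  simplex.\<close>

definition dd :: "real^'n::finite \<Rightarrow> (real^'n \<Rightarrow> real) \<Rightarrow> real^'n \<Rightarrow> real" where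
  "dd v f x = frechet_derivative f (at x) v"

lemma has_derivative_dd: "f differentiable (at x) \<Longrightarrow> (f has_derivative (\<lambda>v. dd v f x)) (at x)"
  unfolding dd_def by (simp add: frechet_derivative_works[symmetric])

lemma dd_unique: "(f has_derivative D) (at x) \<Longrightarrow> dd v f x = D v"
  unfolding dd_def using frechet_derivative_at by metis

lemma linear_dd: "f differentiable (at x) \<Longrightarrow> linear (\<lambda>v. dd v f x)"
  using has_derivative_dd has_derivative_linear by blast

lemma dd_eq_sum:
  fixes f :: "real^'n::finite \<Rightarrow> real"
  assumes "f differentiable (at x)"
  shows "dd v f x = (\<Sum>i\<in>UNIV. v $ i * partial_deriv i f x)"
proof -
  have "dd v f x = dd (\<Sum>i\<in>UNIV. v $ i *\<^sub>R axis i 1) f x"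
    using basis_expansion[of v] by (simp add: scalar_mult_eq_scaleR)
  also have "\<dots> = (\<Sum>i\<in>UNIV. dd (v $ i *\<^sub>R axis i 1) f x)"
    by (rule linear_sum[OF linear_dd[OF assms]])
  also have "\<dots> = (\<Sum>i\<in>UNIV. v $ i * dd (axis i 1) f x)"
    using linear_scale[OF linear_dd[OF assms]] by simp
  finally show ?thesis by (simp add: dd_def partial_deriv_def)
qed

lemma partial_deriv_eq_dd: "partial_deriv i f x = dd (axis i 1) f x"
  by (simp add: dd_def partial_deriv_def)

lemma dd_cong_open:
  assumes "open S" "x \<in> S" "\<And>y. y \<in> S \<Longrightarrow> f y = g y" "f differentiable (at x)"
  shows "dd v g x = dd v f x" "g differentiable (at x)"
proof -
  have "(g has_derivative (\<lambda>v. dd v f x)) (at x)"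
    using has_derivative_transform_within_open[OF has_derivative_dd[OF assms(4)] assms(1,2)] assms(3) by auto
  then show "dd v g x = dd v f x" "g differentiable (at x)" by (auto simp: dd_unique differentiable_def)
qed

lemma Ck_on_cong:
  assumes "open S" "Ck_on k f S" "\<And>y. y \<in> S \<Longrightarrow> f y = g y"
  shows "Ck_on k g S"
  using assms(2,3)
proof (induction k arbitrary: f g)
  case 0
  then show ?case using continuous_on_cong[of S S f g] by simp
next
  case (Suc k)
  have "Ck_on k (partial_deriv i g) S" for i
  proof (rule Suc.IH[of "partial_deriv i f"])
    show "partial_deriv i f y = partial_deriv i g y" if "y \<in> S" for y
      unfolding partial_deriv_eq_dd
      by (rule dd_cong_open(1)[OF assms(1) that, symmetric]) (use Suc.prems that in auto)
  qed (use Suc.prems in auto)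
  moreover have "g differentiable (at x)" if "x \<in> S" for x
    by (rule dd_cong_open(2)[OF assms(1) that, of f]) (use Suc.prems that in auto)
  ultimately show ?case by simp
qed

lemma Ck_on_differentiable: "Ck_on (Suc k) f S \<Longrightarrow> x \<in> S \<Longrightarrow> f differentiable (at x)"
  by simp

lemma Ck_on_SucD: "Ck_on (Suc k) f S \<Longrightarrow> Ck_on k f S"
proof (induction k arbitrary: f)
  case 0
  then show ?case
    by (auto intro!: differentiable_imp_continuous_on simp: differentiable_on_def differentiable_at_withinI)
next
  case (Suc k)
  then show ?case by simp
qed

lemma Ck_on_mono: "j \<le> k \<Longrightarrow> Ck_on k f S \<Longrightarrow> Ck_on j f S"
  by (induction k) (auto simp: le_Suc_eq simp del: Ck_on.simps(2) dest: Ck_on_SucD)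

lemma Ck_on_subset: "Ck_on k f S \<Longrightarrow> T \<subseteq> S \<Longrightarrow> Ck_on k f T"
  by (induction k arbitrary: f) (auto intro: continuous_on_subset)

lemma Ck_on_continuous_on: "Ck_on k f S \<Longrightarrow> continuous_on S f"
  using Ck_on_mono[of 0 k f S] by simp

lemma dd_add: "f differentiable (at x) \<Longrightarrow> g differentiable (at x) \<Longrightarrow> dd v (\<lambda>y. f y + g y) x = dd v f x + dd v g x"
  by (rule dd_unique) (auto intro!: derivative_eq_intros has_derivative_dd)

lemma dd_cmult: "f differentiable (at x) \<Longrightarrow> dd v (\<lambda>y. c * f y) x = c * dd v f x"
  by (rule dd_unique) (auto intro!: derivative_eq_intros has_derivative_dd)

lemma dd_const: "dd v (\<lambda>y. c) x = 0"
  by (rule dd_unique) (auto intro!: derivative_eq_intros)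

lemma dd_inner: "dd v (\<lambda>y. a \<bullet> y) x = a \<bullet> v"
  by (rule dd_unique) (auto intro!: derivative_eq_intros)

lemma Ck_on_const: "Ck_on k (\<lambda>x. c) (S :: (real^'n::finite) set)"
proof (induction k arbitrary: c)
  case (Suc k)
  have "partial_deriv i (\<lambda>x. c) = (\<lambda>x. 0)" for i :: 'n by (simp add: fun_eq_iff partial_deriv_eq_dd dd_const)
  then show ?case using Suc by simp
qed simp

lemma Ck_on_inner: "Ck_on k (\<lambda>x. a \<bullet> x) S"
proof (cases k)
  case 0 then show ?thesis by (auto intro!: continuous_intros)
next
  case (Suc j)
  have "partial_deriv i (\<lambda>x. a \<bullet> x) = (\<lambda>x. a \<bullet> axis i 1)" for i by (simp add: fun_eq_iff partial_deriv_eq_dd dd_inner)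
  then show ?thesis using Suc by (simp add: Ck_on_const)
qed

lemma Ck_on_add:
  assumes "open S" "Ck_on k f S" "Ck_on k g S"
  shows "Ck_on k (\<lambda>x. f x + g x) S"
  using assms(2,3)
proof (induction k arbitrary: f g)
  case (Suc k)
  have "Ck_on k (partial_deriv i (\<lambda>x. f x + g x)) S" for i
    by (rule Ck_on_cong[OF assms(1), of k "\<lambda>x. partial_deriv i f x + partial_deriv i g x"])
      (use Suc.prems in \<open>auto intro!: Suc.IH simp: dd_add[of f _ g "axis _ 1", folded partial_deriv_eq_dd]\<close>)
  then show ?case using Suc.prems by simp
qed (auto intro: continuous_intros)

lemma Ck_on_cmult:
  assumes "open S" "Ck_on k f S"
  shows "Ck_on k (\<lambda>x. c * f x) S"
  using assms(2)
proof (induction k arbitrary: f)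
  case (Suc k)
  have "Ck_on k (partial_deriv i (\<lambda>x. c * f x)) S" for i
    by (rule Ck_on_cong[OF assms(1), of k "\<lambda>x. c * partial_deriv i f x"])
      (use Suc.prems in \<open>auto intro!: Suc.IH simp: dd_cmult[of f _ "axis _ 1", folded partial_deriv_eq_dd]\<close>)
  then show ?case using Suc.prems by simp
qed (auto intro: continuous_intros)

lemma Ck_on_diff:
  assumes "open S" "Ck_on k f S" "Ck_on k g S"
  shows "Ck_on k (\<lambda>x. f x - g x) S"
  using Ck_on_add[OF assms(1,2) Ck_on_cmult[OF assms(1,3), of "-1"]] by simp

lemma Ck_on_sum:
  assumes "open S" "finite I" "\<And>i. i \<in> I \<Longrightarrow> Ck_on k (f i) S"
  shows "Ck_on k (\<lambda>x. \<Sum>i\<in>I. f i x) S"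
  using assms(2,3) by (induction I) (auto intro: Ck_on_const Ck_on_add[OF assms(1)])

lemma Ck_on_dd:
  assumes "open S" "Ck_on (Suc k) f S"
  shows "Ck_on k (dd v f) S"
  by (rule Ck_on_cong[OF assms(1), of k "\<lambda>x. \<Sum>i\<in>UNIV. v $ i * partial_deriv i f x"])
    (use assms in \<open>auto intro!: Ck_on_sum Ck_on_cmult simp: dd_eq_sum\<close>)

lemma dd_diff: "f differentiable (at x) \<Longrightarrow> g differentiable (at x) \<Longrightarrow> dd v (\<lambda>y. f y - g y) x = dd v f x - dd v g x"
  by (rule dd_unique) (auto intro!: derivative_eq_intros has_derivative_dd)

lemma DERIV_line:
  assumes "f differentiable (at (x + s *\<^sub>R v))"
  shows "((\<lambda>s. f (x + s *\<^sub>R v)) has_real_derivative dd v f (x + s *\<^sub>R v)) (at s)"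
proof -
  have "((\<lambda>s. x + s *\<^sub>R v) has_derivative (\<lambda>h. h *\<^sub>R v)) (at s)"
    by (auto intro!: derivative_eq_intros)
  from has_derivative_compose[OF this has_derivative_dd[OF assms]]
  have "((\<lambda>s. f (x + s *\<^sub>R v)) has_derivative (\<lambda>h. dd (h *\<^sub>R v) f (x + s *\<^sub>R v))) (at s)" .
  then show ?thesis
    using linear_scale[OF linear_dd[OF assms]] by (simp add: has_field_derivative_def mult_commute_abs)
qed

lemma eventually_line_in:
  fixes S :: "'a::real_normed_vector set"
  assumes "open S" "x \<in> S"
  shows "\<forall>\<^sub>F s in nhds (0::real). x + s *\<^sub>R v \<in> S"
proof -
  have "open ((\<lambda>s::real. x + s *\<^sub>R v) -` S)" by (intro open_vimage assms continuous_on_add continuous_on_scaleR continuous_on_const continuous_on_id)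
  then have "\<forall>\<^sub>F s in nhds 0. s \<in> (\<lambda>s. x + s *\<^sub>R v) -` S" using assms by (intro eventually_nhds_in_open) auto
  then show ?thesis by simp
qed

lemma eventually_nhds_line:
  fixes x :: "real^'n"
  assumes "\<forall>\<^sub>F y in nhds x. P y"
  shows "\<forall>\<^sub>F s in nhds (0::real). P (x + s *\<^sub>R w)"
proof -
  have "((\<lambda>s::real. x + s *\<^sub>R w) \<longlongrightarrow> x + 0 *\<^sub>R w) (nhds 0)"
    by (intro tendsto_intros) (simp add: filterlim_ident)
  then have "filterlim (\<lambda>s::real. x + s *\<^sub>R w) (nhds x) (nhds 0)" by simp
  from eventually_compose_filterlim[OF assms this] show ?thesis .
qed

lemma jet2_line:
  assumes "open S" "Ck_on 2 f S" "x \<in> S"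
  shows "jet2 (\<lambda>s. f (x + s *\<^sub>R v)) (f x) (dd v f x) (dd v (dd v f) x)"
proof (rule jet2I[where f' = "\<lambda>s. dd v f (x + s *\<^sub>R v)"])
  have c: "Ck_on 1 (dd v f) S" using Ck_on_dd[OF assms(1), of 1 f v] assms(2) by (simp add: numeral_2_eq_2)
  show "\<forall>\<^sub>F s in nhds 0. ((\<lambda>s. f (x + s *\<^sub>R v)) has_real_derivative dd v f (x + s *\<^sub>R v)) (at s)"
    using eventually_line_in[OF assms(1,3)]
    by eventually_elim (rule DERIV_line, use assms in \<open>auto simp: numeral_2_eq_2\<close>)
  show "((\<lambda>s. dd v f (x + s *\<^sub>R v)) has_real_derivative dd v (dd v f) x) (at 0)"
    using DERIV_line[of "dd v f" x 0 v] c assms(3) by auto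
qed auto

text \<open>The mean value theorem in direction \<open>v\<close> and then in direction \<open>w\<close>. The left-hand side is
  symmetric in \<open>v\<close> and \<open>w\<close>, hence exchanging them proves that mixed second derivatives agree.\<close>

lemma second_difference_mvt:
  assumes S: "open S" and C: "Ck_on 2 f S" and h: "0 < h"
    and box: "\<And>a b. 0 \<le> a \<Longrightarrow> a \<le> h \<Longrightarrow> 0 \<le> b \<Longrightarrow> b \<le> h \<Longrightarrow> x + a *\<^sub>R v + b *\<^sub>R w \<in> S"
  shows "\<exists>a b. 0 < a \<and> a < h \<and> 0 < b \<and> b < h \<and>
    f (x + h *\<^sub>R v + h *\<^sub>R w) - f (x + h *\<^sub>R v) - f (x + h *\<^sub>R w) + f x = h * h * dd w (dd v f) (x + a *\<^sub>R v + b *\<^sub>R w)"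
proof -
  have df: "f differentiable (at y)" if "y \<in> S" for y using C that by (simp add: numeral_2_eq_2)
  have dg: "dd v f differentiable (at y)" if "y \<in> S" for y
    using Ck_on_dd[OF S, of 1 f v] C that by (simp add: numeral_2_eq_2)
  define g where "g = (\<lambda>s. f ((x + h *\<^sub>R w) + s *\<^sub>R v) - f (x + s *\<^sub>R v))"
  have gd: "(g has_real_derivative dd v f ((x + h *\<^sub>R w) + s *\<^sub>R v) - dd v f (x + s *\<^sub>R v)) (at s)"
    if "0 \<le> s" "s \<le> h" for s
    unfolding g_def
    by (intro DERIV_diff DERIV_line df) (use box[of s h] box[of s 0] that h in \<open>auto simp: algebra_simps\<close>)
  obtain a where a: "0 < a" "a < h" "g h - g 0 = h * (dd v f ((x + h *\<^sub>R w) + a *\<^sub>R v) - dd v f (x + a *\<^sub>R v))"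
    using MVT2[OF h gd] by auto
  define k where "k = (\<lambda>s. dd v f ((x + a *\<^sub>R v) + s *\<^sub>R w))"
  have kd: "(k has_real_derivative dd w (dd v f) ((x + a *\<^sub>R v) + s *\<^sub>R w)) (at s)"
    if "0 \<le> s" "s \<le> h" for s
    unfolding k_def
    by (intro DERIV_line dg) (use box[of a s] that a in \<open>auto simp: algebra_simps\<close>)
  obtain b where b: "0 < b" "b < h" "k h - k 0 = h * dd w (dd v f) ((x + a *\<^sub>R v) + b *\<^sub>R w)"
    using MVT2[OF h kd] by auto
  have "g h - g 0 = h * (k h - k 0)" using a(3) by (simp add: k_def algebra_simps)
  then have "g h - g 0 = h * h * dd w (dd v f) (x + a *\<^sub>R v + b *\<^sub>R w)" using b(3) by simp
  moreover have "g h - g 0 = f (x + h *\<^sub>R v + h *\<^sub>R w) - f (x + h *\<^sub>R v) - f (x + h *\<^sub>R w) + f x"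
    by (simp add: g_def algebra_simps)
  ultimately show ?thesis using a b by auto
qed

lemma dd_commute:
  assumes S: "open S" and C: "Ck_on 2 f S" and x: "x \<in> S"
  shows "dd v (dd w f) x = dd w (dd v f) x"
proof (rule ccontr)
  define p where "p = dd v (dd w f)"
  define q where "q = dd w (dd v f)"
  assume "dd v (dd w f) x \<noteq> dd w (dd v f) x"
  then have ne: "0 < \<bar>p x - q x\<bar> / 2" by (auto simp: p_def q_def)
  have cp: "continuous_on S p" "continuous_on S q" unfolding p_def q_def
    using Ck_on_dd[OF S, of 0] Ck_on_dd[OF S, of 1 f] C
    by (auto simp: numeral_2_eq_2 simp del: Ck_on.simps(2))
  then have "isCont p x" "isCont q x" using S x by (auto simp: continuous_on_eq_continuous_at)
  then obtain d1 d2 where d: "0 < d1" "\<And>y. dist y x < d1 \<Longrightarrow> dist (p y) (p x) < \<bar>p x - q x\<bar> / 2"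
     "0 < d2" "\<And>y. dist y x < d2 \<Longrightarrow> dist (q y) (q x) < \<bar>p x - q x\<bar> / 2"
    using ne unfolding continuous_at_eps_delta by (metis dist_commute)
  obtain d3 where d3: "0 < d3" "ball x d3 \<subseteq> S" using S x open_contains_ball by blast
  define d where "d = min d1 (min d2 d3)"
  define h where "h = d / (2 * (norm v + norm w + 1))"
  have d0: "0 < d" using d d3 by (simp add: d_def)
  have nn: "0 < norm v + norm w + 1" by (smt (verit) norm_ge_zero)
  have h0: "0 < h" using d0 nn by (simp add: h_def)
  have near: "dist (x + a *\<^sub>R v + b *\<^sub>R w) x < d" if "0 \<le> a" "a \<le> h" "0 \<le> b" "b \<le> h" for a b
  proof -
    have "dist (x + a *\<^sub>R v + b *\<^sub>R w) x = norm (a *\<^sub>R v + b *\<^sub>R w)" by (simp add: dist_norm)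
    also have "\<dots> \<le> a * norm v + b * norm w" using that norm_triangle_ineq[of "a *\<^sub>R v" "b *\<^sub>R w"] by simp
    also have "\<dots> \<le> h * norm v + h * norm w" using that by (intro add_mono mult_right_mono) auto
    also have "\<dots> \<le> h * (norm v + norm w + 1)" using h0 by (simp add: algebra_simps)
    also have "\<dots> = d / 2" using nn unfolding h_def by (simp add: field_split_simps)
    finally show ?thesis using d0 by simp
  qed
  have box: "x + a *\<^sub>R v + b *\<^sub>R w \<in> S" if "0 \<le> a" "a \<le> h" "0 \<le> b" "b \<le> h" for a b
    using near[OF that] d3(2) by (auto simp: d_def dist_commute subset_iff)
  have box': "x + a *\<^sub>R w + b *\<^sub>R v \<in> S" if "0 \<le> a" "a \<le> h" "0 \<le> b" "b \<le> h" for a b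
    using box[of b a] that by (simp add: algebra_simps)
  obtain a b where ab: "0 < a" "a < h" "0 < b" "b < h"
    "f (x + h *\<^sub>R v + h *\<^sub>R w) - f (x + h *\<^sub>R v) - f (x + h *\<^sub>R w) + f x = h * h * q (x + a *\<^sub>R v + b *\<^sub>R w)"
    using second_difference_mvt[OF S C h0 box] unfolding q_def by blast
  obtain a' b' where ab': "0 < a'" "a' < h" "0 < b'" "b' < h"
    "f (x + h *\<^sub>R w + h *\<^sub>R v) - f (x + h *\<^sub>R w) - f (x + h *\<^sub>R v) + f x = h * h * p (x + a' *\<^sub>R w + b' *\<^sub>R v)"
    using second_difference_mvt[OF S C h0 box'] unfolding p_def by blast
  have "h * h * q (x + a *\<^sub>R v + b *\<^sub>R w) = h * h * p (x + b' *\<^sub>R v + a' *\<^sub>R w)"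
    using ab(5) ab'(5) by (simp add: algebra_simps)
  then have eq: "q (x + a *\<^sub>R v + b *\<^sub>R w) = p (x + b' *\<^sub>R v + a' *\<^sub>R w)" using h0 by simp
  have "dist (q (x + a *\<^sub>R v + b *\<^sub>R w)) (q x) < \<bar>p x - q x\<bar> / 2"
    by (rule d(4)) (use near[of a b] ab in \<open>auto simp: d_def\<close>)
  moreover have "dist (p (x + b' *\<^sub>R v + a' *\<^sub>R w)) (p x) < \<bar>p x - q x\<bar> / 2"
    by (rule d(2)) (use near[of b' a'] ab' in \<open>auto simp: d_def\<close>)
  moreover have "\<bar>p x - q x\<bar> \<le> \<bar>q (x + a *\<^sub>R v + b *\<^sub>R w) - q x\<bar> + \<bar>q (x + a *\<^sub>R v + b *\<^sub>R w) - p x\<bar>"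
    by arith
  moreover have False if "r < D / 2" "t < D / 2" "D \<le> r + t" for r t D :: real
    using that by linarith
  ultimately show False unfolding dist_real_def eq by blast
qed

lemma hessian_form:
  assumes S: "open S" and C: "Ck_on 2 f S" and x: "x \<in> S"
  shows "v \<bullet> (hessian f x *v w) = dd v (dd w f) x"
proof -
  have d1: "f differentiable (at y)" if "y \<in> S" for y using C that by (simp add: numeral_2_eq_2)
  have C1: "Ck_on 1 (dd w f) S" "\<And>j. Ck_on 1 (partial_deriv j f) S"
    using Ck_on_dd[OF S, of 1 f w] C by (auto simp: numeral_2_eq_2)
  have "dd v (dd w f) x = (\<Sum>i\<in>UNIV. v $ i * dd (axis i 1) (dd w f) x)"
    using dd_eq_sum[of "dd w f" x v] C1(1) x by (simp add: partial_deriv_eq_dd)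
  also have "\<dots> = (\<Sum>i\<in>UNIV. v $ i * dd w (partial_deriv i f) x)"
    using dd_commute[OF S C x] by (simp add: partial_deriv_eq_dd[abs_def])
  also have "\<dots> = (\<Sum>i\<in>UNIV. v $ i * (\<Sum>j\<in>UNIV. w $ j * partial_deriv j (partial_deriv i f) x))"
    using dd_eq_sum[of _ x w] C1(2) x by simp
  also have "\<dots> = (\<Sum>i\<in>UNIV. v $ i * (\<Sum>j\<in>UNIV. hessian f x $ i $ j * w $ j))"
    using dd_commute[OF S C x] by (simp add: hessian_def partial_deriv_eq_dd[abs_def] mult.commute)
  also have "\<dots> = v \<bullet> (hessian f x *v w)"
    by (simp add: inner_vec_def matrix_vector_mult_def)
  finally show ?thesis by simp
qed

lemma hessian_symmetric:
  assumes "open S" "Ck_on 2 f S" "x \<in> S"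
  shows "transpose (hessian f x) = hessian f x"
  using dd_commute[OF assms] by (simp add: transpose_def hessian_def vec_eq_iff partial_deriv_eq_dd[abs_def])

text \<open>This translates the differential inequality of the theorem into the language of frames.\<close>

lemma inverse_hessian_trace_eq_frame_sum:
  assumes "open S" "Ck_on 2 f S" "x \<in> S" "orthoframe A E"
  shows "(\<Sum>i\<in>UNIV. \<Sum>j\<in>UNIV. matrix_inv A $ i $ j * hessian f x $ i $ j) = (\<Sum>k\<in>UNIV. dd (E k) (dd (E k) f) x)"
proof -
  have "dd (E k) (dd (E k) f) x = (\<Sum>i\<in>UNIV. \<Sum>j\<in>UNIV. E k $ i * E k $ j * hessian f x $ i $ j)" for k
    unfolding hessian_form[OF assms(1-3), symmetric] inner_vec_def matrix_vector_mult_def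
    by (simp add: sum_distrib_left mult_ac)
  then have "(\<Sum>k\<in>UNIV. dd (E k) (dd (E k) f) x) = (\<Sum>k\<in>UNIV. \<Sum>i\<in>UNIV. \<Sum>j\<in>UNIV. E k $ i * E k $ j * hessian f x $ i $ j)"
    by simp
  also have "\<dots> = (\<Sum>i\<in>UNIV. \<Sum>k\<in>UNIV. \<Sum>j\<in>UNIV. E k $ i * E k $ j * hessian f x $ i $ j)"
    by (rule sum.swap)
  also have "\<dots> = (\<Sum>i\<in>UNIV. \<Sum>j\<in>UNIV. \<Sum>k\<in>UNIV. E k $ i * E k $ j * hessian f x $ i $ j)"
    by (intro sum.cong refl sum.swap)
  also have "\<dots> = (\<Sum>i\<in>UNIV. \<Sum>j\<in>UNIV. matrix_inv A $ i $ j * hessian f x $ i $ j)"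
    by (simp add: orthoframe_matrix_inv[OF assms(4)] sum_distrib_right)
  finally show ?thesis by simp
qed

section \<open>Third derivatives and Pogorelov's computation\<close>

lemma det_subtract_row_multiples:
  fixes E :: "'n::finite \<Rightarrow> real^'n"
  assumes "finite T" "i0 \<notin> T"
  shows "det (\<chi> i. if i \<in> T then E i - c i *\<^sub>R E i0 else E i) = det (\<chi> i. E i)"
  using assms
proof (induction T)
  case (insert k T)
  define B where "B = ((\<chi> i. if i \<in> T then E i - c i *\<^sub>R E i0 else E i) :: real^'n^'n)"
  have k: "k \<notin> T" "k \<noteq> i0" "i0 \<notin> T" using insert.hyps insert.prems by auto
  have Bi: "row i B = (if i \<in> T then E i - c i *\<^sub>R E i0 else E i)" for i
    by (simp add: B_def row_eq_nth)
  have eq: "(if i \<in> insert k T then E i - c i *\<^sub>R E i0 else E i) =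
      (if i = k then row k B + (- c k) *s row i0 B else row i B)" for i
    unfolding Bi using k by (simp add: scalar_mult_eq_scaleR)
  have "det (\<chi> i. if i \<in> insert k T then E i - c i *\<^sub>R E i0 else E i) = det B"
    unfolding eq using k(2) by (rule det_row_operation)
  also have "\<dots> = det (\<chi> i. E i)" unfolding B_def using insert.IH k(3) by blast
  finally show ?case .
qed simp

lemma Ck_on_dd_le: "open S \<Longrightarrow> Ck_on m f S \<Longrightarrow> Suc k \<le> m \<Longrightarrow> Ck_on k (dd v f) S"
  by (rule Ck_on_dd[OF _ Ck_on_mono])

lemma Ck_on_differentiable_le: "Ck_on m f S \<Longrightarrow> 1 \<le> m \<Longrightarrow> x \<in> S \<Longrightarrow> f differentiable (at x)"
  using Ck_on_mono[of 1 m f S] by simp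

lemma dd2_diff:
  assumes S: "open S" and f: "Ck_on 2 f S" and g: "Ck_on 2 g S" and x: "x \<in> S"
  shows "dd w (dd w (\<lambda>y. f y - g y)) x = dd w (dd w f) x - dd w (dd w g) x"
proof -
  have d: "dd w f differentiable (at x)" "dd w g differentiable (at x)"
    by (rule Ck_on_differentiable_le[OF Ck_on_dd_le[OF S _] _ x, of 2 _ 1]; use f g in simp)+
  have "dd w (dd w (\<lambda>y. f y - g y)) x = dd w (\<lambda>y. dd w f y - dd w g y) x"
  proof (rule dd_cong_open(1)[OF S x])
    show "dd w f y - dd w g y = dd w (\<lambda>y. f y - g y) y" if "y \<in> S" for y
      using dd_diff[of f y g w] Ck_on_differentiable_le[OF f _ that] Ck_on_differentiable_le[OF g _ that] by simp
    show "(\<lambda>y. dd w f y - dd w g y) differentiable (at x)" using d by (intro differentiable_diff)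
  qed
  then show ?thesis using dd_diff[OF d] by simp
qed

lemma dd2_minus_const:
  assumes "open S" "Ck_on 2 f S" "x \<in> S"
  shows "dd w (dd w (\<lambda>y. f y - c)) x = dd w (dd w f) x"
  using dd2_diff[OF assms(1,2) Ck_on_const assms(3), of w c] by (simp add: dd_const[abs_def])

lemma dd2_const_minus:
  assumes "open S" "Ck_on 2 f S" "x \<in> S"
  shows "dd w (dd w (\<lambda>y. c - f y)) x = - dd w (dd w f) x"
  using dd2_diff[OF assms(1) Ck_on_const assms(2,3), of w c] by (simp add: dd_const[abs_def])

lemma dd_scaleR_dir: "f differentiable (at x) \<Longrightarrow> dd (c *\<^sub>R v) f x = c * dd v f x"
  using linear_scale[OF linear_dd, of f x c v] by simp

lemma dd_sum_dir: "f differentiable (at x) \<Longrightarrow> dd (\<Sum>i\<in>I. g i) f x = (\<Sum>i\<in>I. dd (g i) f x)"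
  using linear_sum[OF linear_dd, of f x g I] by simp

lemma dd_add_dir: "f differentiable (at x) \<Longrightarrow> dd (v + w) f x = dd v f x + dd w f x"
  using linear_add[OF linear_dd, of f x v w] by simp

lemma dd_minus_dir: "f differentiable (at x) \<Longrightarrow> dd (- v) f x = - dd v f x"
  using linear_neg[OF linear_dd, of f x v] by simp

lemma dd_zero_dir: "f differentiable (at x) \<Longrightarrow> dd 0 f x = 0"
  using linear_0[OF linear_dd, of f x] by simp

lemma dd_dd_commute3:
  assumes S: "open S" and C: "Ck_on 3 g S" and x: "x \<in> S"
  shows "dd e (dd v (dd w g)) x = dd v (dd w (dd e g)) x"
proof -
  have a: "Ck_on 2 (dd w g) S" by (rule Ck_on_dd_le[OF S C]) simp
  have b: "Ck_on 2 g S" by (rule Ck_on_mono[OF _ C]) simp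
  have c: "Ck_on 1 (dd e (dd w g)) S" by (rule Ck_on_dd_le[OF S a]) simp
  note 1 = a b c
  have d: "dd e (dd w g) differentiable (at x)"
    by (rule Ck_on_differentiable_le[OF 1(3) _ x]) simp
  have "dd e (dd v (dd w g)) x = dd v (dd e (dd w g)) x" by (rule dd_commute[OF S 1(1) x])
  also have "\<dots> = dd v (dd w (dd e g)) x"
    by (rule dd_cong_open(1)[OF S x _ d, symmetric]) (rule dd_commute[OF S 1(2)])
  finally show ?thesis .
qed

lemma dd_dd_commute4:
  assumes S: "open S" and C: "Ck_on 4 g S" and x: "x \<in> S"
  shows "dd e (dd e (dd v (dd v g))) x = dd v (dd v (dd e (dd e g))) x"
proof -
  have 1: "Ck_on 3 (dd e g) S" by (rule Ck_on_dd_le[OF S C]) simp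
  have 2: "Ck_on 3 g S" by (rule Ck_on_mono[OF _ C]) simp
  have 3: "Ck_on 3 (dd v g) S" by (rule Ck_on_dd_le[OF S C]) simp
  have 4: "Ck_on 2 (dd v (dd v g)) S" by (rule Ck_on_dd_le[OF S 3]) simp
  have "Ck_on 1 (dd e (dd v (dd v g))) S" by (rule Ck_on_dd_le[OF S 4]) simp
  then have d: "dd e (dd v (dd v g)) differentiable (at x)"
    by (rule Ck_on_differentiable_le[OF _ _ x]) simp
  have "dd e (dd e (dd v (dd v g))) x = dd e (dd v (dd v (dd e g))) x"
    by (rule dd_cong_open(1)[OF S x _ d, symmetric]) (rule dd_dd_commute3[OF S 2])
  also have "\<dots> = dd v (dd v (dd e (dd e g))) x" by (rule dd_dd_commute3[OF S 1 x])
  finally show ?thesis .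
qed

text \<open>For a convex solution, positive definiteness of the Hessian follows from \<open>det D\<^sup>2u = 1\<close>.\<close>

locale ma_solution =
  fixes D :: "(real^'n::finite) set" and u :: "real^'n \<Rightarrow> real"
  assumes open_D: "open D"
    and smooth: "Ck_on 4 u D"
    and posdef: "x \<in> D \<Longrightarrow> sym_posdef (hessian u x)"
    and det_one: "x \<in> D \<Longrightarrow> det (hessian u x) = 1"
begin

lemma smooth2: "Ck_on 2 u D"
  by (rule Ck_on_mono[OF _ smooth]) simp

lemma smooth_dd: "Ck_on 3 (dd v u) D"
  by (rule Ck_on_dd_le[OF open_D smooth]) simp

lemma smooth_dd2: "Ck_on 2 (dd w (dd v u)) D"
  by (rule Ck_on_dd_le[OF open_D smooth_dd]) simp

lemma differentiable: "x \<in> D \<Longrightarrow> u differentiable (at x)" "x \<in> D \<Longrightarrow> dd v u differentiable (at x)"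
    "x \<in> D \<Longrightarrow> dd w (dd v u) differentiable (at x)"
  by (rule Ck_on_differentiable_le[OF smooth] Ck_on_differentiable_le[OF smooth_dd]
      Ck_on_differentiable_le[OF smooth_dd2]; simp)+

lemma form: "x \<in> D \<Longrightarrow> v \<bullet> (hessian u x *v w) = dd v (dd w u) x"
  by (rule hessian_form[OF open_D smooth2])

lemma commute: "x \<in> D \<Longrightarrow> dd v (dd w u) x = dd w (dd v u) x"
  by (rule dd_commute[OF open_D smooth2])

lemma symmetric: "x \<in> D \<Longrightarrow> transpose (hessian u x) = hessian u x"
  using posdef by (simp add: sym_posdef_def)

lemma form_pos: "x \<in> D \<Longrightarrow> e \<noteq> 0 \<Longrightarrow> 0 < dd e (dd e u) x"
  using posdef form unfolding sym_posdef_def by metis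

lemma form_nonneg: "x \<in> D \<Longrightarrow> 0 \<le> dd e (dd e u) x"
  using form_pos[of x e] form[of x e e] by (cases "e = 0") (auto intro: less_imp_le)

lemma form_scaleR: "x \<in> D \<Longrightarrow> dd (c *\<^sub>R v) (dd (d *\<^sub>R w) u) x = c * d * dd v (dd w u) x"
  unfolding form[symmetric] by (simp add: matrix_vector_mult_scaleR)

lemma frame_exists:
  assumes "x \<in> D" "e \<noteq> 0"
  shows "\<exists>E. orthoframe (hessian u x) E \<and> E i0 = (1 / sqrt (dd e (dd e u) x)) *\<^sub>R e"
  using orthoframe_exists[OF posdef[OF assms(1)] assms(2)] form[OF assms(1)] by simp

lemma some_frame: "x \<in> D \<Longrightarrow> \<exists>E. orthoframe (hessian u x) E"
  using frame_exists[of x "axis undefined 1"] by (auto simp: axis_eq_0_iff)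

lemma frame_form: "x \<in> D \<Longrightarrow> orthoframe (hessian u x) E \<Longrightarrow> dd (E i) (dd (E j) u) x = (if i = j then 1 else 0)"
  by (simp add: form[symmetric] orthoframe_def)

lemma det_le_prod: "x \<in> D \<Longrightarrow> (det (\<chi> i. F i))\<^sup>2 \<le> (\<Prod>i\<in>UNIV. dd (F i) (dd (F i) u) x)"
  using det_le_prod_form[OF posdef det_one] by (simp add: form)

text \<open>Both claims are the differentiated equation, obtained without differentiating a determinant.
  Fix the frame at \<open>x\<close> and let \<open>M(s)\<close> be the matrix of \<open>D\<^sup>2u(x + s e)\<close> in it. After clearing the row
  and column \<open>i0\<close>, \<open>det_le_prod\<close> shows that \<open>ln M\<^sub>0\<^sub>0 + \<Sum> ln (M\<^sub>i\<^sub>i - M\<^sub>i\<^sub>0\<^sup>2 / M\<^sub>0\<^sub>0)\<close> is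
  nonnegative, with equality at \<open>s = 0\<close> where \<open>M\<close> is the identity. At this minimum the first
  derivative vanishes and the second one is nonnegative; the factor 2 in the inequality, on which
  Pogorelov's computation depends, comes from the square in the Schur complement.\<close>

lemma third_order:
  assumes x: "x \<in> D" and e: "e \<noteq> 0" and E: "orthoframe (hessian u x) E"
    and E0: "E i0 = (1 / sqrt (dd e (dd e u) x)) *\<^sub>R e"
  defines "U \<equiv> dd e (dd e u)"
  shows "(\<Sum>k\<in>UNIV. dd (E k) (dd (E k) (dd e u)) x) = 0"
    and "(dd (E i0) U x)\<^sup>2 + 2 * (\<Sum>k\<in>UNIV - {i0}. (dd (E k) U x)\<^sup>2) \<le> U x * (\<Sum>k\<in>UNIV. dd (E k) (dd (E k) U) x)"
proof -
  have U0: "0 < U x" using form_pos[OF x e] by (simp add: U_def)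
  define M where "M = (\<lambda>i j s. dd (E i) (dd (E j) u) (x + s *\<^sub>R e))"
  define M1 where "M1 = (\<lambda>i j. dd e (dd (E i) (dd (E j) u)) x)"
  define M2 where "M2 = (\<lambda>i j. dd e (dd e (dd (E i) (dd (E j) u))) x)"
  have Mj: "jet2 (M i j) (if i = j then 1 else 0) (M1 i j) (M2 i j)" for i j
    using jet2_line[OF open_D smooth_dd2[of "E i" "E j"] x, of e] frame_form[OF x E]
    by (simp add: M_def M1_def M2_def)
  \<comment> \<open>diagonal of the Schur complement of the entry \<open>(i0, i0)\<close>\<close>
  define d where "d = (\<lambda>i s. M i i s - (M i i0 s)\<^sup>2 / M i0 i0 s)"
  have dj: "jet2 (d i) 1 (M1 i i) (M2 i i - 2 * (M1 i i0)\<^sup>2)" if "i \<noteq> i0" for i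
  proof -
    have "jet2 (\<lambda>s. (M i i0 s)\<^sup>2) 0 0 (2 * (M1 i i0)\<^sup>2)"
      using jet2_power2[OF Mj[of i i0]] that by simp
    from jet2_divide[OF this Mj[of i0 i0]]
    have "jet2 (\<lambda>s. (M i i0 s)\<^sup>2 / M i0 i0 s) 0 0 (2 * (M1 i i0)\<^sup>2)" by simp
    from jet2_diff[OF Mj[of i i] this] show ?thesis by (simp add: d_def)
  qed
  define Q where "Q = (\<lambda>s. ln (M i0 i0 s) + (\<Sum>i\<in>UNIV-{i0}. ln (d i s)))"
  have l1: "jet2 (\<lambda>s. ln (M i0 i0 s)) 0 (M1 i0 i0) (M2 i0 i0 - (M1 i0 i0)\<^sup>2)"
    using jet2_ln[OF Mj[of i0 i0]] by simp
  have l2: "jet2 (\<lambda>s. ln (d i s)) 0 (M1 i i) (M2 i i - 2 * (M1 i i0)\<^sup>2 - (M1 i i)\<^sup>2)" if "i \<in> UNIV - {i0}" for i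
    using jet2_ln[OF dj[of i]] that by simp
  have Qj: "jet2 Q 0 (M1 i0 i0 + (\<Sum>i\<in>UNIV-{i0}. M1 i i))
     (M2 i0 i0 - (M1 i0 i0)\<^sup>2 + (\<Sum>i\<in>UNIV-{i0}. M2 i i - 2 * (M1 i i0)\<^sup>2 - (M1 i i)\<^sup>2))"
    unfolding Q_def
    by (rule jet2_cong[OF jet2_add[OF l1 jet2_sum[of "UNIV - {i0}", OF _ l2]]]) auto
  have Qmin: "\<forall>\<^sub>F s in nhds 0. 0 \<le> Q s"
    using eventually_line_in[OF open_D x, of e]
  proof eventually_elim
    case (elim s)
    let ?y = "x + s *\<^sub>R e"
    have y: "?y \<in> D" by (rule elim)
    have E00: "E i0 \<noteq> 0" using frame_form[OF x E, of i0 i0] form[OF x, of "E i0" "E i0"] by auto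
    have m: "0 < M i0 i0 s" using form_pos[OF y E00] by (simp add: M_def)
    \<comment> \<open>the frame after elimination of the direction \<open>E i0\<close> in the inner product at \<open>x + s e\<close>\<close>
    define F where "F = (\<lambda>i. if i \<in> UNIV - {i0} then E i - (M i i0 s / M i0 i0 s) *\<^sub>R E i0 else E i)"
    have "det (\<chi> i. F i) = det (\<chi> i. E i)"
      unfolding F_def by (rule det_subtract_row_multiples) auto
    then have dF: "(det (\<chi> i. F i))\<^sup>2 = 1" using orthoframe_det[OF E det_one[OF x]] by simp
    have F0: "dd (F i0) (dd (F i0) u) ?y = M i0 i0 s" by (simp add: F_def M_def)
    have Fi: "dd (F i) (dd (F i) u) ?y = d i s" if "i \<noteq> i0" for i
    proof -
      have sy: "E i0 \<bullet> (hessian u ?y *v E i) = E i \<bullet> (hessian u ?y *v E i0)"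
        using sym_form_commute[OF symmetric[OF y]] .
      have "dd (F i) (dd (F i) u) ?y = M i i s - 2 * (M i i0 s / M i0 i0 s) * M i i0 s + (M i i0 s / M i0 i0 s)\<^sup>2 * M i0 i0 s"
        using that unfolding form[OF y, symmetric] M_def F_def
        by (simp add: matrix_vector_mult_diff_distrib matrix_vector_mult_scaleR inner_diff_left inner_diff_right sy
            power2_eq_square algebra_simps)
      also have "\<dots> = d i s" using m by (simp add: d_def field_simps power2_eq_square)
      finally show ?thesis .
    qed
    have Fn: "F i \<noteq> 0" for i
    proof
      assume "F i = 0"
      then have "row i (\<chi> i. F i) = 0" by (simp add: row_eq_nth)
      then show False using dF det_zero_row(2) by fastforce
    qed
    have di: "0 < d i s" if "i \<noteq> i0" for i
      using form_pos[OF y Fn[of i]] Fi[OF that] by simp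
    have "1 \<le> (\<Prod>i\<in>UNIV. dd (F i) (dd (F i) u) ?y)" using det_le_prod[OF y, of F] dF by simp
    also have "\<dots> = M i0 i0 s * (\<Prod>i\<in>UNIV-{i0}. d i s)"
      by (subst prod.remove[of UNIV i0]) (auto simp: F0 Fi intro!: prod.cong)
    finally have "0 \<le> ln (M i0 i0 s * (\<Prod>i\<in>UNIV-{i0}. d i s))" by simp
    also have "\<dots> = ln (M i0 i0 s) + ln (\<Prod>i\<in>UNIV-{i0}. d i s)"
      by (rule ln_mult_pos[OF m]) (use di in \<open>auto intro: prod_pos\<close>)
    also have "ln (\<Prod>i\<in>UNIV-{i0}. d i s) = (\<Sum>i\<in>UNIV-{i0}. ln (d i s))"
      by (rule ln_prod) (use di in \<open>auto simp: less_le\<close>)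
    finally have "0 \<le> Q s" by (simp add: Q_def)
    then show ?case .
  qed
  note mn = jet2_local_min[OF Qj Qmin]
  have "(\<Sum>k\<in>UNIV. dd (E k) (dd (E k) (dd e u)) x) = (\<Sum>k\<in>UNIV. M1 k k)"
    unfolding M1_def by (intro sum.cong refl dd_dd_commute3[symmetric, OF open_D _ x] Ck_on_mono[OF _ smooth]) auto
  also have "\<dots> = 0" using mn(1) by (simp add: sum.remove[of UNIV i0])
  finally show "(\<Sum>k\<in>UNIV. dd (E k) (dd (E k) (dd e u)) x) = 0" .
  have M1e: "M1 k i0 = dd (E k) U x / sqrt (U x)" for k
  proof -
    have "M1 k i0 = dd (E k) (dd (E i0) (dd e u)) x"
      unfolding M1_def by (rule dd_dd_commute3[OF open_D Ck_on_mono[OF _ smooth] x]) auto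
    also have "\<dots> = dd (E k) (\<lambda>y. (1 / sqrt (U x)) * U y) x"
    proof (rule dd_cong_open(1)[OF open_D x])
      show "1 / sqrt (U x) * U y = dd (E i0) (dd e u) y" if "y \<in> D" for y
        unfolding E0 U_def using that by (simp add: dd_scaleR_dir differentiable)
      show "(\<lambda>y. 1 / sqrt (U x) * U y) differentiable (at x)"
        unfolding U_def using differentiable(3)[OF x] by (intro differentiable_mult differentiable_const)
    qed
    also have "\<dots> = dd (E k) U x / sqrt (U x)"
      unfolding U_def by (subst dd_cmult[OF differentiable(3)[OF x]]) simp
    finally show ?thesis .
  qed
  have M1sq: "(M1 k i0)\<^sup>2 = (dd (E k) U x)\<^sup>2 / U x" for k
    using U0 by (simp add: M1e power_divide)
  have "(\<Sum>k\<in>UNIV. dd (E k) (dd (E k) U) x) = (\<Sum>k\<in>UNIV. M2 k k)"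
    unfolding M2_def U_def by (simp add: dd_dd_commute4[OF open_D smooth x])
  also have "\<dots> = M2 i0 i0 + (\<Sum>i\<in>UNIV-{i0}. M2 i i)" by (simp add: sum.remove[of UNIV i0])
  also have "\<dots> \<ge> (M1 i0 i0)\<^sup>2 + (\<Sum>i\<in>UNIV-{i0}. 2 * (M1 i i0)\<^sup>2)"
  proof -
    have "(\<Sum>i\<in>UNIV-{i0}. M2 i i - 2 * (M1 i i0)\<^sup>2 - (M1 i i)\<^sup>2) \<le> (\<Sum>i\<in>UNIV-{i0}. M2 i i - 2 * (M1 i i0)\<^sup>2)"
      by (intro sum_mono) auto
    then show ?thesis using mn(2) by (simp add: sum_subtractf)
  qed
  finally have "(M1 i0 i0)\<^sup>2 + (\<Sum>i\<in>UNIV-{i0}. 2 * (M1 i i0)\<^sup>2) \<le> (\<Sum>k\<in>UNIV. dd (E k) (dd (E k) U) x)" .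
  then have "((dd (E i0) U x)\<^sup>2 + 2 * (\<Sum>k\<in>UNIV - {i0}. (dd (E k) U x)\<^sup>2)) / U x \<le> (\<Sum>k\<in>UNIV. dd (E k) (dd (E k) U) x)"
    by (simp add: M1sq add_divide_distrib sum_divide_distrib sum_distrib_left)
  then show "(dd (E i0) U x)\<^sup>2 + 2 * (\<Sum>k\<in>UNIV - {i0}. (dd (E k) U x)\<^sup>2) \<le> U x * (\<Sum>k\<in>UNIV. dd (E k) (dd (E k) U) x)"
    using U0 by (simp add: field_simps)
qed

text \<open>Sum the second-order condition at the maximum over the frame. Off the direction \<open>i0\<close> the
  first-order condition turns \<open>2 (t\<^sub>k / t)\<^sup>2\<close> into \<open>(U\<^sub>k / U)\<^sup>2\<close> up to \<open>r1\<close>, and these terms are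
  absorbed by the factor 2 in \<open>third_order\<close>. In the direction \<open>i0\<close>, parallel to \<open>e\<close>, the square of
  the logarithmic derivative of \<open>t\<close> remains on the right. The good term on the left comes from
  \<open>(u\<^sub>e - \<kappa>)\<^sup>2\<close>. The function \<open>\<rho>\<close> is a free perturbation, zero in sections and a multiple of \<open>|x|\<^sup>2\<close>
  in the global estimate.\<close>

lemma pogorelov_at_max:
  assumes x: "x \<in> D" and e: "e \<noteq> 0" and E: "orthoframe (hessian u x) E"
    and E0: "E i0 = (1 / sqrt (dd e (dd e u) x)) *\<^sub>R e"
    and N: "open N" "x \<in> N" "Ck_on 2 t N" "0 < t x"
    and Lt: "- C \<le> (\<Sum>k\<in>UNIV. dd (E k) (dd (E k) t) x)"
    and rho: "\<And>k. jet2 (\<lambda>s. \<rho> (x + s *\<^sub>R E k)) (\<rho> x) (r1 k) (r2 k)"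
    and mx: "\<forall>\<^sub>F y in nhds x. 2 * ln (t y) + ln (dd e (dd e u) y) + a / 2 * (dd e u y - \<kappa>)\<^sup>2 + \<rho> y
        \<le> 2 * ln (t x) + ln (dd e (dd e u) x) + a / 2 * (dd e u x - \<kappa>)\<^sup>2 + \<rho> x"
  shows "a * dd e (dd e u) x \<le> 2 * C / t x + 2 * (dd e t x)\<^sup>2 / ((t x)\<^sup>2 * dd e (dd e u) x)
     + (\<Sum>k\<in>UNIV. (r1 k)\<^sup>2) - (\<Sum>k\<in>UNIV. r2 k)"
proof -
  define U where "U = dd e (dd e u)"
  define p where "p = dd e u x - \<kappa>"
  have U0: "0 < U x" using form_pos[OF x e] by (simp add: U_def)
  define t1 where "t1 = (\<lambda>k. dd (E k) t x)"
  define t2 where "t2 = (\<lambda>k. dd (E k) (dd (E k) t) x)"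
  define U1 where "U1 = (\<lambda>k. dd (E k) U x)"
  define U2 where "U2 = (\<lambda>k. dd (E k) (dd (E k) U) x)"
  define p1 where "p1 = (\<lambda>k. dd (E k) (dd e u) x)"
  define p2 where "p2 = (\<lambda>k. dd (E k) (dd (E k) (dd e u)) x)"
  have J: "jet2 (\<lambda>s. 2 * ln (t (x + s *\<^sub>R E k)) + ln (U (x + s *\<^sub>R E k)) + a / 2 * (dd e u (x + s *\<^sub>R E k) - \<kappa>)\<^sup>2 + \<rho> (x + s *\<^sub>R E k))
      (2 * ln (t x) + ln (U x) + a / 2 * p\<^sup>2 + \<rho> x)
      (2 * (t1 k / t x) + U1 k / U x + a / 2 * (2 * p * p1 k) + r1 k)
      (2 * (t2 k / t x - (t1 k)\<^sup>2 / (t x)\<^sup>2) + (U2 k / U x - (U1 k)\<^sup>2 / (U x)\<^sup>2) + a / 2 * (2 * (p1 k)\<^sup>2 + 2 * p * p2 k) + r2 k)" for k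
  proof -
    have jt: "jet2 (\<lambda>s. t (x + s *\<^sub>R E k)) (t x) (t1 k) (t2 k)"
      unfolding t1_def t2_def by (rule jet2_line[OF N(1,3,2)])
    have jU: "jet2 (\<lambda>s. U (x + s *\<^sub>R E k)) (U x) (U1 k) (U2 k)"
      unfolding U1_def U2_def U_def by (rule jet2_line[OF open_D smooth_dd2 x])
    have jp: "jet2 (\<lambda>s. dd e u (x + s *\<^sub>R E k) - \<kappa>) p (p1 k) (p2 k)"
      using jet2_diff[OF jet2_line[OF open_D Ck_on_mono[OF _ smooth_dd, of 2] x] jet2_const, of e "E k" \<kappa>]
      by (simp add: p_def p1_def p2_def)
    show ?thesis
      by (rule jet2_add[OF jet2_add[OF jet2_add[OF jet2_cmult[OF jet2_ln[OF jt N(4)]] jet2_ln[OF jU U0]]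
            jet2_cmult[OF jet2_power2[OF jp]]] rho])
  qed
  have ev: "\<forall>\<^sub>F s in nhds 0. 2 * ln (t (x + s *\<^sub>R E k)) + ln (U (x + s *\<^sub>R E k)) + a / 2 * (dd e u (x + s *\<^sub>R E k) - \<kappa>)\<^sup>2 + \<rho> (x + s *\<^sub>R E k)
      \<le> 2 * ln (t x) + ln (U x) + a / 2 * p\<^sup>2 + \<rho> x" for k
    using eventually_nhds_line[OF mx, of "E k"] unfolding U_def p_def .
  have z1: "2 * (t1 k / t x) + U1 k / U x + a * p * p1 k + r1 k = 0" for k
    using jet2_local_max(1)[OF J ev, of k] by (simp add: algebra_simps)
  have z2: "2 * (t2 k / t x) - 2 * ((t1 k)\<^sup>2 / (t x)\<^sup>2) + U2 k / U x - (U1 k)\<^sup>2 / (U x)\<^sup>2 + a * (p1 k)\<^sup>2 + a * p * p2 k + r2 k \<le> 0" for k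
    using jet2_local_max(2)[OF J ev, of k] by (simp add: algebra_simps)
  have p1_0: "p1 k = 0" if "k \<noteq> i0" for k
  proof -
    have "dd (E k) (dd (E i0) u) x = 0" using frame_form[OF x E] that by simp
    then have "(1 / sqrt (U x)) * p1 k = 0"
      unfolding p1_def E0 U_def form[OF x, symmetric] by (simp add: matrix_vector_mult_scaleR)
    then show ?thesis using U0 by simp
  qed
  have p1_i: "(p1 i0)\<^sup>2 = U x"
  proof -
    have "p1 i0 = U x / sqrt (U x)" unfolding p1_def E0 U_def by (simp add: dd_scaleR_dir differentiable x)
    then show ?thesis using U0 by (simp add: power_divide power2_eq_square)
  qed
  have t1_i: "(t1 i0)\<^sup>2 / (t x)\<^sup>2 = (dd e t x)\<^sup>2 / ((t x)\<^sup>2 * U x)"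
  proof -
    have "t differentiable (at x)" using N by (simp add: numeral_2_eq_2)
    then have "t1 i0 = dd e t x / sqrt (U x)" unfolding t1_def E0 U_def by (simp add: dd_scaleR_dir)
    then show ?thesis using U0 by (simp add: power_divide)
  qed
  \<comment> \<open>the first-order condition at the maximum, off the direction \<open>e\<close>\<close>
  have cs: "2 * ((t1 k)\<^sup>2 / (t x)\<^sup>2) \<le> (U1 k)\<^sup>2 / (U x)\<^sup>2 + (r1 k)\<^sup>2" if "k \<noteq> i0" for k
  proof -
    have "2 * (t1 k / t x) = - (U1 k / U x + r1 k)" using z1[of k] p1_0[OF that] by simp
    then have "(2 * (t1 k / t x))\<^sup>2 = (U1 k / U x + r1 k)\<^sup>2" by (metis power2_minus)
    moreover have "(U1 k / U x + r1 k)\<^sup>2 \<le> 2 * ((U1 k / U x)\<^sup>2 + (r1 k)\<^sup>2)"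
      using sum_squares_bound[of "U1 k / U x" "r1 k"] by (simp add: power2_sum)
    ultimately show ?thesis by (simp add: power_divide power_mult_distrib)
  qed
  note T = third_order[OF x e E E0]
  have T2: "(U1 i0)\<^sup>2 / (U x)\<^sup>2 + 2 * (\<Sum>k\<in>UNIV-{i0}. (U1 k)\<^sup>2 / (U x)\<^sup>2) \<le> (\<Sum>k\<in>UNIV. U2 k) / U x"
  proof -
    have "((U1 i0)\<^sup>2 + 2 * (\<Sum>k\<in>UNIV-{i0}. (U1 k)\<^sup>2)) / (U x)\<^sup>2 \<le> U x * (\<Sum>k\<in>UNIV. U2 k) / (U x)\<^sup>2"
      using T(2) by (intro divide_right_mono) (auto simp: U1_def U2_def U_def)
    moreover have "U x * (\<Sum>k\<in>UNIV. U2 k) / (U x)\<^sup>2 = (\<Sum>k\<in>UNIV. U2 k) / U x"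
      using U0 by (simp add: power2_eq_square)
    moreover have "(\<Sum>k\<in>UNIV-{i0}. (U1 k)\<^sup>2 / (U x)\<^sup>2) = (\<Sum>k\<in>UNIV-{i0}. (U1 k)\<^sup>2) / (U x)\<^sup>2"
      by (simp add: sum_divide_distrib)
    ultimately show ?thesis by (simp add: add_divide_distrib)
  qed
  have "(\<Sum>k\<in>UNIV. 2 * (t2 k / t x) - 2 * ((t1 k)\<^sup>2 / (t x)\<^sup>2) + U2 k / U x - (U1 k)\<^sup>2 / (U x)\<^sup>2 + a * (p1 k)\<^sup>2 + a * p * p2 k + r2 k) \<le> 0"
    by (intro sum_nonpos z2)
  then have S: "2 * ((\<Sum>k\<in>UNIV. t2 k) / t x) - (\<Sum>k\<in>UNIV. 2 * ((t1 k)\<^sup>2 / (t x)\<^sup>2)) + (\<Sum>k\<in>UNIV. U2 k) / U x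
      - (\<Sum>k\<in>UNIV. (U1 k)\<^sup>2 / (U x)\<^sup>2) + a * (\<Sum>k\<in>UNIV. (p1 k)\<^sup>2) + a * p * (\<Sum>k\<in>UNIV. p2 k) + (\<Sum>k\<in>UNIV. r2 k) \<le> 0"
    by (simp add: sum.distrib sum_subtractf sum_divide_distrib sum_distrib_left)
  have sp: "(\<Sum>k\<in>UNIV. (p1 k)\<^sup>2) = U x" by (simp add: sum.remove[of UNIV i0] p1_0 p1_i)
  have sp2: "(\<Sum>k\<in>UNIV. p2 k) = 0" using T(1) by (simp add: p2_def)
  have st: "(\<Sum>k\<in>UNIV. 2 * ((t1 k)\<^sup>2 / (t x)\<^sup>2)) \<le> 2 * ((dd e t x)\<^sup>2 / ((t x)\<^sup>2 * U x))
      + (\<Sum>k\<in>UNIV-{i0}. (U1 k)\<^sup>2 / (U x)\<^sup>2) + (\<Sum>k\<in>UNIV. (r1 k)\<^sup>2)"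
  proof -
    have "(\<Sum>k\<in>UNIV-{i0}. 2 * ((t1 k)\<^sup>2 / (t x)\<^sup>2)) \<le> (\<Sum>k\<in>UNIV-{i0}. (U1 k)\<^sup>2 / (U x)\<^sup>2 + (r1 k)\<^sup>2)"
      by (intro sum_mono cs) auto
    moreover have "(\<Sum>k\<in>UNIV-{i0}. (r1 k)\<^sup>2) \<le> (\<Sum>k\<in>UNIV. (r1 k)\<^sup>2)" by (intro sum_mono2) auto
    moreover have "(\<Sum>k\<in>UNIV. 2 * ((t1 k)\<^sup>2 / (t x)\<^sup>2)) = 2 * ((t1 i0)\<^sup>2 / (t x)\<^sup>2) + (\<Sum>k\<in>UNIV-{i0}. 2 * ((t1 k)\<^sup>2 / (t x)\<^sup>2))"
      by (rule sum.remove) auto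
    ultimately show ?thesis unfolding t1_i sum.distrib by linarith
  qed
  have sU: "(\<Sum>k\<in>UNIV. (U1 k)\<^sup>2 / (U x)\<^sup>2) = (U1 i0)\<^sup>2 / (U x)\<^sup>2 + (\<Sum>k\<in>UNIV-{i0}. (U1 k)\<^sup>2 / (U x)\<^sup>2)"
    by (rule sum.remove) auto
  have "- (C / t x) \<le> (\<Sum>k\<in>UNIV. t2 k) / t x"
    using divide_right_mono[OF Lt, of "t x"] N(4) by (simp add: t2_def)
  then have "a * U x \<le> 2 * (C / t x) + 2 * ((dd e t x)\<^sup>2 / ((t x)\<^sup>2 * U x)) + (\<Sum>k\<in>UNIV. (r1 k)\<^sup>2) - (\<Sum>k\<in>UNIV. r2 k)"
    using S st T2 unfolding sp sp2 sU mult_zero_right by linarith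
  then show ?thesis unfolding U_def by simp
qed

end

section \<open>Comparison with quadratic polynomials\<close>

text \<open>Quadratic polynomial expanded at \<open>z\<close>, with Hessian \<open>La\<^sup>T La\<close>, whose determinant is
  \<open>(det La)\<^sup>2\<close>; the factor \<open>La\<close> is what the explicit comparison functions come with.\<close>

definition quad :: "real \<Rightarrow> real^'n \<Rightarrow> real^'n^'n \<Rightarrow> real^'n \<Rightarrow> real^'n \<Rightarrow> real" where
  "quad c b La z y = c + b \<bullet> (y - z) + (\<Sum>i\<in>UNIV. (La $ i \<bullet> (y - z))\<^sup>2) / 2"

lemma quad_line:
  "quad c b La z (y + s *\<^sub>R w) = quad c b La z y
     + (b \<bullet> w + (\<Sum>i\<in>UNIV. (La $ i \<bullet> (y - z)) * (La $ i \<bullet> w))) * s + (\<Sum>i\<in>UNIV. (La $ i \<bullet> w)\<^sup>2) / 2 * s\<^sup>2"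
proof -
  have "(\<Sum>i\<in>UNIV. (La $ i \<bullet> (y + s *\<^sub>R w - z))\<^sup>2) = (\<Sum>i\<in>UNIV. (La $ i \<bullet> (y - z))\<^sup>2
      + 2 * s * ((La $ i \<bullet> (y - z)) * (La $ i \<bullet> w)) + s\<^sup>2 * (La $ i \<bullet> w)\<^sup>2)"
    by (intro sum.cong refl) (simp add: inner_diff_right inner_add_right power2_eq_square algebra_simps)
  also have "\<dots> = (\<Sum>i\<in>UNIV. (La $ i \<bullet> (y - z))\<^sup>2) + 2 * s * (\<Sum>i\<in>UNIV. (La $ i \<bullet> (y - z)) * (La $ i \<bullet> w))
      + s\<^sup>2 * (\<Sum>i\<in>UNIV. (La $ i \<bullet> w)\<^sup>2)"
    by (simp add: sum.distrib sum_distrib_left)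
  finally show ?thesis by (simp add: quad_def inner_diff_right inner_add_right algebra_simps)
qed

lemma jet2_quad:
  "jet2 (\<lambda>s. quad c b La z (y + s *\<^sub>R w)) (quad c b La z y)
     (b \<bullet> w + (\<Sum>i\<in>UNIV. (La $ i \<bullet> (y - z)) * (La $ i \<bullet> w))) (\<Sum>i\<in>UNIV. (La $ i \<bullet> w)\<^sup>2)"
  unfolding quad_line by (rule jet2_poly)

lemma continuous_on_quad: "continuous_on K (quad c b La z)"
  unfolding quad_def by (intro continuous_intros) auto

lemma sum_squared_le_card:
  fixes f :: "'n::finite \<Rightarrow> real"
  shows "(\<Sum>i\<in>UNIV. f i)\<^sup>2 \<le> CARD('n) * (\<Sum>i\<in>UNIV. (f i)\<^sup>2)"
  using Cauchy_Schwarz_ineq_sum[of "\<lambda>_. 1" f "UNIV::'n set"] by simp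

context ma_solution
begin

lemma continuous_on_D: "K \<subseteq> D \<Longrightarrow> continuous_on K u" "K \<subseteq> D \<Longrightarrow> continuous_on K (dd e u)"
   "K \<subseteq> D \<Longrightarrow> continuous_on K (dd e (dd f u))"
  using Ck_on_continuous_on[OF smooth] Ck_on_continuous_on[OF smooth_dd] Ck_on_continuous_on[OF smooth_dd2]
  by (blast intro: continuous_on_subset)+

lemma tangent_below:
  assumes seg: "closed_segment x y \<subseteq> D"
    and m: "\<And>p. p \<in> closed_segment x y \<Longrightarrow> m \<le> dd (y - x) (dd (y - x) u) p"
  shows "u x + dd (y - x) u x + m / 2 \<le> u y"
proof -
  let ?w = "y - x"
  define f where "f = (\<lambda>(k::nat) s. if k = 0 then u (x + s *\<^sub>R ?w) else if k = 1 then dd ?w u (x + s *\<^sub>R ?w)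
      else dd ?w (dd ?w u) (x + s *\<^sub>R ?w))"
  have inseg: "x + s *\<^sub>R ?w \<in> closed_segment x y" if "0 \<le> s" "s \<le> 1" for s
    unfolding closed_segment_def using that by (auto intro!: exI[of _ s] simp: algebra_simps)
  then have inD: "x + s *\<^sub>R ?w \<in> D" if "0 \<le> s" "s \<le> 1" for s using that seg by blast
  have "\<exists>t>0. t < 1 \<and> f 0 1 = (\<Sum>k<2. f k 0 / fact k * 1 ^ k) + f 2 t / fact 2 * 1 ^ 2"
  proof (rule Maclaurin)
    show "\<forall>k t. k < 2 \<and> 0 \<le> t \<and> t \<le> 1 \<longrightarrow> DERIV (f k) t :> f (Suc k) t"
    proof (intro allI impI)
      fix k :: nat and t :: real
      assume kt: "k < 2 \<and> 0 \<le> t \<and> t \<le> 1"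
      then have "k = 0 \<or> k = 1" by auto
      then show "DERIV (f k) t :> f (Suc k) t"
        using DERIV_line[OF differentiable(1)[OF inD], of t] DERIV_line[OF differentiable(2)[OF inD], of t] kt
        by (auto simp: f_def)
    qed
  qed auto
  then obtain t where t: "0 < t" "t < 1" "f 0 1 = f 0 0 + f 1 0 + f 2 t / 2"
    by (auto simp: numeral_2_eq_2)
  have "m \<le> f 2 t" unfolding f_def using m[OF inseg[of t]] t by simp
  then show ?thesis using t(3) by (simp add: f_def)
qed

lemma tangent_le:
  assumes "closed_segment x y \<subseteq> D"
  shows "u x + dd (y - x) u x \<le> u y"
  using tangent_below[OF assms, of 0] form_nonneg assms by auto

lemma convex_on_subset_D:
  assumes K: "convex K" "K \<subseteq> D"
  shows "convex_on K u"
proof (rule convex_onI)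
  fix s x y assume s: "0 < s" "s < (1::real)" and xy: "x \<in> K" "y \<in> K"
  define p where "p = (1 - s) *\<^sub>R x + s *\<^sub>R y"
  have p: "p \<in> K" unfolding p_def using convexD_alt[OF K(1) xy, of s] s by simp
  have sx: "closed_segment p x \<subseteq> D" "closed_segment p y \<subseteq> D"
    using closed_segment_subset[OF p xy(1) K(1)] closed_segment_subset[OF p xy(2) K(1)] K(2) by auto
  have d: "u differentiable (at p)" using p K differentiable(1) by blast
  have "(1 - s) * dd (x - p) u p + s * dd (y - p) u p = dd ((1 - s) *\<^sub>R (x - p) + s *\<^sub>R (y - p)) u p"
    by (simp add: dd_add_dir[OF d] dd_scaleR_dir[OF d])
  also have "(1 - s) *\<^sub>R (x - p) + s *\<^sub>R (y - p) = 0" by (simp add: p_def algebra_simps)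
  finally have z: "(1 - s) * dd (x - p) u p + s * dd (y - p) u p = 0" by (simp add: dd_zero_dir[OF d])
  have "(1 - s) * (u p + dd (x - p) u p) + s * (u p + dd (y - p) u p) \<le> (1 - s) * u x + s * u y"
    using s by (intro add_mono mult_left_mono tangent_le sx) auto
  then have "u p \<le> (1 - s) * u x + s * u y" using z by (simp add: algebra_simps)
  then show "u ((1 - s) *\<^sub>R x + s *\<^sub>R y) \<le> (1 - s) * u x + s * u y" by (simp add: p_def)
qed (rule K(1))

lemma second_derivative_le_at_max:
  assumes x: "x \<in> D" and mx: "\<forall>\<^sub>F y in nhds x. u y - quad c b La z y \<le> u x - quad c b La z x"
  shows "dd w (dd w u) x \<le> (\<Sum>i\<in>UNIV. (La $ i \<bullet> w)\<^sup>2)"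
proof -
  have "jet2 (\<lambda>s. u (x + s *\<^sub>R w) - quad c b La z (x + s *\<^sub>R w)) (u x - quad c b La z x)
     (dd w u x - (b \<bullet> w + (\<Sum>i\<in>UNIV. (La $ i \<bullet> (x - z)) * (La $ i \<bullet> w))))
     (dd w (dd w u) x - (\<Sum>i\<in>UNIV. (La $ i \<bullet> w)\<^sup>2))"
    by (rule jet2_diff[OF jet2_line[OF open_D smooth2 x] jet2_quad])
  from jet2_local_max(2)[OF this eventually_nhds_line[OF mx]] show ?thesis by simp
qed

text \<open>A quadratic polynomial that touches a solution from below has the smaller Hessian, so its
  second derivatives along a frame add up to at most \<open>n\<close>.\<close>

lemma det_le_one_at_min:
  assumes x: "x \<in> D" and mn: "\<forall>\<^sub>F y in nhds x. quad c b La z y - u y \<le> quad c b La z x - u x"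
  shows "(det La)\<^sup>2 \<le> 1"
proof -
  obtain E where E: "orthoframe (hessian u x) E" using some_frame[OF x] by blast
  have "(\<Sum>i\<in>UNIV. (La $ i \<bullet> E k)\<^sup>2) \<le> 1" for k
  proof -
    have "jet2 (\<lambda>s. quad c b La z (x + s *\<^sub>R E k) - u (x + s *\<^sub>R E k)) (quad c b La z x - u x)
      (b \<bullet> E k + (\<Sum>i\<in>UNIV. (La $ i \<bullet> (x - z)) * (La $ i \<bullet> E k)) - dd (E k) u x)
      ((\<Sum>i\<in>UNIV. (La $ i \<bullet> E k)\<^sup>2) - dd (E k) (dd (E k) u) x)"
      by (rule jet2_diff[OF jet2_quad jet2_line[OF open_D smooth2 x]])
    from jet2_local_max(2)[OF this eventually_nhds_line[OF mn]] show ?thesis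
      by (simp add: frame_form[OF x E])
  qed
  then have "(\<Sum>k\<in>UNIV. \<Sum>i\<in>UNIV. (La $ i \<bullet> E k)\<^sup>2) \<le> (\<Sum>k\<in>(UNIV::'n set). 1)"
    by (intro sum_mono)
  then show ?thesis by (intro det_le_one_of_frame_sum_le[OF E det_one[OF x]]) simp
qed

text \<open>Cauchy-Schwarz in the inner product \<open>D\<^sup>2u(x)\<close>.\<close>

lemma form_sum_le:
  assumes x: "x \<in> D"
  shows "dd (\<Sum>i\<in>UNIV. f i) (dd (\<Sum>i\<in>UNIV. f i) u) x \<le> CARD('n) * (\<Sum>i\<in>(UNIV::'n set). dd (f i) (dd (f i) u) x)"
proof -
  obtain E where E: "orthoframe (hessian u x) E" using some_frame[OF x] by blast
  let ?A = "hessian u x"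
  note P = orthoframe_parseval[OF E symmetric[OF x], unfolded form[OF x]]
  have "dd (\<Sum>i\<in>UNIV. f i) (dd (\<Sum>i\<in>UNIV. f i) u) x = (\<Sum>k\<in>UNIV. (dd (\<Sum>i\<in>UNIV. f i) (dd (E k) u) x)\<^sup>2)"
    by (simp add: P)
  also have "\<dots> = (\<Sum>k\<in>UNIV. (\<Sum>i\<in>UNIV. dd (f i) (dd (E k) u) x)\<^sup>2)"
    by (simp add: dd_sum_dir differentiable x)
  also have "\<dots> \<le> (\<Sum>k\<in>UNIV. CARD('n) * (\<Sum>i\<in>UNIV. (dd (f i) (dd (E k) u) x)\<^sup>2))"
    by (intro sum_mono sum_squared_le_card)
  also have "\<dots> = CARD('n) * (\<Sum>k\<in>UNIV. \<Sum>i\<in>UNIV. (dd (f i) (dd (E k) u) x)\<^sup>2)"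
    by (rule sum_distrib_left[symmetric])
  also have "(\<Sum>k\<in>UNIV. \<Sum>i\<in>UNIV. (dd (f i) (dd (E k) u) x)\<^sup>2) = (\<Sum>i\<in>UNIV. \<Sum>k\<in>UNIV. (dd (f i) (dd (E k) u) x)\<^sup>2)"
    by (rule sum.swap)
  also have "\<dots> = (\<Sum>i\<in>UNIV. dd (f i) (dd (f i) u) x)" by (simp add: P)
  finally show ?thesis by simp
qed

text \<open>Cauchy-Schwarz for the pairing of a linear form with a vector: the sum over the frame is the
  squared norm of \<open>l\<close> dual to \<open>D\<^sup>2u(x)\<close>.\<close>

lemma gradient_form_bound:
  assumes x: "x \<in> D" and E: "orthoframe (hessian u x) E" and l: "linear l"
  shows "(l w)\<^sup>2 \<le> dd w (dd w u) x * (\<Sum>k\<in>UNIV. (l (E k))\<^sup>2)"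
proof -
  have "l w = l (\<Sum>k\<in>UNIV. dd w (dd (E k) u) x *\<^sub>R E k)"
    using orthoframe_expand[OF E symmetric[OF x], of w] by (simp add: form[OF x])
  also have "\<dots> = (\<Sum>k\<in>UNIV. dd w (dd (E k) u) x * l (E k))"
    by (simp add: linear_sum[OF l] linear_scale[OF l])
  finally have "(l w)\<^sup>2 \<le> (\<Sum>k\<in>UNIV. (dd w (dd (E k) u) x)\<^sup>2) * (\<Sum>k\<in>UNIV. (l (E k))\<^sup>2)"
    using Cauchy_Schwarz_ineq_sum by metis
  then show ?thesis using orthoframe_parseval[OF E symmetric[OF x], of w] by (simp add: form[OF x])
qed

end

text \<open>A section of height \<open>H\<close> with base point \<open>x0\<close>. In the applications \<open>v\<close> is the excess of a
  solution over its tangent plane at \<open>x0\<close>.\<close>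

locale ma_section = ma_solution D v for D :: "(real^'n::finite) set" and v +
  fixes S :: "(real^'n) set" and x0 :: "real^'n" and H :: real
  assumes open_S: "open S" and convex_S: "convex S" and bounded_S: "bounded S"
    and closure_S: "closure S \<subseteq> D" and x0_S: "x0 \<in> S" and H_pos: "0 < H"
    and v_x0: "v x0 = 0"
    and v_nonneg: "y \<in> closure S \<Longrightarrow> 0 \<le> v y"
    and v_less: "y \<in> S \<Longrightarrow> v y < H"
    and v_boundary: "y \<in> closure S \<Longrightarrow> y \<notin> S \<Longrightarrow> v y = H"
begin

lemma S_sub: "S \<subseteq> D" using closure_S closure_subset by blast

lemma v_le: "y \<in> closure S \<Longrightarrow> v y \<le> H"
  using v_less v_boundary by fastforce

lemma compact_closure: "compact (closure S)"
  using bounded_S by (simp add: compact_closure)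

text \<open>On the boundary of \<open>S\<close> the polynomial is at most \<open>H = v\<close>, so a positive maximum of the
  difference is interior, which \<open>det_le_one_at_min\<close> rules out.\<close>

lemma quad_comparison:
  assumes det: "1 < (det La)\<^sup>2" and q: "\<And>y. y \<in> closure S \<Longrightarrow> quad c b La z y \<le> H" and x: "x \<in> S"
  shows "quad c b La z x \<le> v x"
proof (rule ccontr)
  assume "\<not> ?thesis"
  then have pos: "0 < quad c b La z x - v x" by simp
  have x_cl: "x \<in> closure S" using x closure_subset by blast
  have "continuous_on (closure S) (\<lambda>y. quad c b La z y - v y)"
    by (intro continuous_intros continuous_on_quad continuous_on_D closure_S)
  from continuous_attains_sup[OF compact_closure _ this] x_cl
  obtain y where y: "y \<in> closure S" "\<And>y'. y' \<in> closure S \<Longrightarrow> quad c b La z y' - v y' \<le> quad c b La z y - v y"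
    by (metis empty_iff)
  have "0 < quad c b La z y - v y" using y(2)[OF x_cl] pos by linarith
  then have yS: "y \<in> S" using v_boundary[OF y(1)] q[OF y(1)] by (cases "y \<in> S") auto
  have "\<forall>\<^sub>F y' in nhds y. quad c b La z y' - v y' \<le> quad c b La z y - v y"
    using eventually_nhds_in_open[OF open_S yS]
    by eventually_elim (rule y(2), use closure_subset[of S] in blast)
  from det_le_one_at_min[OF _ this] det yS S_sub show False by auto
qed

end

text \<open>A substitute for John's ellipsoid that keeps the base point: among the simplices with vertex
  \<open>x0\<close> and the other vertices in the closure of \<open>S\<close> take one of maximal volume. By Cramer's rule the
  coordinates of a point \<open>y\<close> with respect to its edges \<open>P\<close> are the ratios of volumes after replacing
  an edge by \<open>y - x0\<close>, hence at most 1 in absolute value. The rows of \<open>Q\<close> are the dual basis.\<close>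

lemma simplex_coordinates:
  fixes S :: "(real^'n::finite) set"
  assumes "open S" "bounded S" "x0 \<in> S"
  obtains P Q :: "real^'n^'n" where "\<And>i. x0 + P $ i \<in> closure S" "det P \<noteq> 0" "det Q * det P = 1"
    "\<And>y. y = (\<Sum>i\<in>UNIV. (Q $ i \<bullet> y) *\<^sub>R P $ i)" "\<And>i j. Q $ i \<bullet> P $ j = (if i = j then 1 else 0)"
    "\<And>y i. y \<in> closure S \<Longrightarrow> \<bar>Q $ i \<bullet> (y - x0)\<bar> \<le> 1"
    "\<And>j w. det (\<chi> i. if i = j then w else P $ i) = (Q $ j \<bullet> w) * det P"
proof -
  define K where "K = {P :: real^'n^'n. \<forall>i. x0 + P $ i \<in> closure S}"
  have "closed K"
    unfolding K_def Collect_all_eq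
    by (intro closed_INT ballI closed_vimage[of "closure S", unfolded vimage_def]) (auto intro!: continuous_intros)
  moreover have "bounded K"
  proof -
    obtain b where b: "\<And>y. y \<in> closure S \<Longrightarrow> norm y \<le> b"
      using bounded_closure[OF assms(2)] unfolding bounded_iff by blast
    have "norm P \<le> (\<Sum>i\<in>(UNIV::'n set). b + norm x0)" if "P \<in> K" for P
    proof -
      have "norm (P $ i) \<le> b + norm x0" for i
        using b[of "x0 + P $ i"] that norm_triangle_ineq4[of "x0 + P $ i" x0] by (auto simp: K_def)
      then have "(\<Sum>i\<in>UNIV. norm (P $ i)) \<le> (\<Sum>i\<in>(UNIV::'n set). b + norm x0)" by (intro sum_mono)
      moreover have "norm P \<le> (\<Sum>i\<in>UNIV. norm (P $ i))" unfolding norm_vec_def by (rule L2_set_le_sum) simp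
      ultimately show ?thesis by linarith
    qed
    then show ?thesis unfolding bounded_iff by blast
  qed
  ultimately have cK: "compact K" by (simp add: compact_eq_bounded_closed)
  have contd: "continuous_on K (\<lambda>P. \<bar>det P\<bar>)"
    unfolding det_def by (intro continuous_intros)
  obtain r where r: "0 < r" "cball x0 r \<subseteq> S" using open_contains_cball assms by blast
  \<comment> \<open>a small orthogonal simplex shows that the maximal volume is positive\<close>
  define P0 :: "real^'n^'n" where "P0 = (\<chi> i. r *\<^sub>R axis i 1)"
  have P0K: "P0 \<in> K"
    using r closure_subset[of S] by (auto simp: K_def P0_def dist_norm norm_axis_1 subset_iff)
  have "P0 = (\<chi> i j. if i = j then r else 0)" by (simp add: P0_def vec_eq_iff axis_def)
  then have "det P0 = r ^ CARD('n)" by (simp add: det_diagonal)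
  then have dP0: "0 < \<bar>det P0\<bar>" using r by simp
  obtain P where P: "P \<in> K" "\<And>P'. P' \<in> K \<Longrightarrow> \<bar>det P'\<bar> \<le> \<bar>det P\<bar>"
    using continuous_attains_sup[OF cK _ contd] P0K by blast
  have dP: "det P \<noteq> 0" using P(2)[OF P0K] dP0 by auto
  then obtain B where B: "P ** B = mat 1" "B ** P = mat 1"
    unfolding invertible_det_nz[symmetric] invertible_def by blast
  define Q where "Q = transpose B"
  have "det (B ** P) = 1" using B by simp
  then have dQ: "det Q * det P = 1" by (simp add: det_mul Q_def)
  have ex: "y = (\<Sum>i\<in>UNIV. (Q $ i \<bullet> y) *\<^sub>R P $ i)" for y
  proof -
    have "y = transpose (B ** P) *v y" using B by simp
    also have "\<dots> = transpose P *v (Q *v y)" 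
      by (simp only: Q_def matrix_transpose_mul matrix_vector_mul_assoc)
    also have "\<dots> = (\<Sum>i\<in>UNIV. (Q *v y) $ i *s column i (transpose P))" by (rule matrix_mult_sum)
    also have "\<dots> = (\<Sum>i\<in>UNIV. (Q $ i \<bullet> y) *\<^sub>R P $ i)"
      by (simp add: scalar_mult_eq_scaleR matrix_vector_mul_component row_eq_nth)
    finally show ?thesis .
  qed
  have du: "Q $ i \<bullet> P $ j = (if i = j then 1 else 0)" for i j
  proof -
    have "(P ** B) $ j $ i = P $ j \<bullet> Q $ i"
      by (simp add: matrix_matrix_mult_def Q_def transpose_def inner_vec_def)
    then show ?thesis using B(1) by (simp add: mat_def inner_commute eq_commute)
  qed
  have cr: "det (\<chi> i. if i = j then w else P $ i) = (Q $ j \<bullet> w) * det P" for j w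
  proof -
    have e: "(\<Sum>i\<in>UNIV. (\<chi> i. Q $ i \<bullet> w) $ i *s row i P) = w"
      using ex[of w] by (simp add: scalar_mult_eq_scaleR row_eq_nth)
    show ?thesis
      using cramer_lemma_transpose[of j "\<chi> i. Q $ i \<bullet> w" P] unfolding e unfolding row_eq_nth by simp
  qed
  have bd: "\<bar>Q $ i \<bullet> (y - x0)\<bar> \<le> 1" if "y \<in> closure S" for y i
  proof -
    have "(\<chi> k. if k = i then y - x0 else P $ k) \<in> K" using that P(1) by (auto simp: K_def)
    from P(2)[OF this] have "\<bar>Q $ i \<bullet> (y - x0)\<bar> * \<bar>det P\<bar> \<le> 1 * \<bar>det P\<bar>" by (simp add: cr abs_mult)
    then show ?thesis using dP by (simp add: mult_le_cancel_right)
  qed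
  show ?thesis by (rule that[OF _ dP dQ ex du bd cr]) (use P(1) in \<open>auto simp: K_def\<close>)
qed

section \<open>Normalised sections\<close>

lemma det_scaleR_rows: "det (\<chi> i. c i *\<^sub>R A $ i) = (\<Prod>i\<in>UNIV. c i) * det (A :: real^'n^'n)"
  using det_rows_mul[of c "\<lambda>i. A $ i"] by (simp add: scalar_mult_eq_scaleR)

lemma det_replace_row:
  fixes Q :: "real^'n^'n"
  shows "det (\<chi> i. if i = j then (\<Sum>k\<in>UNIV. l k *\<^sub>R Q $ k) else Q $ i) = l j * det Q"
  using cramer_lemma_transpose[of j "\<chi> k. l k" Q]
  unfolding row_eq_nth scalar_mult_eq_scaleR vec_lambda_beta .

text \<open>The constants in the normalised estimates depend on the dimension and on fractions of the
  height only. This uniformity is what makes the estimates applicable to sections whose height tends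
  to 0. The present one is the number \<open>a\<close> with \<open>(2 \<mu>) ^ (n - 1) * a = (16 n\<^sup>2) ^ n\<close> for
  \<open>\<mu> = (1 - \<theta>) / (8 n)\<close>; with it the quadratic polynomial in \<open>gradient_bound_coord\<close> has determinant
  above 1.\<close>

definition quadratic_det_const :: "real \<Rightarrow> nat \<Rightarrow> real" where
  "quadratic_det_const \<theta> n = (16 * (real n)\<^sup>2) ^ n / (2 * ((1 - \<theta>) / (8 * real n))) ^ (n - 1)"

definition gradient_const :: "real \<Rightarrow> nat \<Rightarrow> real" where
  "gradient_const \<theta> n = 1 + 2 * quadratic_det_const \<theta> n * (1 + 2 * real n) / (1 - \<theta>)"

definition pogorelov_const :: "real \<Rightarrow> real \<Rightarrow> nat \<Rightarrow> real" where
  "pogorelov_const B V n = (2 * real n * B\<^sup>2 + 2 * V * B) * exp (V\<^sup>2 / (2 * B\<^sup>2))"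

lemma le_of_square_le:
  fixes X a b :: real
  assumes "0 \<le> a" "0 \<le> b" and le: "X * X \<le> a * X + b * b"
  shows "X \<le> a + b"
proof (rule ccontr)
  assume "\<not> ?thesis"
  then have g: "a + b < X" by simp
  then have "b * b \<le> b * X" "(a + b) * X < X * X"
    using assms by (auto intro: mult_left_mono mult_strict_right_mono)
  then show False using le by (simp add: distrib_right)
qed

context ma_section
begin

text \<open>The maximum of \<open>(h - v)\<^sup>2 v\<^sub>e\<^sub>e exp (v\<^sub>e\<^sup>2 / (2 B\<^sup>2))\<close> over \<open>{v \<le> h}\<close> is interior, because the
  function vanishes where \<open>v = h\<close>. The length \<open>B\<close> is the scale on which \<open>v\<^sub>e\<close> is measured: \<open>H\<close> if
  \<open>e\<close> is an edge of the normalising simplex, 1 if \<open>e\<close> is a unit vector.\<close>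

lemma pogorelov_section:
  assumes h: "0 < h" "h \<le> H" and e: "e \<noteq> 0" and B: "0 < B" and V: "0 \<le> V"
    and grad: "\<And>y. y \<in> S \<Longrightarrow> v y < h \<Longrightarrow> \<bar>dd e v y\<bar> \<le> V"
    and x: "x \<in> S" "v x < h"
  shows "(h - v x)\<^sup>2 * dd e (dd e v) x \<le> h * pogorelov_const B V CARD('n)"
proof -
  define U where "U = dd e (dd e v)"
  define F where "F = (\<lambda>y. (h - v y)\<^sup>2 * U y * exp ((dd e v y)\<^sup>2 / (2 * B\<^sup>2)))"
  define K where "K = {y \<in> closure S. v y \<le> h}"
  have K: "compact K"
  proof -
    have "closed {y \<in> closure S. v y \<le> h}"
      by (intro continuous_closed_preimage_constant continuous_on_closed_Collect_le continuous_on_D closure_S) auto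
    then show ?thesis unfolding K_def
      by (metis (no_types, lifting) bounded_S bounded_closure bounded_subset compact_eq_bounded_closed mem_Collect_eq subsetI)
  qed
  have KD: "K \<subseteq> D" using closure_S by (auto simp: K_def)
  have "continuous_on K F" unfolding F_def U_def
    using B by (intro continuous_intros continuous_on_D KD) auto
  moreover have xK: "x \<in> K" using x closure_subset by (auto simp: K_def)
  ultimately obtain y where y: "y \<in> K" "\<And>z. z \<in> K \<Longrightarrow> F z \<le> F y"
    using continuous_attains_sup[OF K] by (metis empty_iff)
  have U_pos: "0 < U z" if "z \<in> K" for z using form_pos[OF _ e, of z] that KD by (auto simp: U_def)
  have "0 < F x" unfolding F_def using U_pos[OF xK] x by simp
  then have Fy: "0 < F y" using y(2)[OF xK] by simp
  have vy: "v y < h"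
  proof (rule ccontr)
    assume "\<not> v y < h" then have "v y = h" using y(1) by (auto simp: K_def)
    then show False using Fy by (simp add: F_def)
  qed
  have yS: "y \<in> S" using v_boundary[of y] vy h(2) y(1) by (auto simp: K_def)
  have yD: "y \<in> D" using yS S_sub by blast
  obtain E where E: "orthoframe (hessian v y) E" "E undefined = (1 / sqrt (dd e (dd e v) y)) *\<^sub>R e"
    using frame_exists[OF yD e, of undefined] by blast
  define t where "t = (\<lambda>z. h - v z)"
  have tC: "Ck_on 2 t D" unfolding t_def by (intro Ck_on_diff open_D smooth2 Ck_on_const)
  have t_dd: "dd w t z = - dd w v z" if "z \<in> D" for w z
    unfolding t_def using dd_diff[of "\<lambda>_. h" z v w] differentiable(1)[OF that] by (simp add: dd_const)
  have t_dd2: "dd w (dd w t) y = - dd w (dd w v) y" for w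
    unfolding t_def by (rule dd2_const_minus[OF open_D smooth2 yD])
  have nb: "\<forall>\<^sub>F z in nhds y. z \<in> S \<and> v z < h"
  proof -
    have "open (v -` {..<h} \<inter> S)"
      using continuous_on_open_vimage[OF open_S] continuous_on_D(1)[OF S_sub] open_lessThan by blast
    from eventually_nhds_in_open[OF this, of y] yS vy show ?thesis by (simp add: conj_commute)
  qed
  have mx: "\<forall>\<^sub>F z in nhds y. 2 * ln (t z) + ln (dd e (dd e v) z) + (1 / B\<^sup>2) / 2 * (dd e v z - 0)\<^sup>2 + 0
        \<le> 2 * ln (t y) + ln (dd e (dd e v) y) + (1 / B\<^sup>2) / 2 * (dd e v y - 0)\<^sup>2 + 0"
    using nb
  proof eventually_elim
    case (elim z)
    have zK: "z \<in> K" using elim closure_subset by (auto simp: K_def)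
    have ln: "ln (F z) = 2 * ln (t z) + ln (U z) + (1 / B\<^sup>2) / 2 * (dd e v z)\<^sup>2" if "z \<in> K" "v z < h" for z
      using U_pos[OF that(1)] that(2) unfolding F_def t_def
      by (simp add: ln_mult ln_realpow)
    have "0 < F z" unfolding F_def using U_pos[OF zK] elim by simp
    then have "ln (F z) \<le> ln (F y)" using y(2)[OF zK] Fy by simp
    then show ?case using ln[OF zK] ln[OF y(1) vy] elim by (simp add: U_def)
  qed
  have Lt: "- real CARD('n) \<le> (\<Sum>k\<in>UNIV. dd (E k) (dd (E k) t) y)"
    by (simp add: t_dd2 frame_form[OF yD E(1)] sum_negf)
  have ty: "0 < t y" using vy by (simp add: t_def)
  have P: "1 / B\<^sup>2 * U y \<le> 2 * real CARD('n) / t y + 2 * (dd e t y)\<^sup>2 / ((t y)\<^sup>2 * U y)"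
    using pogorelov_at_max[OF yD e E open_D yD tC ty Lt, where \<rho> = "\<lambda>_. 0" and a = "1 / B\<^sup>2" and \<kappa> = 0 and ?r1.0 = "\<lambda>_. 0" and ?r2.0 = "\<lambda>_. 0"]
      mx by (simp add: jet2_const U_def)
  define X where "X = t y * U y"
  have Uy: "0 < U y" using U_pos y(1) by blast
  have X0: "0 < X" using ty Uy by (simp add: X_def)
  have "(t y)\<^sup>2 * U y * (1 / B\<^sup>2 * U y) \<le> (t y)\<^sup>2 * U y * (2 * real CARD('n) / t y + 2 * (dd e t y)\<^sup>2 / ((t y)\<^sup>2 * U y))"
    using P Uy by (intro mult_left_mono) auto
  also have "\<dots> = 2 * real CARD('n) * X + 2 * (dd e v y)\<^sup>2"
    using ty Uy by (simp add: X_def t_dd[OF yD] field_simps power2_eq_square)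
  also have "(dd e v y)\<^sup>2 \<le> V\<^sup>2" using grad[OF yS vy] V by (simp add: abs_le_square_iff[symmetric])
  finally have "X\<^sup>2 / B\<^sup>2 \<le> 2 * real CARD('n) * X + 2 * V\<^sup>2"
    by (simp add: X_def power2_eq_square mult_ac)
  then have XX: "X\<^sup>2 \<le> B\<^sup>2 * (2 * real CARD('n) * X + 2 * V\<^sup>2)" using B by (simp add: field_simps)
  have XB: "X \<le> 2 * real CARD('n) * B\<^sup>2 + 2 * V * B"
  proof (rule le_of_square_le)
    have "0 \<le> V\<^sup>2 * B\<^sup>2" by simp
    then show "X * X \<le> 2 * real CARD('n) * B\<^sup>2 * X + 2 * V * B * (2 * V * B)"
      using XX by (simp add: power2_eq_square algebra_simps)
  qed (use V B in auto)
  have "(h - v x)\<^sup>2 * U x \<le> F x" unfolding F_def using U_pos[OF xK]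
    mult_left_mono[of 1 "exp ((dd e v x)\<^sup>2 / (2 * B\<^sup>2))" "(h - v x)\<^sup>2 * U x"] by simp
  also have "\<dots> \<le> F y" by (rule y(2)[OF xK])
  also have "F y = t y * X * exp ((dd e v y)\<^sup>2 / (2 * B\<^sup>2))" by (simp add: F_def X_def t_def power2_eq_square)
  also have "\<dots> \<le> h * (2 * real CARD('n) * B\<^sup>2 + 2 * V * B) * exp (V\<^sup>2 / (2 * B\<^sup>2))"
  proof (intro mult_mono)
    show "t y \<le> h" using v_nonneg y(1) by (simp add: t_def K_def)
    show "exp ((dd e v y)\<^sup>2 / (2 * B\<^sup>2)) \<le> exp (V\<^sup>2 / (2 * B\<^sup>2))"
      using \<open>(dd e v y)\<^sup>2 \<le> V\<^sup>2\<close> B by (simp add: divide_right_mono)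
  qed (use XB X0 h V B in auto)
  finally show ?thesis by (simp add: pogorelov_const_def U_def mult.assoc)
qed

end

text \<open>The numbers \<open>Q $ i \<bullet> (y - x0)\<close> are the normalised coordinates of \<open>y\<close>.\<close>

locale ma_section_coords = ma_section D v S x0 H
  for D :: "(real^'n::finite) set" and v S x0 H +
  fixes P Q :: "real^'n^'n"
  assumes P_in: "x0 + P $ i \<in> closure S" and det_P: "det P \<noteq> 0" and det_QP: "det Q * det P = 1"
    and expand: "y = (\<Sum>i\<in>UNIV. (Q $ i \<bullet> y) *\<^sub>R P $ i)"
    and dual: "Q $ i \<bullet> P $ j = (if i = j then 1 else 0)"
    and coord_le: "y \<in> closure S \<Longrightarrow> \<bar>Q $ i \<bullet> (y - x0)\<bar> \<le> 1"
    and det_P_replace: "det (\<chi> i. if i = j then w else P $ i) = (Q $ j \<bullet> w) * det P"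
begin

lemma card_ge1: "1 \<le> real CARD('n)"
  by (simp add: Suc_leI)

lemma P_nz: "P $ i \<noteq> 0"
  using dual[of i i] by auto

lemma coord_le2: "y \<in> closure S \<Longrightarrow> x \<in> closure S \<Longrightarrow> \<bar>Q $ i \<bullet> (y - x)\<bar> \<le> 2"
  using coord_le[of y i] coord_le[of x i] by (auto simp: inner_diff_right abs_if split: if_splits)

lemma det_Q_sq: "(det Q)\<^sup>2 = 1 / (det P)\<^sup>2"
proof -
  have "(det Q * det P)\<^sup>2 = 1" using det_QP by simp
  then show ?thesis using det_P by (simp add: power_mult_distrib field_simps)
qed

text \<open>If the simplex were too small, the polynomial \<open>H / 2 + H / (2 n) \<Sum> c\<^sub>i\<^sup>2\<close> in the normalised
  coordinates \<open>c\<close> would have determinant above 1. It is at most \<open>H\<close> on the section, so it would stay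
  below \<open>v\<close>, but at \<open>x0\<close> it is positive and \<open>v\<close> vanishes.\<close>

lemma det_P_lower: "(H / real CARD('n)) ^ CARD('n) \<le> (det P)\<^sup>2"
proof (rule ccontr)
  assume "\<not> ?thesis"
  then have less: "(det P)\<^sup>2 < (H / real CARD('n)) ^ CARD('n)" by simp
  define r where "r = sqrt (H / real CARD('n))"
  have r: "0 < r" "r\<^sup>2 = H / real CARD('n)" using H_pos card_ge1 by (auto simp: r_def)
  define La :: "real^'n^'n" where "La = (\<chi> i. r *\<^sub>R Q $ i)"
  have "det La = r ^ CARD('n) * det Q" unfolding La_def by (simp add: det_scaleR_rows)
  then have "(det La)\<^sup>2 = (r\<^sup>2) ^ CARD('n) / (det P)\<^sup>2"
    by (simp add: power_mult_distrib det_Q_sq power_mult[symmetric] mult.commute)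
  then have dL: "1 < (det La)\<^sup>2" using less det_P by (simp add: r)
  have sq: "(\<Sum>i\<in>UNIV. (La $ i \<bullet> (y - x0))\<^sup>2) = H / real CARD('n) * (\<Sum>i\<in>UNIV. (Q $ i \<bullet> (y - x0))\<^sup>2)" for y
    by (simp add: La_def power_mult_distrib r sum_distrib_left)
  have "quad (H / 2) 0 La x0 y \<le> H" if "y \<in> closure S" for y
  proof -
    have "(\<Sum>i\<in>UNIV. (Q $ i \<bullet> (y - x0))\<^sup>2) \<le> (\<Sum>i\<in>(UNIV::'n set). 1)"
      by (intro sum_mono) (use coord_le[OF that] in \<open>simp add: abs_square_le_1\<close>)
    then have "H / real CARD('n) * (\<Sum>i\<in>UNIV. (Q $ i \<bullet> (y - x0))\<^sup>2) \<le> H / real CARD('n) * real CARD('n)"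
      using H_pos card_ge1 by (intro mult_left_mono) auto
    then show ?thesis using card_ge1 by (simp add: quad_def sq)
  qed
  from quad_comparison[OF dL this x0_S] have "quad (H / 2) 0 La x0 x0 \<le> v x0" by blast
  then show False using H_pos by (simp add: quad_def v_x0)
qed

text \<open>The simplex contains an ellipsoid around the point \<open>b\<close> with all coordinates \<open>1 / (2 n)\<close>. A
  polynomial \<open>q\<close> that is \<open>0\<close> at \<open>b\<close> and \<open>2 H\<close> on its boundary grows beyond \<open>v\<close>, so \<open>v - q\<close> has an
  interior maximum, where \<open>D\<^sup>2v \<le> D\<^sup>2q\<close>. At that point the volume is bounded by \<open>det_le_prod\<close>.\<close>

lemma det_P_upper: "(det P)\<^sup>2 \<le> (16 * (real CARD('n))\<^sup>2 * H) ^ CARD('n)"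
proof -
  define b where "b = x0 + (\<Sum>i\<in>UNIV. (1 / (2 * real CARD('n))) *\<^sub>R P $ i)"
  define r where "r = 4 * real CARD('n) * sqrt H"
  have r: "r\<^sup>2 = 16 * (real CARD('n))\<^sup>2 * H" using H_pos by (simp add: r_def power_mult_distrib)
  define La :: "real^'n^'n" where "La = (\<chi> i. r *\<^sub>R Q $ i)"
  define q where "q = quad 0 0 La b"
  have q: "q y = 8 * (real CARD('n))\<^sup>2 * H * (\<Sum>i\<in>UNIV. (Q $ i \<bullet> (y - b))\<^sup>2)" for y
    by (simp add: q_def quad_def La_def power_mult_distrib r sum_distrib_left[symmetric])
  have Qb: "Q $ i \<bullet> (b - x0) = 1 / (2 * real CARD('n))" for i
    by (simp add: b_def inner_sum_right dual if_distrib[of "\<lambda>z. _ * z"] cong: if_cong)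
  have inball: "y \<in> closure S" if "q y \<le> 2 * H" for y
  proof -
    define c where "c = (\<lambda>i. Q $ i \<bullet> (y - x0))"
    have "8 * (real CARD('n))\<^sup>2 * H * (\<Sum>i\<in>UNIV. (Q $ i \<bullet> (y - b))\<^sup>2) \<le> 2 * H" using that q by simp
    then have s: "(\<Sum>i\<in>UNIV. (Q $ i \<bullet> (y - b))\<^sup>2) \<le> (1 / (2 * real CARD('n)))\<^sup>2"
      using H_pos card_ge1 by (simp add: field_simps power2_eq_square)
    have "\<bar>Q $ i \<bullet> (y - b)\<bar> \<le> 1 / (2 * real CARD('n))" for i
    proof -
      have "(Q $ i \<bullet> (y - b))\<^sup>2 \<le> (\<Sum>i\<in>UNIV. (Q $ i \<bullet> (y - b))\<^sup>2)" by (rule member_le_sum) auto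
      then have "(Q $ i \<bullet> (y - b))\<^sup>2 \<le> (1 / (2 * real CARD('n)))\<^sup>2" using s by simp
      then show ?thesis using card_ge1 by (simp add: abs_le_square_iff[symmetric])
    qed
    moreover have "c i = Q $ i \<bullet> (y - b) + 1 / (2 * real CARD('n))" for i
      using Qb[of i] by (simp add: c_def inner_diff_right)
    moreover have "1 / real CARD('n) = 1 / (2 * real CARD('n)) + 1 / (2 * real CARD('n))" by simp
    ultimately have c: "0 \<le> c i \<and> c i \<le> 1 / real CARD('n)" for i
      by (smt (verit))
    have cs: "(\<Sum>i\<in>UNIV. c i) \<le> 1"
    proof -
      have "(\<Sum>i\<in>UNIV. c i) \<le> (\<Sum>i\<in>(UNIV::'n set). 1 / real CARD('n))" using c by (intro sum_mono) auto
      then show ?thesis by simp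
    qed
    have "y = x0 + (\<Sum>i\<in>UNIV. c i *\<^sub>R P $ i)" using expand[of "y - x0"] by (simp add: c_def algebra_simps)
    also have "\<dots> = (1 - (\<Sum>i\<in>UNIV. c i)) *\<^sub>R x0 + (\<Sum>i\<in>UNIV. c i *\<^sub>R (x0 + P $ i))"
      by (simp add: scaleR_add_right sum.distrib scaleR_sum_left[symmetric] scaleR_diff_left)
    finally have y: "y = (1 - (\<Sum>i\<in>UNIV. c i)) *\<^sub>R x0 + (\<Sum>i\<in>UNIV. c i *\<^sub>R (x0 + P $ i))" .
    \<comment> \<open>barycentric coordinates with respect to \<open>x0\<close> and the other vertices, indexed by an option
      type\<close>
    define w where "w = (\<lambda>j. case j of None \<Rightarrow> x0 | Some i \<Rightarrow> x0 + P $ i)"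
    define d where "d = (\<lambda>j. case j of None \<Rightarrow> 1 - (\<Sum>i\<in>UNIV. c i) | Some i \<Rightarrow> c i)"
    have UO: "(UNIV :: 'n option set) = insert None (Some ` UNIV)" by (auto simp: UNIV_option_conv)
    have "(\<Sum>j\<in>UNIV. d j *\<^sub>R w j) \<in> closure S"
    proof (rule convex_sum)
      show "convex (closure S)" by (simp add: convex_closure convex_S)
      show "sum d UNIV = 1" unfolding UO by (simp add: d_def sum.reindex)
      show "0 \<le> d j" for j using c cs by (simp add: d_def split: option.split)
      show "w j \<in> closure S" for j using P_in x0_S closure_subset by (auto simp: w_def split: option.split)
    qed auto
    also have "(\<Sum>j\<in>UNIV. d j *\<^sub>R w j) = y" unfolding UO y by (simp add: d_def w_def sum.reindex)
    finally show ?thesis .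
  qed
  have bS: "b \<in> closure S" by (rule inball) (use H_pos in \<open>simp add: q\<close>)
  have "continuous_on (closure S) (\<lambda>y. v y - q y)" unfolding q_def
    by (intro continuous_intros continuous_on_quad continuous_on_D closure_S)
  from continuous_attains_sup[OF compact_closure _ this] bS
  obtain y where y: "y \<in> closure S" "\<And>z. z \<in> closure S \<Longrightarrow> v z - q z \<le> v y - q y"
    by (metis empty_iff)
  have "0 \<le> v b - q b" using v_nonneg[OF bS] by (simp add: q)
  then have "q y \<le> v y" using y(2)[OF bS] by simp
  then have qy: "q y < 2 * H" using v_le[OF y(1)] H_pos by simp
  have "open {z. q z < 2 * H}" unfolding q_def
    by (intro open_Collect_less continuous_on_quad) auto
  from eventually_nhds_in_open[OF this, of y] qy
  have "\<forall>\<^sub>F z in nhds y. v z - quad 0 0 La b z \<le> v y - quad 0 0 La b y"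
    by simp (erule eventually_mono, use y(2) inball in \<open>auto simp: q_def less_imp_le\<close>)
  then have le: "dd w (dd w v) y \<le> (\<Sum>i\<in>UNIV. (La $ i \<bullet> w)\<^sup>2)" for w
    using second_derivative_le_at_max y(1) closure_S by blast
  have yD: "y \<in> D" using y(1) closure_S by blast
  have "(det P)\<^sup>2 = (det (\<chi> i. P $ i))\<^sup>2" by simp
  also have "\<dots> \<le> (\<Prod>i\<in>UNIV. dd (P $ i) (dd (P $ i) v) y)" by (rule det_le_prod[OF yD])
  also have "\<dots> \<le> (\<Prod>i\<in>(UNIV::'n set). 16 * (real CARD('n))\<^sup>2 * H)"
  proof (intro prod_mono conjI)
    fix i
    show "0 \<le> dd (P $ i) (dd (P $ i) v) y" by (rule form_nonneg[OF yD])
    have "(\<Sum>k\<in>UNIV. (La $ k \<bullet> P $ i)\<^sup>2) = (\<Sum>k\<in>UNIV. if k = i then r\<^sup>2 else 0)"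
      by (intro sum.cong refl) (simp add: La_def dual)
    then show "dd (P $ i) (dd (P $ i) v) y \<le> 16 * (real CARD('n))\<^sup>2 * H" using le[of "P $ i"] by (simp add: r)
  qed
  finally show ?thesis by simp
qed

text \<open>Let \<open>G\<close> be the largest derivative of \<open>v\<close> at \<open>x\<close> along an edge, attained for the edge \<open>j\<close>, and
  let \<open>g\<close> be the gradient. By convexity \<open>s = (H - g \<bullet> (y - x)) / G\<close> lies between \<open>0\<close> and
  \<open>s1 = 1 + 2 n\<close> on the section (if \<open>G > H\<close>), so the polynomial
  \<open>H - \<mu> H \<Sum>\<^sub>i (4 - c\<^sub>i\<^sup>2) - a H s (s1 - s)\<close>, with \<open>c\<close> the coordinates relative to \<open>x\<close> and \<open>i\<close>
  different from \<open>j\<close>, is at most \<open>H\<close> there. Its determinant is twice the bound of \<open>det_P_upper\<close> over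
  \<open>(det P)\<^sup>2\<close>. Hence it is at most \<open>v\<close> at \<open>x\<close>, where \<open>s = H / G\<close> and \<open>c = 0\<close>: this bounds \<open>H / G\<close>
  from below.\<close>

lemma gradient_bound_coord:
  assumes th: "0 < \<theta>" "\<theta> < 1" and x: "x \<in> S" "v x \<le> \<theta> * H"
  shows "\<bar>dd (P $ i) v x\<bar> \<le> gradient_const \<theta> CARD('n) * H"
proof -
  let ?n = "CARD('n)"
  define l where "l = (\<lambda>i. dd (P $ i) v x)"
  define G where "G = Max (range (\<lambda>i. \<bar>l i\<bar>))"
  have Gi: "\<bar>l i\<bar> \<le> G" for i unfolding G_def by (rule Max_ge) auto
  obtain j where j: "\<bar>l j\<bar> = G"
    using Max_in[of "range (\<lambda>i. \<bar>l i\<bar>)"] unfolding G_def by fastforce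
  define \<mu> where "\<mu> = (1 - \<theta>) / (8 * real CARD('n))"
  define a where "a = quadratic_det_const \<theta> ?n"
  have mu: "0 < \<mu>" using th card_ge1 by (simp add: \<mu>_def)
  have a_eq: "(2 * \<mu>) ^ (?n - 1) * a = (16 * (real CARD('n))\<^sup>2) ^ ?n"
    using mu by (simp add: a_def quadratic_det_const_def \<mu>_def[symmetric])
  have a: "0 < a"
    unfolding a_def quadratic_det_const_def \<mu>_def[symmetric] using mu card_ge1
    by (intro divide_pos_pos zero_less_power) auto
  have GC: "G \<le> gradient_const \<theta> ?n * H"
  proof (cases "G \<le> H")
    case True
    have "1 \<le> gradient_const \<theta> ?n" unfolding gradient_const_def a_def[symmetric] using a th card_ge1 by simp
    then have "1 * H \<le> gradient_const \<theta> ?n * H" using H_pos by (intro mult_right_mono) auto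
    then show ?thesis using True by simp
  next
    case False
    then have G: "H < G" "0 < G" using H_pos by auto
    have xD: "x \<in> D" and xc: "x \<in> closure S" using x S_sub closure_subset by auto
    have dx: "v differentiable (at x)" using differentiable(1)[OF xD] .
    define g where "g = (\<Sum>k\<in>UNIV. l k *\<^sub>R Q $ k)"
    have g: "dd w v x = g \<bullet> w" for w
    proof -
      have "dd w v x = dd (\<Sum>i\<in>UNIV. (Q $ i \<bullet> w) *\<^sub>R P $ i) v x" using expand[of w] by simp
      also have "\<dots> = (\<Sum>i\<in>UNIV. (Q $ i \<bullet> w) * l i)"
        by (simp add: dd_sum_dir[OF dx] dd_scaleR_dir[OF dx] l_def)
      finally show ?thesis by (simp add: g_def inner_sum_left mult.commute)
    qed
    define s1 where "s1 = 1 + 2 * real CARD('n)"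
    define s where "s = (\<lambda>y. (H - g \<bullet> (y - x)) / G)"
    have s0: "0 \<le> s y" and s1: "s y \<le> s1" if y: "y \<in> closure S" for y
    proof -
      have "closed_segment x y \<subseteq> D"
        using closed_segment_subset[OF xc y convex_closure[OF convex_S]] closure_S by auto
      then have "v x + g \<bullet> (y - x) \<le> v y" using tangent_le g by metis
      then have "g \<bullet> (y - x) \<le> H" using v_le[OF y] v_nonneg[OF xc] by simp
      then show "0 \<le> s y" using G by (simp add: s_def)
      have "- (g \<bullet> (y - x)) = (\<Sum>k\<in>UNIV. - (l k * (Q $ k \<bullet> (y - x))))"
        by (simp add: g_def inner_sum_left sum_negf)
      also have "\<dots> \<le> (\<Sum>k\<in>(UNIV::'n set). G * 2)"
      proof (intro sum_mono)
        fix k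
        have "\<bar>l k * (Q $ k \<bullet> (y - x))\<bar> \<le> G * 2" unfolding abs_mult
          by (intro mult_mono Gi coord_le2 y xc) (use G in auto)
        then show "- (l k * (Q $ k \<bullet> (y - x))) \<le> G * 2" by linarith
      qed
      finally have "H - g \<bullet> (y - x) \<le> G + 2 * real CARD('n) * G" using G by simp
      also have "\<dots> = s1 * G" by (simp add: s1_def algebra_simps)
      finally show "s y \<le> s1" using G by (simp add: s_def pos_divide_le_eq)
    qed
    define La :: "real^'n^'n" where "La = (\<chi> i. (if i = j then sqrt (2 * a * H) / G else sqrt (2 * \<mu> * H)) *\<^sub>R
        (if i = j then g else Q $ i))"
    \<comment> \<open>in the dual basis, \<open>g\<close> has the coefficient \<open>l j\<close> of absolute value \<open>G\<close> in position \<open>j\<close>, which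
      cancels the division by \<open>G\<close>\<close>
    have "det La = (\<Prod>i\<in>UNIV. if i = j then sqrt (2 * a * H) / G else sqrt (2 * \<mu> * H)) *
        det (\<chi> i. if i = j then g else Q $ i)"
      unfolding La_def using det_scaleR_rows[of _ "\<chi> i. if i = j then g else Q $ i"] by simp
    also have "det (\<chi> i. if i = j then g else Q $ i) = l j * det Q"
      unfolding g_def by (rule det_replace_row)
    also have "(\<Prod>i\<in>UNIV. if i = j then sqrt (2 * a * H) / G else sqrt (2 * \<mu> * H)) =
        sqrt (2 * a * H) / G * sqrt (2 * \<mu> * H) ^ (?n - 1)"
    proof -
      have "(\<Prod>i\<in>UNIV - {j}. if i = j then sqrt (2 * a * H) / G else sqrt (2 * \<mu> * H)) =
          (\<Prod>i\<in>UNIV - {j}. sqrt (2 * \<mu> * H))" by (rule prod.cong) auto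
      then show ?thesis by (subst prod.remove[of UNIV j]) (auto simp: card_Diff_singleton)
    qed
    finally have dLa: "det La = sqrt (2 * a * H) / G * sqrt (2 * \<mu> * H) ^ (?n - 1) * (l j * det Q)" .
    have "(det La)\<^sup>2 = (2 * a * H) / G\<^sup>2 * (2 * \<mu> * H) ^ (?n - 1) * ((l j)\<^sup>2 * (1 / (det P)\<^sup>2))"
    proof -
      have "(sqrt (2 * \<mu> * H) ^ (?n - 1))\<^sup>2 = (2 * \<mu> * H) ^ (?n - 1)"
        unfolding real_sqrt_power[symmetric] using mu H_pos by (simp add: real_sqrt_abs)
      then show ?thesis unfolding dLa using a H_pos
        by (simp only: power_mult_distrib power_divide det_Q_sq) simp
    qed
    also have "(l j)\<^sup>2 = G\<^sup>2" using j by (metis power2_abs)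
    also have "(2 * a * H) / G\<^sup>2 * (2 * \<mu> * H) ^ (?n - 1) * (G\<^sup>2 * (1 / (det P)\<^sup>2)) =
        2 * ((2 * \<mu>) ^ (?n - 1) * a) * (H * H ^ (?n - 1)) / (det P)\<^sup>2"
      using G by (simp add: power_mult_distrib)
    also have "H * H ^ (?n - 1) = H ^ ?n" by (simp add: power_eq_if)
    also have "2 * ((2 * \<mu>) ^ (?n - 1) * a) * H ^ ?n = 2 * (16 * (real CARD('n))\<^sup>2 * H) ^ ?n"
      unfolding a_eq by (simp add: power_mult_distrib)
    finally have dL: "(det La)\<^sup>2 = 2 * (16 * (real CARD('n))\<^sup>2 * H) ^ ?n / (det P)\<^sup>2" .
    have "(det P)\<^sup>2 < 2 * (16 * (real CARD('n))\<^sup>2 * H) ^ ?n"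
      using det_P_upper H_pos card_ge1 by (smt (verit) zero_less_power zero_less_mult_iff)
    then have dL1: "1 < (det La)\<^sup>2" unfolding dL using det_P by simp
    have sq: "(\<Sum>i\<in>UNIV. (La $ i \<bullet> w)\<^sup>2) = 2 * a * H * (g \<bullet> w / G)\<^sup>2 + (\<Sum>i\<in>UNIV-{j}. 2 * \<mu> * H * (Q $ i \<bullet> w)\<^sup>2)" for w
    proof -
      have "(\<Sum>i\<in>UNIV-{j}. (La $ i \<bullet> w)\<^sup>2) = (\<Sum>i\<in>UNIV-{j}. 2 * \<mu> * H * (Q $ i \<bullet> w)\<^sup>2)"
        using mu H_pos by (intro sum.cong refl) (auto simp: La_def power_mult_distrib)
      moreover have "(La $ j \<bullet> w)\<^sup>2 = 2 * a * H * (g \<bullet> w / G)\<^sup>2"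
        using a H_pos by (simp add: La_def power_mult_distrib power_divide)
      ultimately show ?thesis by (subst sum.remove[of UNIV j]) auto
    qed
    \<comment> \<open>the polynomial \<open>H - \<mu> H \<Sum>\<^sub>i (4 - c\<^sub>i\<^sup>2) - a H s (s1 - s)\<close> expanded around \<open>x\<close>\<close>
    define c0 where "c0 = H - 4 * \<mu> * H * (real CARD('n) - 1) - a * H * (H / G) * (s1 - H / G)"
    define b where "b = ((a * H * s1 - 2 * a * H * (H / G)) / G) *\<^sub>R g"
    have q: "quad c0 b La x y = H - \<mu> * H * (\<Sum>i\<in>UNIV-{j}. 4 - (Q $ i \<bullet> (y - x))\<^sup>2) - a * H * s y * (s1 - s y)" for y
    proof -
      define \<tau> where "\<tau> = g \<bullet> (y - x) / G"
      have s_eq: "s y = H / G - \<tau>" by (simp add: s_def \<tau>_def diff_divide_distrib)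
      have b_eq: "b \<bullet> (y - x) = (a * H * s1 - 2 * a * H * (H / G)) * \<tau>" by (simp add: b_def \<tau>_def)
      have card: "real (card (UNIV - {j})) = real CARD('n) - 1" by (simp add: card_Diff_singleton of_nat_diff Suc_leI)
      have e1: "(\<Sum>i\<in>UNIV-{j}. 4 - (Q $ i \<bullet> (y - x))\<^sup>2) = 4 * (real CARD('n) - 1) - (\<Sum>i\<in>UNIV-{j}. (Q $ i \<bullet> (y - x))\<^sup>2)"
        unfolding sum_subtractf using card by simp
      have e2: "(\<Sum>i\<in>UNIV-{j}. 2 * \<mu> * H * (Q $ i \<bullet> (y - x))\<^sup>2) = 2 * \<mu> * H * (\<Sum>i\<in>UNIV-{j}. (Q $ i \<bullet> (y - x))\<^sup>2)"
        by (rule sum_distrib_left[symmetric])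
      have "H - 4 * \<mu> * H * n' - a * H * h * (s1 - h) + (a * H * s1 - 2 * a * H * h) * \<tau> + (2 * a * H * \<tau>\<^sup>2 + 2 * \<mu> * H * r) / 2
          = H - \<mu> * H * (4 * n' - r) - a * H * (h - \<tau>) * (s1 - (h - \<tau>))" for h r n'
        by (simp add: algebra_simps power2_eq_square)
      then show ?thesis unfolding quad_def sq b_eq \<tau>_def[symmetric] s_eq c0_def e1 e2 .
    qed
    have "quad c0 b La x y \<le> H" if y: "y \<in> closure S" for y
    proof -
      have "0 \<le> (\<Sum>i\<in>UNIV-{j}. 4 - (Q $ i \<bullet> (y - x))\<^sup>2)"
      proof (intro sum_nonneg)
        fix i
        have "(Q $ i \<bullet> (y - x))\<^sup>2 \<le> 2\<^sup>2" using coord_le2[OF y xc, of i] abs_le_square_iff[of _ "2::real"] by simp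
        then show "0 \<le> 4 - (Q $ i \<bullet> (y - x))\<^sup>2" by simp
      qed
      then have "0 \<le> \<mu> * H * (\<Sum>i\<in>UNIV-{j}. 4 - (Q $ i \<bullet> (y - x))\<^sup>2)" using mu H_pos by simp
      moreover have "0 \<le> a * H * s y * (s1 - s y)" using a H_pos s0[OF y] s1[OF y] by simp
      ultimately show ?thesis unfolding q by linarith
    qed
    from quad_comparison[OF dL1 this x(1)] have "c0 \<le> \<theta> * H" using x(2) by (force simp: quad_def)
    then have "H * (1 - 4 * \<mu> * (real CARD('n) - 1) - \<theta>) \<le> H * (a * (H / G) * (s1 - H / G))"
      unfolding c0_def by (simp add: algebra_simps)
    then have "1 - 4 * \<mu> * (real CARD('n) - 1) - \<theta> \<le> a * (H / G) * (s1 - H / G)"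
      using H_pos by (simp only: mult_le_cancel_left_pos)
    also have "\<dots> \<le> a * (H / G) * s1" using a H_pos G by (intro mult_left_mono) auto
    finally have f: "1 - 4 * \<mu> * (real CARD('n) - 1) - \<theta> \<le> a * (H / G) * s1" .
    have "4 * \<mu> * (real CARD('n) - 1) \<le> 4 * \<mu> * real CARD('n)" using mu by simp
    also have "\<dots> = (1 - \<theta>) / 2" using card_ge1 by (simp add: \<mu>_def)
    finally have m: "4 * \<mu> * (real CARD('n) - 1) \<le> (1 - \<theta>) / 2" .
    have "(1 - \<theta>) / 2 \<le> Y" if "M \<le> (1 - \<theta>) / 2" "1 - M - \<theta> \<le> Y" for M Y :: real
      using that by (simp add: field_simps)
    from this[OF m f] have "(1 - \<theta>) / 2 \<le> a * (H / G) * s1" .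
    then have "(1 - \<theta>) / 2 \<le> a * s1 * H / G" by (simp add: mult_ac)
    then have "G * (1 - \<theta>) \<le> 2 * a * s1 * H" using G by (simp add: field_simps)
    then have "G \<le> 2 * a * s1 / (1 - \<theta>) * H" using th by (simp add: field_simps)
    also have "\<dots> \<le> gradient_const \<theta> ?n * H"
      unfolding gradient_const_def a_def[symmetric] s1_def using H_pos by (intro mult_right_mono) auto
    finally show ?thesis .
  qed
  show ?thesis using Gi[of i] GC by (simp add: l_def)
qed

end

section \<open>A Harnack inequality in sections\<close>

text \<open>Pogorelov's estimate on \<open>{v < \<theta>' H}\<close>, read off on \<open>{v \<le> \<theta> H}\<close>.\<close>

definition hessian_const :: "real \<Rightarrow> real \<Rightarrow> nat \<Rightarrow> real" where
  "hessian_const \<theta> \<theta>' n = pogorelov_const 1 (gradient_const \<theta>' n) n / (\<theta>' - \<theta>)\<^sup>2"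

definition ellipticity_const :: "real \<Rightarrow> real \<Rightarrow> nat \<Rightarrow> real" where
  "ellipticity_const \<theta> \<theta>' n = 1 / (real n ^ n * hessian_const \<theta> \<theta>' n ^ (n - 1))"

lemma pogorelov_const_scale:
  assumes "0 < H"
  shows "pogorelov_const H (c * H) n = H\<^sup>2 * pogorelov_const 1 c n"
  using assms by (simp add: pogorelov_const_def power_mult_distrib power2_eq_square algebra_simps)

lemma quadratic_det_const_pos: "\<theta> < 1 \<Longrightarrow> 0 < n \<Longrightarrow> 0 < quadratic_det_const \<theta> n"
  unfolding quadratic_det_const_def by (intro divide_pos_pos zero_less_power) auto

lemma gradient_const_ge1: "\<theta> < 1 \<Longrightarrow> 0 < n \<Longrightarrow> 1 \<le> gradient_const \<theta> n"
  unfolding gradient_const_def using quadratic_det_const_pos[of \<theta> n] by simp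

lemma hessian_const_pos:
  assumes "\<theta> < \<theta>'" "\<theta>' < 1" "0 < n"
  shows "0 < hessian_const \<theta> \<theta>' n"
proof -
  have "0 < gradient_const \<theta>' n" using gradient_const_ge1[of \<theta>' n] assms by simp
  then show ?thesis unfolding hessian_const_def pogorelov_const_def using assms
    by (intro divide_pos_pos mult_pos_pos add_pos_pos) auto
qed

context ma_section_coords
begin

lemma hessian_bound_coord:
  assumes th: "0 < \<theta>" "\<theta> < \<theta>'" "\<theta>' < 1" and x: "x \<in> S" "v x \<le> \<theta> * H"
  shows "dd (P $ i) (dd (P $ i) v) x \<le> hessian_const \<theta> \<theta>' CARD('n) * H"
proof -
  let ?C = "gradient_const \<theta>' CARD('n)"
  let ?U = "dd (P $ i) (dd (P $ i) v) x"
  have xD: "x \<in> D" using x S_sub by blast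
  have C0: "0 \<le> ?C * H" using gradient_const_ge1[of \<theta>' "CARD('n)"] th H_pos by simp
  have h: "0 < \<theta>' * H" "\<theta>' * H \<le> H" using th H_pos by auto
  have lt: "\<theta> * H < \<theta>' * H" using th H_pos by simp
  have gr: "\<bar>dd (P $ i) v y\<bar> \<le> ?C * H" if "y \<in> S" "v y < \<theta>' * H" for y
    using gradient_bound_coord[of \<theta>' y i] that th by simp
  have "(\<theta>' * H - v x)\<^sup>2 * ?U \<le> \<theta>' * H * pogorelov_const H (?C * H) CARD('n)"
    by (rule pogorelov_section[OF h P_nz H_pos C0 gr x(1)]) (use x(2) lt in auto)
  also have "\<dots> = \<theta>' * H * (H\<^sup>2 * pogorelov_const 1 ?C CARD('n))"
    by (simp add: pogorelov_const_scale[OF H_pos])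
  also have "\<dots> \<le> 1 * H * (H\<^sup>2 * pogorelov_const 1 ?C CARD('n))"
  proof -
    have "0 \<le> pogorelov_const 1 ?C CARD('n)"
      using gradient_const_ge1[of \<theta>' "CARD('n)"] th unfolding pogorelov_const_def by simp
    then show ?thesis using th H_pos by (intro mult_right_mono) auto
  qed
  finally have 1: "(\<theta>' * H - v x)\<^sup>2 * ?U \<le> H ^ 3 * pogorelov_const 1 ?C CARD('n)"
    by (simp add: power3_eq_cube power2_eq_square mult_ac)
  have "((\<theta>' - \<theta>) * H)\<^sup>2 \<le> (\<theta>' * H - v x)\<^sup>2"
    by (rule power_mono) (use x(2) lt th H_pos in \<open>auto simp: algebra_simps\<close>)
  then have "((\<theta>' - \<theta>) * H)\<^sup>2 * ?U \<le> H ^ 3 * pogorelov_const 1 ?C CARD('n)"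
    using 1 mult_right_mono[OF _ form_nonneg[OF xD]] order_trans by blast
  then have "H\<^sup>2 * ((\<theta>' - \<theta>)\<^sup>2 * ?U) \<le> H\<^sup>2 * (H * pogorelov_const 1 ?C CARD('n))"
    by (simp add: power_mult_distrib power3_eq_cube power2_eq_square mult_ac)
  then have "(\<theta>' - \<theta>)\<^sup>2 * ?U \<le> H * pogorelov_const 1 ?C CARD('n)"
    using H_pos by simp
  then show ?thesis using th unfolding hessian_const_def by (simp add: pos_le_divide_eq mult.commute)
qed

lemma directional_gradient_bound:
  assumes th: "0 < \<theta>" "\<theta> < 1" and x: "x \<in> S" "v x \<le> \<theta> * H" and y: "y \<in> closure S" "z \<in> closure S"
  shows "\<bar>dd (y - z) v x\<bar> \<le> 2 * real CARD('n) * gradient_const \<theta> CARD('n) * H"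
proof -
  have d: "v differentiable (at x)" using x S_sub differentiable(1) by blast
  have "dd (y - z) v x = dd (\<Sum>i\<in>UNIV. (Q $ i \<bullet> (y - z)) *\<^sub>R P $ i) v x"
    using expand[of "y - z"] by simp
  also have "\<dots> = (\<Sum>i\<in>UNIV. (Q $ i \<bullet> (y - z)) * dd (P $ i) v x)"
    by (simp add: dd_sum_dir[OF d] dd_scaleR_dir[OF d])
  also have "\<bar>\<dots>\<bar> \<le> (\<Sum>i\<in>(UNIV::'n set). 2 * (gradient_const \<theta> CARD('n) * H))"
    unfolding abs_mult
    by (rule order_trans[OF sum_abs], rule sum_mono, unfold abs_mult)
      (intro mult_mono coord_le2 y gradient_bound_coord th x; simp)
  finally show ?thesis by simp
qed

lemma directional_hessian_bound:
  assumes th: "0 < \<theta>" "\<theta> < \<theta>'" "\<theta>' < 1" and x: "x \<in> S" "v x \<le> \<theta> * H" and y: "y \<in> closure S" "z \<in> closure S"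
  shows "dd (y - z) (dd (y - z) v) x \<le> 4 * (real CARD('n))\<^sup>2 * hessian_const \<theta> \<theta>' CARD('n) * H"
proof -
  have xD: "x \<in> D" using x S_sub by blast
  have "dd (y - z) (dd (y - z) v) x = dd (\<Sum>i\<in>UNIV. (Q $ i \<bullet> (y - z)) *\<^sub>R P $ i) (dd (\<Sum>i\<in>UNIV. (Q $ i \<bullet> (y - z)) *\<^sub>R P $ i) v) x"
    using expand[of "y - z"] by simp
  also have "\<dots> \<le> real CARD('n) * (\<Sum>i\<in>UNIV. dd ((Q $ i \<bullet> (y - z)) *\<^sub>R P $ i) (dd ((Q $ i \<bullet> (y - z)) *\<^sub>R P $ i) v) x)"
    by (rule form_sum_le[OF xD])
  also have "(\<Sum>i\<in>UNIV. dd ((Q $ i \<bullet> (y - z)) *\<^sub>R P $ i) (dd ((Q $ i \<bullet> (y - z)) *\<^sub>R P $ i) v) x)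
      = (\<Sum>i\<in>UNIV. (Q $ i \<bullet> (y - z))\<^sup>2 * dd (P $ i) (dd (P $ i) v) x)"
    by (simp add: form_scaleR[OF xD] power2_eq_square)
  also have "\<dots> \<le> (\<Sum>i\<in>(UNIV::'n set). 2\<^sup>2 * (hessian_const \<theta> \<theta>' CARD('n) * H))"
  proof (intro sum_mono mult_mono hessian_bound_coord th x)
    show "(Q $ i \<bullet> (y - z))\<^sup>2 \<le> 2\<^sup>2" for i
      using coord_le2[OF y, of i] abs_le_square_iff[of _ "2::real"] by simp
  qed (use form_nonneg[OF xD] in auto)
  finally show ?thesis by (simp add: power2_eq_square)
qed

text \<open>Replace the edge \<open>j\<close> by \<open>w\<close> in \<open>det_le_prod\<close>: the volume is known from below, and the second
  derivatives along the remaining edges from above.\<close>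

lemma hessian_lower_bound_coord:
  assumes th: "0 < \<theta>" "\<theta> < \<theta>'" "\<theta>' < 1" and x: "x \<in> S" "v x \<le> \<theta> * H"
  shows "ellipticity_const \<theta> \<theta>' CARD('n) * H * (Q $ j \<bullet> w)\<^sup>2 \<le> dd w (dd w v) x"
proof -
  let ?n = "CARD('n)"
  let ?C = "hessian_const \<theta> \<theta>' ?n"
  have xD: "x \<in> D" using x S_sub by blast
  have C: "0 < ?C" by (rule hessian_const_pos) (use th in auto)
  define F where "F = (\<lambda>i. if i = j then w else P $ i)"
  have "(Q $ j \<bullet> w)\<^sup>2 * (det P)\<^sup>2 = (det (\<chi> i. F i))\<^sup>2"
    unfolding F_def det_P_replace by (simp add: power_mult_distrib)
  also have "\<dots> \<le> (\<Prod>i\<in>UNIV. dd (F i) (dd (F i) v) x)" by (rule det_le_prod[OF xD])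
  also have "\<dots> = dd w (dd w v) x * (\<Prod>i\<in>UNIV-{j}. dd (P $ i) (dd (P $ i) v) x)"
    by (subst prod.remove[of UNIV j]) (auto simp: F_def intro!: prod.cong)
  also have "\<dots> \<le> dd w (dd w v) x * (\<Prod>i\<in>UNIV-{j}. ?C * H)"
    by (intro mult_left_mono prod_mono conjI form_nonneg[OF xD] hessian_bound_coord th x)
  also have "(\<Prod>i\<in>UNIV-{j}. ?C * H) = (?C * H) ^ (?n - 1)" by (simp add: card_Diff_singleton)
  finally have 1: "(Q $ j \<bullet> w)\<^sup>2 * (det P)\<^sup>2 \<le> dd w (dd w v) x * (?C * H) ^ (?n - 1)" .
  have "(Q $ j \<bullet> w)\<^sup>2 * (H / real ?n) ^ ?n \<le> (Q $ j \<bullet> w)\<^sup>2 * (det P)\<^sup>2"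
    by (intro mult_left_mono det_P_lower) auto
  then have 2: "(Q $ j \<bullet> w)\<^sup>2 * (H / real ?n) ^ ?n \<le> dd w (dd w v) x * (?C * H) ^ (?n - 1)" using 1 by simp
  have pos: "0 < (?C * H) ^ (?n - 1)" using C H_pos by simp
  have "H ^ ?n = H * H ^ (?n - 1)" by (simp add: power_eq_if)
  then have "ellipticity_const \<theta> \<theta>' ?n * H * (Q $ j \<bullet> w)\<^sup>2 = (Q $ j \<bullet> w)\<^sup>2 * (H / real ?n) ^ ?n / (?C * H) ^ (?n - 1)"
    using C H_pos by (simp add: ellipticity_const_def power_divide power_mult_distrib field_simps)
  also have "\<dots> \<le> dd w (dd w v) x" using 2 pos by (simp add: pos_divide_le_eq)
  finally show ?thesis .
qed

lemma convex_v: "convex_on S v"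
  by (rule convex_on_subset_D[OF convex_S S_sub])

lemma strict_tangent_bound:
  assumes th: "0 < \<theta>" "\<theta> < \<theta>'" "\<theta>' < 1" and x: "x \<in> S" "v x \<le> \<theta> * H" and z: "z \<in> S" "v z \<le> \<theta> * H"
  shows "ellipticity_const \<theta> \<theta>' CARD('n) * H * (Q $ j \<bullet> (x - z))\<^sup>2 / 2 \<le> v x - v z - dd (x - z) v z"
proof -
  have seg: "closed_segment z x \<subseteq> S" by (rule closed_segment_subset[OF z(1) x(1) convex_S])
  have "v z + dd (x - z) v z + (ellipticity_const \<theta> \<theta>' CARD('n) * H * (Q $ j \<bullet> (x - z))\<^sup>2) / 2 \<le> v x"
  proof (rule tangent_below)
    show "closed_segment z x \<subseteq> D" using seg S_sub by blast
    fix p assume p: "p \<in> closed_segment z x"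
    then obtain s where s: "0 \<le> s" "s \<le> 1" "p = (1 - s) *\<^sub>R z + s *\<^sub>R x" unfolding closed_segment_def by auto
    have "v p \<le> (1 - s) * v z + s * v x"
      unfolding s(3) by (rule convex_onD[OF convex_v s(1,2) z(1) x(1)])
    also have "\<dots> \<le> (1 - s) * (\<theta> * H) + s * (\<theta> * H)" using s x z by (intro add_mono mult_left_mono) auto
    finally have "v p \<le> \<theta> * H" by (simp add: algebra_simps)
    then show "ellipticity_const \<theta> \<theta>' CARD('n) * H * (Q $ j \<bullet> (x - z))\<^sup>2 \<le> dd (x - z) (dd (x - z) v) p"
      using hessian_lower_bound_coord[OF th _ _] p seg by blast
  qed
  then show ?thesis by linarith
qed

text \<open>The edges of the simplex are no longer than \<open>T\<close>, so a long vector has a large coordinate.\<close>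

lemma exists_large_coord:
  assumes T: "\<And>y. y \<in> closure S \<Longrightarrow> norm (y - x0) \<le> T" and w: "\<rho> \<le> norm w" and T0: "0 < T"
  shows "\<exists>j. \<rho> / (real CARD('n) * T) \<le> \<bar>Q $ j \<bullet> w\<bar>"
proof (rule ccontr)
  assume "\<not> ?thesis"
  then have c: "\<bar>Q $ j \<bullet> w\<bar> < \<rho> / (real CARD('n) * T)" for j by (simp add: not_le)
  have PT: "norm (P $ i) \<le> T" for i using T[OF P_in[of i]] by simp
  have "norm w = norm (\<Sum>i\<in>UNIV. (Q $ i \<bullet> w) *\<^sub>R P $ i)" using expand[of w] by simp
  also have "\<dots> \<le> (\<Sum>i\<in>UNIV. \<bar>Q $ i \<bullet> w\<bar> * norm (P $ i))" by (rule order_trans[OF norm_sum]) simp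
  also have "\<dots> \<le> (\<Sum>i\<in>UNIV. \<bar>Q $ i \<bullet> w\<bar> * T)" using PT by (intro sum_mono mult_left_mono) auto
  also have "\<dots> < (\<Sum>i\<in>(UNIV::'n set). \<rho> / (real CARD('n) * T) * T)"
    using c T0 by (intro sum_strict_mono mult_strict_right_mono) auto
  also have "\<dots> = \<rho>" using T0 by simp
  finally show False using w by simp
qed

end

text \<open>The next constants belong to the barrier with centre \<open>z\<close>, \<open>r\<close> being the distance to \<open>z\<close>
  relative to the size of the section. In units of the height, the first three are the least gap
  between \<open>v\<close> and its tangent plane at \<open>z\<close>, the largest value of \<open>k\<close>, and the least squared dual
  norm of the gradient that drives the barrier; the last one is the exponent \<open>\<alpha>\<close> that makes the
  gradient term outweigh \<open>n\<close>.\<close>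

definition tangent_gap_const :: "real \<Rightarrow> real \<Rightarrow> real \<Rightarrow> nat \<Rightarrow> real" where
  "tangent_gap_const \<theta> \<theta>' r n = ellipticity_const \<theta> \<theta>' n * (r / real n)\<^sup>2 / 2"

definition barrier_height_const :: "real \<Rightarrow> nat \<Rightarrow> real" where
  "barrier_height_const \<theta> n = 1 + 2 * real n * gradient_const \<theta> n"

definition barrier_gradient_const :: "real \<Rightarrow> real \<Rightarrow> real \<Rightarrow> real \<Rightarrow> nat \<Rightarrow> real" where
  "barrier_gradient_const \<theta>\<^sub>0 \<theta> \<theta>' r n =
     ((\<theta> - \<theta>\<^sub>0) * tangent_gap_const \<theta> \<theta>' r n / barrier_height_const \<theta> n)\<^sup>2 / (4 * (real n)\<^sup>2 * hessian_const \<theta> \<theta>' n)"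

definition barrier_exponent :: "real \<Rightarrow> real \<Rightarrow> real \<Rightarrow> real \<Rightarrow> nat \<Rightarrow> real" where
  "barrier_exponent \<theta>\<^sub>0 \<theta> \<theta>' r n = (real n + 1) * barrier_height_const \<theta> n / barrier_gradient_const \<theta>\<^sub>0 \<theta> \<theta>' r n"

context ma_section_coords
begin

text \<open>Here \<open>k\<close> is affine, so up to the factor \<open>\<alpha> exp (\<alpha> t / k)\<close> the only second-order terms are that
  of \<open>t\<close> and the square of \<open>\<nabla>t - (t / k) \<nabla>k\<close>.\<close>

lemma barrier_jet:
  assumes x: "x \<in> S" and zD: "z \<in> D" and k_pos: "0 < h - (v z + dd (x - z) v z)"
  defines "t \<equiv> \<lambda>y. h - v y" and "k \<equiv> \<lambda>y. h - (v z + dd (y - z) v z)"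
  shows "jet2 (\<lambda>s. k (x + s *\<^sub>R w) * (exp (\<alpha> * (t (x + s *\<^sub>R w) / k (x + s *\<^sub>R w))) - 1))
     (k x * (exp (\<alpha> * (t x / k x)) - 1))
     (- dd w v z * (exp (\<alpha> * (t x / k x)) - 1) + k x * (exp (\<alpha> * (t x / k x)) * (\<alpha> * ((- dd w v x + t x / k x * dd w v z) / k x))))
     (\<alpha> * exp (\<alpha> * (t x / k x)) * (- dd w (dd w v) x + \<alpha> * (- dd w v x + t x / k x * dd w v z)\<^sup>2 / k x))"
proof -
  have xD: "x \<in> D" using x S_sub by blast
  have kx: "0 < k x" using k_pos by (simp add: k_def)
  have kj: "jet2 (\<lambda>s. k (x + s *\<^sub>R w)) (k x) (- dd w v z) 0"
  proof -
    have "k (x + s *\<^sub>R w) = k x + (- dd w v z) * s + 0 / 2 * s\<^sup>2" for s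
    proof -
      have "dd (x + s *\<^sub>R w - z) v z = dd ((x - z) + s *\<^sub>R w) v z" by (simp add: algebra_simps)
      then show ?thesis unfolding k_def
        by (simp add: dd_add_dir[OF differentiable(1)[OF zD]] dd_scaleR_dir[OF differentiable(1)[OF zD]])
    qed
    then show ?thesis using jet2_poly[of "k x" "- dd w v z" 0] by simp
  qed
  have tj: "jet2 (\<lambda>s. t (x + s *\<^sub>R w)) (t x) (- dd w v x) (- dd w (dd w v) x)"
    unfolding t_def using jet2_diff[OF jet2_const jet2_line[OF open_D smooth2 xD], of h w] by simp
  note J = jet2_mult[OF kj jet2_diff[OF jet2_exp[OF jet2_cmult[OF jet2_divide[OF tj kj], of \<alpha>]] jet2_const[of 1]]]
  show ?thesis
    by (rule jet2_cong[OF J]) (use kx in \<open>simp_all add: field_simps power2_eq_square power3_eq_cube\<close>)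
qed

text \<open>The sum of the second derivatives of \<open>t\<close> over a frame is \<open>- n\<close>; the gradient term has to
  compensate it. Let \<open>\<psi> = t / k\<close> and \<open>l = \<nabla>t - \<psi> \<nabla>k\<close>. Since \<open>k\<close> is the tangent plane of \<open>t\<close> at \<open>z\<close>
  and \<open>t\<close> is concave, \<open>l (z - x)\<close> is at least \<open>(1 - \<psi>)\<close> times the value of \<open>t\<close> at \<open>z\<close>. Strict
  convexity keeps \<open>1 - \<psi>\<close> away from \<open>0\<close> when \<open>x\<close> is not near \<open>z\<close>, and \<open>gradient_form_bound\<close> converts
  this into a bound for \<open>l\<close> along the frame. All bounds scale linearly in \<open>H\<close>.\<close>

lemma barrier_subsolution:
  fixes z x E
  assumes th: "0 < \<theta>\<^sub>0" "\<theta>\<^sub>0 < \<theta>" "\<theta> < \<theta>'" "\<theta>' < 1"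
    and z: "z \<in> S" "v z \<le> \<theta>\<^sub>0 * H" and x: "x \<in> S" "v x \<le> \<theta> * H"
    and T: "\<And>y. y \<in> closure S \<Longrightarrow> norm (y - x0) \<le> T" and rho: "\<rho> \<le> norm (x - z)" "0 < \<rho>" and T0: "0 < T"
    and E: "orthoframe (hessian v x) E"
  defines "\<alpha> \<equiv> barrier_exponent \<theta>\<^sub>0 \<theta> \<theta>' (\<rho> / T) CARD('n)"
    and "k \<equiv> \<theta> * H - (v z + dd (x - z) v z)" and "t \<equiv> \<theta> * H - v x"
  shows "0 < k" "t \<le> k" "k \<le> barrier_height_const \<theta> CARD('n) * H"
    "\<alpha> \<le> (\<Sum>i\<in>UNIV. \<alpha> * exp (\<alpha> * (t / k)) * (- 1 + \<alpha> * (- dd (E i) v x + t / k * dd (E i) v z)\<^sup>2 / k))"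
proof -
  let ?n = "CARD('n)"
  let ?c6 = "tangent_gap_const \<theta> \<theta>' (\<rho> / T) ?n"
  let ?c7 = "barrier_height_const \<theta> ?n"
  let ?c8 = "barrier_gradient_const \<theta>\<^sub>0 \<theta> \<theta>' (\<rho> / T) ?n"
  let ?C5 = "4 * (real ?n)\<^sup>2 * hessian_const \<theta> \<theta>' ?n"
  have th0: "0 < \<theta>" using th by simp
  have thl: "\<theta> < 1" using th by simp
  have xD: "x \<in> D" and zD: "z \<in> D" and xc: "x \<in> closure S" and zc: "z \<in> closure S"
    using x z S_sub closure_subset by auto
  have "\<theta>\<^sub>0 * H \<le> \<theta> * H" using th H_pos by simp
  then have vz: "v z \<le> \<theta> * H" using z by simp
  have hc: "0 < hessian_const \<theta> \<theta>' ?n" by (rule hessian_const_pos) (use th in auto)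
  have el: "0 < ellipticity_const \<theta> \<theta>' ?n" using hc by (simp add: ellipticity_const_def)
  have c6: "0 < ?c6" using el rho T0 by (simp add: tangent_gap_const_def)
  have gc: "1 \<le> gradient_const \<theta> ?n" by (rule gradient_const_ge1) (use thl in auto)
  have c7: "0 < ?c7" unfolding barrier_height_const_def using gc by (simp add: add_pos_nonneg)
  have C5: "0 < ?C5" using hc by simp
  have c8: "0 < ?c8" unfolding barrier_gradient_const_def using c6 c7 C5 th by simp
  have al: "0 < \<alpha>" unfolding \<alpha>_def barrier_exponent_def using c7 c8 by simp
  obtain j where j: "\<rho> / (real ?n * T) \<le> \<bar>Q $ j \<bullet> (x - z)\<bar>"
    using exists_large_coord[OF T rho(1) T0] by blast
  have gap: "?c6 * H \<le> v x - v z - dd (x - z) v z"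
  proof -
    have "(\<rho> / T / real ?n)\<^sup>2 \<le> (Q $ j \<bullet> (x - z))\<^sup>2"
      using j rho T0 abs_le_square_iff[of "\<rho> / T / real ?n" "Q $ j \<bullet> (x - z)"] by (simp add: mult.commute)
    then have "ellipticity_const \<theta> \<theta>' ?n * H * (\<rho> / T / real ?n)\<^sup>2 / 2 \<le> ellipticity_const \<theta> \<theta>' ?n * H * (Q $ j \<bullet> (x - z))\<^sup>2 / 2"
      using el H_pos by (intro divide_right_mono mult_left_mono) auto
    also have "\<dots> \<le> v x - v z - dd (x - z) v z" by (rule strict_tangent_bound[OF th0 th(3,4) x z(1) vz])
    finally show ?thesis by (simp add: tangent_gap_const_def mult_ac)
  qed
  have kt: "?c6 * H \<le> k - t" using gap by (simp add: k_def t_def)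
  have t0: "0 \<le> t" using x by (simp add: t_def)
  have c6H: "0 < ?c6 * H" using c6 H_pos by simp
  show k0: "0 < k" and tk: "t \<le> k" using kt t0 c6H by auto
  have "\<bar>dd (x - z) v z\<bar> \<le> 2 * real ?n * gradient_const \<theta> ?n * H"
    by (rule directional_gradient_bound[OF th0 thl z(1) vz xc zc])
  moreover have "\<theta> * H \<le> 1 * H" using thl H_pos by (intro mult_right_mono) auto
  ultimately show k7: "k \<le> ?c7 * H"
    using v_nonneg[OF zc] by (simp add: k_def barrier_height_const_def distrib_right)
  define \<psi> where "\<psi> = t / k"
  have psi0: "0 \<le> \<psi>" using t0 k0 by (simp add: \<psi>_def)
  have psik: "\<psi> * k = t" using k0 by (simp add: \<psi>_def)
  have psi1: "?c6 / ?c7 \<le> 1 - \<psi>"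
  proof -
    have "?c6 / ?c7 = ?c6 * H / (?c7 * H)" using H_pos by simp
    also have "\<dots> \<le> (k - t) / k" using kt k7 k0 c6H by (intro frac_le) auto
    also have "\<dots> = 1 - \<psi>" using k0 by (simp add: \<psi>_def diff_divide_distrib)
    finally show ?thesis .
  qed
  define l where "l = (\<lambda>w. - dd w v x + \<psi> * dd w v z)"
  note lx = differentiable(1)[OF xD] and lz = differentiable(1)[OF zD]
  have lin: "linear l"
    unfolding l_def
    by (rule linearI) (simp_all add: dd_add_dir[OF lx] dd_add_dir[OF lz] dd_scaleR_dir[OF lx] dd_scaleR_dir[OF lz] algebra_simps)
  define kz where "kz = \<theta> * H - v z"
  have kz: "(\<theta> - \<theta>\<^sub>0) * H \<le> kz" using z by (simp add: kz_def algebra_simps)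
  \<comment> \<open>concavity of \<open>t\<close>, with \<open>kz\<close> the common value of \<open>t\<close> and \<open>k\<close> at \<open>z\<close>\<close>
  have lzx: "kz * (1 - \<psi>) \<le> l (z - x)"
  proof -
    have "closed_segment x z \<subseteq> D" using closed_segment_subset[OF x(1) z(1) convex_S] S_sub by blast
    from tangent_le[OF this] have 1: "dd (z - x) v x \<le> v z - v x" by simp
    have "dd (z - x) v z = - dd (x - z) v z" using dd_minus_dir[OF lz, of "x - z"] by simp
    then have 2: "dd (z - x) v z = k - kz" by (simp add: k_def kz_def)
    have "kz * (1 - \<psi>) = (kz - t) + \<psi> * (k - kz)" using psik by (simp add: algebra_simps)
    also have "kz - t = v x - v z" by (simp add: kz_def t_def)
    also have "(v x - v z) + \<psi> * (k - kz) \<le> l (z - x)" using 1 by (simp add: l_def 2)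
    finally show ?thesis .
  qed
  have sl: "?c8 * H \<le> (\<Sum>i\<in>UNIV. (l (E i))\<^sup>2)"
  proof -
    have "(\<theta> - \<theta>\<^sub>0) * H * (?c6 / ?c7) \<le> kz * (1 - \<psi>)"
    proof (intro mult_mono kz psi1)
      have "0 \<le> (\<theta> - \<theta>\<^sub>0) * H" using th H_pos by simp
      then show "0 \<le> kz" using kz by linarith
    qed (use c6 c7 in auto)
    then have a: "(\<theta> - \<theta>\<^sub>0) * H * (?c6 / ?c7) \<le> l (z - x)" using lzx by simp
    have "((\<theta> - \<theta>\<^sub>0) * H * (?c6 / ?c7))\<^sup>2 \<le> (l (z - x))\<^sup>2"
      by (rule power_mono[OF a]) (use th H_pos c6 c7 in auto)
    also have "\<dots> \<le> dd (z - x) (dd (z - x) v) x * (\<Sum>i\<in>UNIV. (l (E i))\<^sup>2)"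
      by (rule gradient_form_bound[OF xD E lin])
    also have "\<dots> \<le> ?C5 * H * (\<Sum>i\<in>UNIV. (l (E i))\<^sup>2)"
      by (intro mult_right_mono directional_hessian_bound[OF th0 th(3,4) x zc xc] sum_nonneg) auto
    finally have "((\<theta> - \<theta>\<^sub>0) * H * (?c6 / ?c7))\<^sup>2 / (?C5 * H) \<le> (\<Sum>i\<in>UNIV. (l (E i))\<^sup>2)"
      using C5 H_pos by (subst pos_divide_le_eq) (auto simp: mult_ac)
    moreover have "((\<theta> - \<theta>\<^sub>0) * H * (?c6 / ?c7))\<^sup>2 / (?C5 * H) = ?c8 * H"
      using H_pos by (simp add: barrier_gradient_const_def power_mult_distrib power_divide power2_eq_square mult_ac)
    ultimately show ?thesis by simp
  qed
  have "real ?n + 1 = \<alpha> * (?c8 * H) / (?c7 * H)"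
    using c7 c8 H_pos by (simp add: \<alpha>_def barrier_exponent_def)
  also have "\<dots> \<le> \<alpha> * (\<Sum>i\<in>UNIV. (l (E i))\<^sup>2) / k"
    using al sl k7 k0 by (intro frac_le mult_left_mono mult_nonneg_nonneg sum_nonneg) auto
  also have "\<dots> = (\<Sum>i\<in>UNIV. \<alpha> * (l (E i))\<^sup>2 / k)" by (simp add: sum_distrib_left sum_divide_distrib)
  finally have s1: "1 \<le> (\<Sum>i\<in>(UNIV::'n set). - 1 + \<alpha> * (l (E i))\<^sup>2 / k)"
    by (simp add: sum_subtractf)
  have "\<alpha> \<le> \<alpha> * exp (\<alpha> * \<psi>)" using al psi0 by simp
  also have "\<dots> * 1 \<le> \<alpha> * exp (\<alpha> * \<psi>) * (\<Sum>i\<in>(UNIV::'n set). - 1 + \<alpha> * (l (E i))\<^sup>2 / k)"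
    using s1 al by (intro mult_left_mono) auto
  finally show "\<alpha> \<le> (\<Sum>i\<in>UNIV. \<alpha> * exp (\<alpha> * (t / k)) * (- 1 + \<alpha> * (- dd (E i) v x + t / k * dd (E i) v z)\<^sup>2 / k))"
    by (simp add: sum_distrib_left \<psi>_def l_def)
qed

end

text \<open>The intermediate fractions \<open>(1 + \<theta>\<^sub>0) / 2\<close> and its analogue leave room for the estimates of
  first and second derivatives.\<close>

definition harnack_height_const :: "real \<Rightarrow> real \<Rightarrow> nat \<Rightarrow> real" where
  "harnack_height_const \<theta>\<^sub>0 r n = (let \<theta> = (1 + \<theta>\<^sub>0) / 2; \<alpha> = barrier_exponent \<theta>\<^sub>0 \<theta> ((1 + \<theta>) / 2) r n in
     barrier_height_const \<theta> n * exp \<alpha> / \<alpha>)"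

definition harnack_const :: "real \<Rightarrow> real \<Rightarrow> nat \<Rightarrow> real" where
  "harnack_const \<theta>\<^sub>0 r n = min 1 ((1 + \<theta>\<^sub>0) / 2 / harnack_height_const \<theta>\<^sub>0 r n)"

context ma_section_coords
begin

lemma barrier_constants_pos:
  assumes "0 < \<theta>\<^sub>0" "\<theta>\<^sub>0 < \<theta>" "\<theta> < \<theta>'" "\<theta>' < 1" "0 < r"
  shows "0 < barrier_height_const \<theta> CARD('n)" "0 < barrier_exponent \<theta>\<^sub>0 \<theta> \<theta>' r CARD('n)"
proof -
  let ?n = "CARD('n)"
  have hc: "0 < hessian_const \<theta> \<theta>' ?n" by (rule hessian_const_pos) (use assms in auto)
  have el: "0 < ellipticity_const \<theta> \<theta>' ?n" using hc by (simp add: ellipticity_const_def)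
  have c6: "0 < tangent_gap_const \<theta> \<theta>' r ?n" using el assms by (simp add: tangent_gap_const_def)
  have gc: "1 \<le> gradient_const \<theta> ?n" by (rule gradient_const_ge1) (use assms in auto)
  show c7: "0 < barrier_height_const \<theta> ?n" unfolding barrier_height_const_def using gc by (simp add: add_pos_nonneg)
  have "0 < barrier_gradient_const \<theta>\<^sub>0 \<theta> \<theta>' r ?n" unfolding barrier_gradient_const_def using c6 c7 hc assms by simp
  then show "0 < barrier_exponent \<theta>\<^sub>0 \<theta> \<theta>' r ?n" unfolding barrier_exponent_def using c7 by simp
qed

text \<open>Compare \<open>g\<close> with a multiple \<open>\<tau> W\<close> of the barrier on \<open>{v \<le> \<theta> H}\<close> outside the ball of radius \<open>\<rho>\<close>
  around \<open>z\<close>. The barrier vanishes where \<open>v = \<theta> H\<close>, and \<open>\<tau>\<close> is chosen with \<open>\<tau> W \<le> c0\<close>. At an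
  interior maximum of \<open>\<tau> W - g\<close> the frame sums would give \<open>\<tau> \<alpha> \<le> C\<close>, which is what the smallness
  assumption rules out. Finally \<open>W\<close> is at least \<open>\<alpha> \<theta> H\<close> at \<open>x0\<close>.\<close>

theorem section_harnack_coords:
  assumes th: "0 < \<theta>\<^sub>0" "\<theta>\<^sub>0 < 1" and z: "z \<in> S" "v z \<le> \<theta>\<^sub>0 * H"
    and T: "\<And>y. y \<in> closure S \<Longrightarrow> norm (y - x0) \<le> T" "0 < T" and rho: "0 < \<rho>"
    and g: "Ck_on 2 g D"
    and nonneg: "\<And>y. y \<in> S \<Longrightarrow> v y \<le> (1 + \<theta>\<^sub>0) / 2 * H \<Longrightarrow> 0 \<le> g y"
    and low: "\<And>y. y \<in> S \<Longrightarrow> norm (y - z) \<le> \<rho> \<Longrightarrow> c0 \<le> g y" "0 < c0"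
    and super: "\<And>y E. y \<in> S \<Longrightarrow> orthoframe (hessian v y) E \<Longrightarrow> (\<Sum>k\<in>UNIV. dd (E k) (dd (E k) g) y) \<le> C"
    and small: "C * H * harnack_height_const \<theta>\<^sub>0 (\<rho> / T) CARD('n) < c0"
  shows "c0 * harnack_const \<theta>\<^sub>0 (\<rho> / T) CARD('n) \<le> g x0"
proof -
  let ?n = "CARD('n)"
  define \<theta> where "\<theta> = (1 + \<theta>\<^sub>0) / 2"
  define \<theta>' where "\<theta>' = (1 + \<theta>) / 2"
  have ths: "0 < \<theta>\<^sub>0" "\<theta>\<^sub>0 < \<theta>" "\<theta> < \<theta>'" "\<theta>' < 1" using th by (auto simp: \<theta>_def \<theta>'_def)
  define \<alpha> where "\<alpha> = barrier_exponent \<theta>\<^sub>0 \<theta> \<theta>' (\<rho> / T) ?n"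
  define c7 where "c7 = barrier_height_const \<theta> ?n"
  have c7: "0 < c7" and al: "0 < \<alpha>"
    using barrier_constants_pos[OF ths] rho T(2) by (auto simp: c7_def \<alpha>_def)
  have K1: "harnack_height_const \<theta>\<^sub>0 (\<rho> / T) ?n = c7 * exp \<alpha> / \<alpha>"
    by (simp add: harnack_height_const_def Let_def c7_def \<alpha>_def \<theta>_def \<theta>'_def)
  have K2: "harnack_const \<theta>\<^sub>0 (\<rho> / T) ?n = min 1 (\<theta> / (c7 * exp \<alpha> / \<alpha>))"
    unfolding harnack_const_def K1 by (simp add: \<theta>_def)
  show ?thesis
  proof (cases "norm (x0 - z) \<le> \<rho>")
    case True
    have "c0 * harnack_const \<theta>\<^sub>0 (\<rho> / T) ?n \<le> c0 * 1" using low(2) by (intro mult_left_mono) (auto simp: harnack_const_def)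
    then show ?thesis using low(1)[OF x0_S True] by simp
  next
    case far: False
    define t where "t = (\<lambda>y. \<theta> * H - v y)"
    define k where "k = (\<lambda>y. \<theta> * H - (v z + dd (y - z) v z))"
    define W where "W = (\<lambda>y. k y * (exp (\<alpha> * (t y / k y)) - 1))"
    \<comment> \<open>\<open>c7 * H * exp \<alpha>\<close> bounds \<open>W\<close>, so that \<open>\<tau> W \<le> c0\<close>\<close>
    define \<tau> where "\<tau> = c0 / (c7 * H * exp \<alpha>)"
    have tau: "0 < \<tau>" using c7 H_pos low(2) by (simp add: \<tau>_def)
    define R where "R = {y \<in> closure S. v y \<le> \<theta> * H \<and> \<rho> \<le> norm (y - z)}"
    have RS: "y \<in> S" if "y \<in> R" for y
    proof (rule ccontr)
      assume "y \<notin> S"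
      then have "v y = H" using v_boundary that by (auto simp: R_def)
      then have "H * 1 \<le> H * \<theta>" using that by (simp add: R_def mult.commute)
      then show False using ths H_pos by simp
    qed
    have RD: "R \<subseteq> D" using RS S_sub by blast
    have zD: "z \<in> D" using z S_sub by blast
    note dz = differentiable(1)[OF zD]
    have facts: "0 < k y" "t y \<le> k y" "k y \<le> c7 * H" if "y \<in> R" for y
    proof -
      have yD: "y \<in> D" using RD that by blast
      obtain E where E: "orthoframe (hessian v y) E" using some_frame[OF yD] by blast
      have y: "v y \<le> \<theta> * H" "\<rho> \<le> norm (y - z)" using that by (auto simp: R_def)
      from barrier_subsolution(1-3)[OF ths z RS[OF that] y(1) T(1) y(2) rho T(2) E]
      show "0 < k y" "t y \<le> k y" "k y \<le> c7 * H" by (simp_all add: k_def t_def c7_def)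
    qed
    have cR: "compact R"
    proof -
      have "closed {y \<in> closure S. v y \<le> \<theta> * H}"
        by (intro continuous_on_closed_Collect_le continuous_on_D closure_S continuous_on_const) auto
      moreover have "closed {y. \<rho> \<le> norm (y - z)}" by (intro closed_Collect_le continuous_intros)
      ultimately have "closed ({y \<in> closure S. v y \<le> \<theta> * H} \<inter> {y. \<rho> \<le> norm (y - z)})" by (rule closed_Int)
      moreover have "R = {y \<in> closure S. v y \<le> \<theta> * H} \<inter> {y. \<rho> \<le> norm (y - z)}" by (auto simp: R_def)
      moreover have "bounded R" using bounded_subset[OF bounded_closure[OF bounded_S], of R] by (auto simp: R_def)
      ultimately show ?thesis by (simp add: compact_eq_bounded_closed)
    qed
    have contk: "continuous_on R k"
    proof -
      have "linear (\<lambda>w. dd w v z)" by (rule linear_dd[OF dz])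
      then have "continuous_on UNIV (\<lambda>w. dd w v z)" by (rule linear_continuous_on[OF linear_conv_bounded_linear[THEN iffD1]])
      then have "continuous_on R (\<lambda>y. dd (y - z) v z)"
        by (rule continuous_on_compose2) (auto intro!: continuous_intros)
      then show ?thesis unfolding k_def by (intro continuous_intros)
    qed
    have contg: "continuous_on R g" using Ck_on_continuous_on[OF g] RD continuous_on_subset by blast
    have cont: "continuous_on R (\<lambda>y. \<tau> * W y - g y)" unfolding W_def t_def
      using facts(1) by (intro continuous_intros contk contg continuous_on_D RD) (auto simp: less_le)
    have x0R: "x0 \<in> R" using x0_S far closure_subset v_x0 ths H_pos by (auto simp: R_def)
    have t_nonneg: "0 \<le> t y" if "y \<in> R" for y using that by (simp add: R_def t_def)
    have Wle: "W y \<le> c7 * H * exp \<alpha>" if "y \<in> R" for y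
    proof -
      have "t y / k y \<le> 1" using facts[OF that] by simp
      then have "\<alpha> * (t y / k y) \<le> \<alpha>" using al mult_left_mono[of "t y / k y" 1 \<alpha>] by simp
      then have "exp (\<alpha> * (t y / k y)) - 1 \<le> exp \<alpha>" by (smt (verit) exp_le_cancel_iff)
      then have "W y \<le> k y * exp \<alpha>" unfolding W_def using facts(1)[OF that] by (intro mult_left_mono) auto
      also have "\<dots> \<le> c7 * H * exp \<alpha>" using facts(3)[OF that] by (intro mult_right_mono) auto
      finally show ?thesis .
    qed
    have le0: "\<tau> * W x0 - g x0 \<le> 0"
    proof (rule ccontr)
      assume neg: "\<not> ?thesis"
      obtain y where y: "y \<in> R" "\<And>p. p \<in> R \<Longrightarrow> \<tau> * W p - g p \<le> \<tau> * W y - g y"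
        using continuous_attains_sup[OF cR _ cont] x0R by blast
      have pos: "0 < \<tau> * W y - g y" using neg y(2)[OF x0R] by linarith
      have yS: "y \<in> S" by (rule RS[OF y(1)])
      have yD: "y \<in> D" using yS S_sub by blast
      have vy: "v y < \<theta> * H"
      proof (rule ccontr)
        assume "\<not> ?thesis"
        then have "v y = \<theta> * H" using y(1) by (auto simp: R_def)
        then have "W y = 0" by (simp add: W_def t_def)
        then show False using pos nonneg[OF yS] y(1) by (auto simp: R_def \<theta>_def)
      qed
      have ny: "\<rho> < norm (y - z)"
      proof (rule ccontr)
        assume "\<not> ?thesis"
        then have "c0 \<le> g y" using low(1)[OF yS] by simp
        moreover have "\<tau> * W y \<le> \<tau> * (c7 * H * exp \<alpha>)" using Wle[OF y(1)] tau by (intro mult_left_mono) auto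
        moreover have "\<tau> * (c7 * H * exp \<alpha>) = c0" using c7 H_pos by (simp add: \<tau>_def)
        ultimately show False using pos by linarith
      qed
      obtain E where E: "orthoframe (hessian v y) E" using some_frame[OF yD] by blast
      have "open (v -` {..<\<theta> * H} \<inter> S)"
        using continuous_on_open_vimage[OF open_S] continuous_on_D(1)[OF S_sub] open_lessThan by blast
      moreover have "open {p. \<rho> < norm (p - z)}" by (intro open_Collect_less continuous_intros)
      ultimately have "open ((v -` {..<\<theta> * H} \<inter> S) \<inter> {p. \<rho> < norm (p - z)})" by (rule open_Int)
      from eventually_nhds_in_open[OF this, of y] yS vy ny
      have nb: "\<forall>\<^sub>F p in nhds y. p \<in> S \<and> v p < \<theta> * H \<and> \<rho> < norm (p - z)" by (auto elim!: eventually_mono)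
      have ev: "\<forall>\<^sub>F p in nhds y. \<tau> * W p - g p \<le> \<tau> * W y - g y"
        using nb
      proof eventually_elim
        case (elim p)
        show ?case by (rule y(2)) (use elim closure_subset[of S] in \<open>auto simp: R_def\<close>)
      qed
      have ky: "0 < \<theta> * H - (v z + dd (y - z) v z)" using facts(1)[OF y(1)] by (simp add: k_def)
      define W2 where "W2 = (\<lambda>i. \<alpha> * exp (\<alpha> * (t y / k y)) * (- 1 + \<alpha> * (- dd (E i) v y + t y / k y * dd (E i) v z)\<^sup>2 / k y))"
      have "\<tau> * W2 i - dd (E i) (dd (E i) g) y \<le> 0" for i
      proof -
        note wj = barrier_jet[OF yS zD ky, of "E i" \<alpha>]
        note gj = jet2_line[OF open_D g yD, of "E i"]
        from jet2_local_max(2)[OF jet2_diff[OF jet2_cmult[OF wj] gj] eventually_nhds_line[OF ev, unfolded W_def k_def t_def]]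
        show ?thesis unfolding W2_def k_def t_def frame_form[OF yD E] by simp
      qed
      then have "(\<Sum>i\<in>UNIV. \<tau> * W2 i - dd (E i) (dd (E i) g) y) \<le> 0" by (intro sum_nonpos) auto
      then have "\<tau> * (\<Sum>i\<in>UNIV. W2 i) \<le> C" using super[OF yS E] by (simp add: sum_subtractf sum_distrib_left)
      moreover have "\<alpha> \<le> (\<Sum>i\<in>UNIV. W2 i)"
      proof -
        have y': "v y \<le> \<theta> * H" "\<rho> \<le> norm (y - z)" using vy ny by auto
        from barrier_subsolution(4)[OF ths z yS y'(1) T(1) y'(2) rho T(2) E] show ?thesis
          by (simp add: W2_def k_def t_def \<alpha>_def)
      qed
      then have "\<tau> * \<alpha> \<le> \<tau> * (\<Sum>i\<in>UNIV. W2 i)" using tau by (intro mult_left_mono) auto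
      ultimately have "\<tau> * \<alpha> \<le> C" by simp
      then have "c0 * \<alpha> \<le> C * (c7 * H * exp \<alpha>)" using c7 H_pos by (simp add: \<tau>_def pos_divide_le_eq)
      then have "c0 \<le> C * H * (c7 * exp \<alpha> / \<alpha>)" using al by (simp add: pos_le_divide_eq mult_ac)
      then show False using small unfolding K1 by simp
    qed
    have "\<tau> * (\<alpha> * (\<theta> * H)) \<le> \<tau> * W x0"
    proof (intro mult_left_mono)
      have kx: "0 < k x0" by (rule facts(1)[OF x0R])
      have tx: "t x0 = \<theta> * H" by (simp add: t_def v_x0)
      have "\<alpha> * (t x0 / k x0) \<le> exp (\<alpha> * (t x0 / k x0)) - 1"
        using exp_ge_add_one_self[of "\<alpha> * (t x0 / k x0)"] by linarith
      then have "k x0 * (\<alpha> * (t x0 / k x0)) \<le> W x0" unfolding W_def using kx by (intro mult_left_mono) auto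
      then show "\<alpha> * (\<theta> * H) \<le> W x0" using kx by (simp add: tx)
    qed (use tau in auto)
    moreover have "\<tau> * (\<alpha> * (\<theta> * H)) = c0 * (\<theta> / (c7 * exp \<alpha> / \<alpha>))"
      using c7 al H_pos by (simp add: \<tau>_def)
    ultimately have "c0 * (\<theta> / (c7 * exp \<alpha> / \<alpha>)) \<le> g x0" using le0 by linarith
    moreover have "c0 * harnack_const \<theta>\<^sub>0 (\<rho> / T) ?n \<le> c0 * (\<theta> / (c7 * exp \<alpha> / \<alpha>))"
      unfolding K2 using low(2) by (intro mult_left_mono) auto
    ultimately show ?thesis by simp
  qed
qed

end

context ma_section
begin

lemma section_coords: "\<exists>P Q. ma_section_coords D v S x0 H P Q"
proof -
  obtain P Q :: "real^'n^'n" where "\<And>i. x0 + P $ i \<in> closure S" "det P \<noteq> 0" "det Q * det P = 1"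
    "\<And>y. y = (\<Sum>i\<in>UNIV. (Q $ i \<bullet> y) *\<^sub>R P $ i)" "\<And>i j. Q $ i \<bullet> P $ j = (if i = j then 1 else 0)"
    "\<And>y i. y \<in> closure S \<Longrightarrow> \<bar>Q $ i \<bullet> (y - x0)\<bar> \<le> 1"
    "\<And>j w. det (\<chi> i. if i = j then w else P $ i) = (Q $ j \<bullet> w) * det P"
    using simplex_coordinates[OF open_S bounded_S x0_S] by blast
  then have "ma_section_coords D v S x0 H P Q" by unfold_locales
  then show ?thesis by blast
qed

theorem section_harnack:
  assumes "0 < \<theta>\<^sub>0" "\<theta>\<^sub>0 < 1" "z \<in> S" "v z \<le> \<theta>\<^sub>0 * H"
    "\<And>y. y \<in> closure S \<Longrightarrow> norm (y - x0) \<le> T" "0 < T" "0 < \<rho>" "Ck_on 2 g D"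
    "\<And>y. y \<in> S \<Longrightarrow> v y \<le> (1 + \<theta>\<^sub>0) / 2 * H \<Longrightarrow> 0 \<le> g y"
    "\<And>y. y \<in> S \<Longrightarrow> norm (y - z) \<le> \<rho> \<Longrightarrow> c0 \<le> g y" "0 < c0"
    "\<And>y E. y \<in> S \<Longrightarrow> orthoframe (hessian v y) E \<Longrightarrow> (\<Sum>k\<in>UNIV. dd (E k) (dd (E k) g) y) \<le> C"
    "C * H * harnack_height_const \<theta>\<^sub>0 (\<rho> / T) CARD('n) < c0"
  shows "c0 * harnack_const \<theta>\<^sub>0 (\<rho> / T) CARD('n) \<le> g x0"
proof -
  obtain P Q where "ma_section_coords D v S x0 H P Q" using section_coords by blast
  then interpret ma_section_coords D v S x0 H P Q .
  show ?thesis by (rule section_harnack_coords[OF assms])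
qed

lemma harnack_consts_pos:
  assumes "0 < \<theta>\<^sub>0" "\<theta>\<^sub>0 < 1" "0 < r"
  shows "0 < harnack_height_const \<theta>\<^sub>0 r CARD('n)" "0 < harnack_const \<theta>\<^sub>0 r CARD('n)"
proof -
  obtain P Q where "ma_section_coords D v S x0 H P Q" using section_coords by blast
  then interpret ma_section_coords D v S x0 H P Q .
  show 1: "0 < harnack_height_const \<theta>\<^sub>0 r CARD('n)"
    unfolding harnack_height_const_def Let_def
    using barrier_constants_pos[of \<theta>\<^sub>0 "(1 + \<theta>\<^sub>0) / 2" "(1 + (1 + \<theta>\<^sub>0) / 2) / 2" r] assms by simp
  show "0 < harnack_const \<theta>\<^sub>0 r CARD('n)" using 1 assms by (simp add: harnack_const_def)
qed

lemma section_gradient_bound: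
  assumes "0 < \<theta>" "\<theta> < 1" "x \<in> S" "v x \<le> \<theta> * H" "y \<in> closure S" "z \<in> closure S"
  shows "\<bar>dd (y - z) v x\<bar> \<le> 2 * real CARD('n) * gradient_const \<theta> CARD('n) * H"
proof -
  obtain P Q where "ma_section_coords D v S x0 H P Q" using section_coords by blast
  then interpret ma_section_coords D v S x0 H P Q .
  show ?thesis by (rule directional_gradient_bound[OF assms])
qed

end

section \<open>Superlevel sets of the gap function\<close>

definition affine_at :: "(real^'n::finite \<Rightarrow> real) \<Rightarrow> real^'n \<Rightarrow> real^'n \<Rightarrow> real" where
  "affine_at u x y = u x + (\<Sum>i\<in>UNIV. (y - x) $ i * partial_deriv i u x)"

definition above_tangent :: "(real^'n::finite \<Rightarrow> real) \<Rightarrow> real^'n \<Rightarrow> real^'n \<Rightarrow> real" where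
  "above_tangent u x y = u y - affine_at u x y"

context ma_solution
begin

lemma affine_at_eq: "x \<in> D \<Longrightarrow> affine_at u x y = u x + dd (y - x) u x"
  by (simp add: affine_at_def dd_eq_sum[OF differentiable(1)])

lemma above_tangent_eq: "x \<in> D \<Longrightarrow> above_tangent u x y = u y - u x - dd (y - x) u x"
  by (simp add: above_tangent_def affine_at_eq)

lemma affine_at_inner: "affine_at u x = (\<lambda>y. (u x - (\<chi> i. partial_deriv i u x) \<bullet> x) + (\<chi> i. partial_deriv i u x) \<bullet> y)"
  by (rule ext) (simp add: affine_at_def inner_vec_def left_diff_distrib sum_subtractf mult.commute[of "partial_deriv _ u x"])

lemma Ck_on_affine_at: "open S \<Longrightarrow> Ck_on k (affine_at u x) S"
  unfolding affine_at_inner by (intro Ck_on_add Ck_on_const Ck_on_inner)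

lemma affine_at_differentiable: "affine_at u x differentiable (at y)"
  by (rule Ck_on_differentiable[OF Ck_on_affine_at[OF open_UNIV]]) simp

lemma dd_affine_at:
  assumes x: "x \<in> D"
  shows "dd w (affine_at u x) y = dd w u x"
proof -
  have "dd w (affine_at u x) y = (\<chi> i. partial_deriv i u x) \<bullet> w"
    unfolding affine_at_inner by (rule dd_unique) (auto intro!: derivative_eq_intros)
  also have "\<dots> = dd w u x"
    by (simp add: dd_eq_sum[OF differentiable(1)[OF x]] inner_vec_def mult.commute)
  finally show ?thesis .
qed

lemma dd_above_tangent:
  assumes "x \<in> D" "y \<in> D"
  shows "dd w (above_tangent u x) y = dd w u y - dd w u x"
proof -
  have "above_tangent u x = (\<lambda>y. u y - affine_at u x y)" by (simp add: above_tangent_def fun_eq_iff)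
  then show ?thesis
    using dd_diff[OF differentiable(1)[OF assms(2)] affine_at_differentiable] dd_affine_at[OF assms(1)] by simp
qed

lemma dd2_above_tangent:
  assumes "x \<in> D" "y \<in> D"
  shows "dd w (dd w' (above_tangent u x)) y = dd w (dd w' u) y"
proof -
  have d: "dd w' u differentiable (at y)" by (rule differentiable(2)[OF assms(2)])
  have "dd w (dd w' (above_tangent u x)) y = dd w (\<lambda>y. dd w' u y - dd w' u x) y"
    by (rule dd_cong_open(1)[OF open_D assms(2)]) (use d dd_above_tangent[OF assms(1)] in \<open>auto intro: differentiable_diff\<close>)
  also have "\<dots> = dd w (dd w' u) y" using dd_diff[OF d, of "\<lambda>_. dd w' u x"] by (simp add: dd_const)
  finally show ?thesis .
qed

lemma hessian_above_tangent: "x \<in> D \<Longrightarrow> y \<in> D \<Longrightarrow> hessian (above_tangent u x) y = hessian u y"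
  using dd2_above_tangent by (simp add: hessian_def partial_deriv_eq_dd[abs_def])

lemma ma_above_tangent: "x \<in> D \<Longrightarrow> ma_solution D (above_tangent u x)"
proof
  assume x: "x \<in> D"
  show "open D" by (rule open_D)
  show "Ck_on 4 (above_tangent u x) D"
    unfolding above_tangent_def[abs_def] by (intro Ck_on_diff open_D smooth Ck_on_affine_at)
  show "sym_posdef (hessian (above_tangent u x) y)" "det (hessian (above_tangent u x) y) = 1" if "y \<in> D" for y
    using hessian_above_tangent[OF x that] posdef[OF that] det_one[OF that] by simp_all
qed

lemma above_tangent_nonneg: "closed_segment x y \<subseteq> D \<Longrightarrow> 0 \<le> above_tangent u x y"
  using tangent_le[of x y] above_tangent_eq[of x y] by (simp add: subset_iff)

lemma above_tangent_self: "x \<in> D \<Longrightarrow> above_tangent u x x = 0"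
  by (simp add: above_tangent_eq dd_zero_dir differentiable)

lemma above_tangent_pos:
  assumes seg: "closed_segment x y \<subseteq> D" and ne: "x \<noteq> y"
  shows "0 < above_tangent u x y"
proof -
  let ?w = "y - x"
  have "continuous_on (closed_segment x y) (dd ?w (dd ?w u))" by (rule continuous_on_D(3)[OF seg])
  moreover have "closed_segment x y \<noteq> {}" by (metis ends_in_segment(1) empty_iff)
  ultimately obtain p where p: "p \<in> closed_segment x y" "\<And>q. q \<in> closed_segment x y \<Longrightarrow> dd ?w (dd ?w u) p \<le> dd ?w (dd ?w u) q"
    using continuous_attains_inf[OF compact_segment, of x y "dd ?w (dd ?w u)"] by blast
  have "0 < dd ?w (dd ?w u) p" by (rule form_pos) (use p seg ne in auto)
  moreover have "u x + dd ?w u x + dd ?w (dd ?w u) p / 2 \<le> u y" by (rule tangent_below[OF seg p(2)])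
  moreover have "x \<in> D" using seg by auto
  ultimately show ?thesis by (simp add: above_tangent_eq)
qed

lemma continuous_on_above_tangent: "K \<subseteq> D \<Longrightarrow> continuous_on K (above_tangent u x)"
  unfolding above_tangent_def[abs_def]
  by (intro continuous_intros continuous_on_D Ck_on_continuous_on[OF Ck_on_subset[OF Ck_on_affine_at[OF open_UNIV]]]) auto

lemma above_tangent_scale_le:
  assumes seg: "closed_segment x y \<subseteq> D" and s: "0 \<le> s" "s \<le> 1"
  shows "above_tangent u x (x + s *\<^sub>R (y - x)) \<le> s * above_tangent u x y"
proof -
  have x: "x \<in> D" using seg by auto
  interpret M: ma_solution D "above_tangent u x" by (rule ma_above_tangent[OF x])
  have "convex_on (closed_segment x y) (above_tangent u x)" by (rule M.convex_on_subset_D[OF _ seg]) simp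
  from convex_onD[OF this s, of x y] show ?thesis
    by (simp add: above_tangent_self[OF x] algebra_simps)
qed

end

text \<open>The situation of the theorem with \<open>\<eta> = w - u\<close> and with constants in place of norms. Assumption
  \<open>ball_in\<close> is the form in which the boundary values enter: a Lipschitz function that vanishes on
  the boundary bounds the distance to it from below.\<close>

locale ma_obstacle = ma_solution D u for D :: "(real^'n::finite) set" and u +
  fixes \<eta> :: "real^'n \<Rightarrow> real" and L A B C1 :: real
  assumes eta_smooth: "Ck_on 2 \<eta> D"
    and L_pos: "0 < L" and A_pos: "0 < A" and C1_nonneg: "0 \<le> C1"
    and eta_pos: "x \<in> D \<Longrightarrow> 0 < \<eta> x" and eta_le: "x \<in> D \<Longrightarrow> \<eta> x \<le> B"
    and eta_lip: "x \<in> D \<Longrightarrow> y \<in> D \<Longrightarrow> \<bar>\<eta> x - \<eta> y\<bar> \<le> L * norm (x - y)"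
    and ball_in: "x \<in> D \<Longrightarrow> ball x (\<eta> x / L) \<subseteq> D"
    and u_le: "x \<in> D \<Longrightarrow> \<bar>u x\<bar> \<le> A" and grad_le: "x \<in> D \<Longrightarrow> \<bar>dd e u x\<bar> \<le> A * norm e"
    and eta_super: "x \<in> D \<Longrightarrow> orthoframe (hessian u x) E \<Longrightarrow> - C1 \<le> (\<Sum>k\<in>UNIV. dd (E k) (dd (E k) \<eta>) x)"
begin

definition level :: "real \<Rightarrow> (real^'n) set" where
  "level m = {x \<in> D. m \<le> \<eta> x}"

definition interior_level :: "real \<Rightarrow> (real^'n) set" where
  "interior_level m = {x \<in> D. m < \<eta> x}"

lemma level_sub: "level m \<subseteq> D" "interior_level m \<subseteq> level m"
  by (auto simp: level_def interior_level_def)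

lemma continuous_eta: "continuous_on D \<eta>"
  by (rule Ck_on_continuous_on[OF eta_smooth])

lemma open_interior_level: "open (interior_level m)"
proof -
  have "open (\<eta> -` {m<..} \<inter> D)"
    using continuous_on_open_vimage[OF open_D] continuous_eta open_greaterThan by blast
  moreover have "interior_level m = \<eta> -` {m<..} \<inter> D" by (auto simp: interior_level_def)
  ultimately show ?thesis by simp
qed

lemma ball_level: "x \<in> level m \<Longrightarrow> ball x (m / L) \<subseteq> D"
  using ball_in[of x] subset_ball[of "m / L" "\<eta> x / L" x] L_pos by (auto simp: level_def divide_right_mono)

text \<open>Closed in the whole space, not only relative to \<open>D\<close>: points of the level set keep the distance
  \<open>m / L\<close> from the complement of \<open>D\<close>.\<close>

lemma closed_level:
  assumes m: "0 < m"
  shows "closed (level m)"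
  unfolding closed_sequential_limits
proof (intro allI impI, elim conjE)
  fix f p assume f: "\<forall>n. f n \<in> level m" and lim: "f \<longlonglongrightarrow> p"
  have "\<forall>\<^sub>F n in sequentially. dist (f n) p < m / L"
    by (rule tendstoD[OF lim]) (use m L_pos in simp)
  then obtain n where "dist (f n) p < m / L" by (meson eventually_sequentially order_refl)
  then have pD: "p \<in> D" using ball_level[of "f n" m] f by (auto simp: subset_iff)
  have "isCont \<eta> p" using continuous_eta open_D pD continuous_on_eq_continuous_at by blast
  then have "(\<lambda>n. \<eta> (f n)) \<longlonglongrightarrow> \<eta> p" using lim by (rule isCont_tendsto_compose)
  then have "m \<le> \<eta> p" by (rule LIMSEQ_le_const) (use f in \<open>auto simp: level_def\<close>)
  then show "p \<in> level m" using pD by (simp add: level_def)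
qed

definition segment_bound :: "real \<Rightarrow> real" where
  "segment_bound m = sqrt (24 * A * (24 * A * L\<^sup>2 / m\<^sup>2) ^ (CARD('n) - 1)) + 1"

lemma segment_bound_pos: "0 < segment_bound m"
  unfolding segment_bound_def using A_pos by (intro add_nonneg_pos) auto

text \<open>A segment of length \<open>l\<close> on which \<open>\<eta> \<ge> m\<close> is surrounded by an ellipsoid in \<open>D\<close> with one axis of
  length \<open>l\<close> and the others of length \<open>m / L\<close>. As \<open>u\<close> is bounded by \<open>A\<close>, a quadratic polynomial that
  grows by \<open>3 A\<close> from the centre to the boundary of the ellipsoid touches \<open>u\<close> from above at some
  point, up to a constant. There the product of the second derivatives along the axes is at least
  \<open>1\<close> and at most a multiple of \<open>1 / l\<^sup>2\<close>. Consequently visible points are at bounded distance even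
  if the domain is unbounded.\<close>

lemma segment_length_bound:
  assumes m: "0 < m" and seg: "closed_segment x y \<subseteq> level m"
  shows "norm (y - x) \<le> segment_bound m"
proof (cases "x = y")
  case True
  then show ?thesis using segment_bound_pos[of m] by simp
next
  case False
  define l where "l = norm (y - x)"
  have l: "0 < l" using False by (simp add: l_def)
  define r where "r = m / (2 * L)"
  have r: "0 < r" "r < m / L" using m L_pos by (auto simp: r_def field_simps)
  define e where "e = (1 / l) *\<^sub>R (y - x)"
  have e1: "e \<bullet> e = 1" using l by (simp add: e_def dot_square_norm l_def power2_eq_square)
  then have e0: "e \<noteq> 0" by auto
  define c where "c = (1 / 2) *\<^sub>R (x + y)"
  \<comment> \<open>as \<open>u\<close> oscillates by at most \<open>2 A\<close>, a growth of \<open>3 A\<close> forces the maximum of \<open>u - q\<close> into the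
    interior\<close>
  define K where "K = 3 * A"
  have K: "0 < K" using A_pos by (simp add: K_def)
  have spd: "sym_posdef (mat 1 :: real^'n^'n)"
    by (simp add: sym_posdef_def transpose_mat)
  obtain E where E: "orthoframe (mat 1 :: real^'n^'n) E" "E undefined = (1 / sqrt (e \<bullet> (mat 1 *v e))) *\<^sub>R e"
    using orthoframe_exists[OF spd e0] by blast
  define i0 :: 'n where "i0 = undefined"
  have Ei0: "E i0 = e" using E(2) e1 by (simp add: i0_def)
  have EE: "E i \<bullet> E j = (if i = j then 1 else 0)" for i j
    using E(1) by (simp add: orthoframe_def)
  have pars: "(\<Sum>k\<in>UNIV. (w \<bullet> E k)\<^sup>2) = w \<bullet> w" for w
    using orthoframe_parseval[OF E(1), of w] by (simp add: transpose_mat)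
  have exp: "w = (\<Sum>k\<in>UNIV. (w \<bullet> E k) *\<^sub>R E k)" for w
    using orthoframe_expand[OF E(1), of w] by (simp add: transpose_mat)
  define La :: "real^'n^'n" where "La = (\<chi> i. (if i = i0 then sqrt (8 * K) / l else sqrt (2 * K) / r) *\<^sub>R E i)"
  define q where "q = quad 0 0 La c"
  have La2: "(\<Sum>i\<in>UNIV. (La $ i \<bullet> w)\<^sup>2) = 8 * K / l\<^sup>2 * (w \<bullet> e)\<^sup>2 + 2 * K / r\<^sup>2 * (\<Sum>i\<in>UNIV-{i0}. (w \<bullet> E i)\<^sup>2)" for w
  proof -
    have "(\<Sum>i\<in>UNIV-{i0}. (La $ i \<bullet> w)\<^sup>2) = (\<Sum>i\<in>UNIV-{i0}. 2 * K / r\<^sup>2 * (w \<bullet> E i)\<^sup>2)"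
      using K by (intro sum.cong refl) (auto simp: La_def power_mult_distrib power_divide inner_commute)
    moreover have "(La $ i0 \<bullet> w)\<^sup>2 = 8 * K / l\<^sup>2 * (w \<bullet> e)\<^sup>2"
      using K by (simp add: La_def power_mult_distrib power_divide Ei0 inner_commute)
    ultimately show ?thesis by (subst sum.remove[of UNIV i0]) (auto simp: sum_distrib_left)
  qed
  have q: "q p = K * (4 / l\<^sup>2 * ((p - c) \<bullet> e)\<^sup>2 + (\<Sum>i\<in>UNIV-{i0}. ((p - c) \<bullet> E i)\<^sup>2) / r\<^sup>2)" for p
    by (simp add: q_def quad_def La2 field_simps)
  have bounds: "((p - c) \<bullet> e)\<^sup>2 \<le> (l / 2)\<^sup>2" "(\<Sum>i\<in>UNIV-{i0}. ((p - c) \<bullet> E i)\<^sup>2) \<le> r\<^sup>2" if "q p \<le> K" for p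
  proof -
    let ?a = "4 / l\<^sup>2 * ((p - c) \<bullet> e)\<^sup>2" and ?b = "(\<Sum>i\<in>UNIV-{i0}. ((p - c) \<bullet> E i)\<^sup>2) / r\<^sup>2"
    have "K * (?a + ?b) \<le> K * 1" using that unfolding q by simp
    then have s: "?a + ?b \<le> 1" using K by (simp only: mult_le_cancel_left_pos)
    have a0: "0 \<le> ?a" by (intro mult_nonneg_nonneg divide_nonneg_nonneg) auto
    have b0: "0 \<le> ?b" by (intro divide_nonneg_nonneg sum_nonneg) auto
    have gen: "a' \<le> 1 \<and> b' \<le> 1" if "0 \<le> a'" "0 \<le> b'" "a' + b' \<le> 1" for a' b' :: real
      using that by linarith
    have "?a \<le> 1" "?b \<le> 1" using gen[OF a0 b0 s] by blast+
    then show "((p - c) \<bullet> e)\<^sup>2 \<le> (l / 2)\<^sup>2" "(\<Sum>i\<in>UNIV-{i0}. ((p - c) \<bullet> E i)\<^sup>2) \<le> r\<^sup>2"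
      using l r by (auto simp: field_simps power2_eq_square)
  qed
  have EllD: "p \<in> D" if "q p \<le> K" for p
  proof -
    define \<tau> where "\<tau> = (p - c) \<bullet> e"
    have "\<bar>\<tau>\<bar> \<le> l / 2" using bounds(1)[OF that] l abs_le_square_iff[of \<tau> "l / 2"] by (simp add: \<tau>_def)
    define s where "s = \<tau> / l + 1 / 2"
    have s: "0 \<le> s" "s \<le> 1" using \<open>\<bar>\<tau>\<bar> \<le> l / 2\<close> l by (auto simp: s_def field_simps abs_le_iff)
    have "c + \<tau> *\<^sub>R e = (1 - s) *\<^sub>R x + s *\<^sub>R y"
    proof -
      have "c + \<tau> *\<^sub>R e = (1 / 2) *\<^sub>R (x + y) + (\<tau> / l) *\<^sub>R (y - x)" by (simp add: c_def e_def)
      also have "\<tau> / l = s - 1 / 2" by (simp add: s_def)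
      also have "(1 / 2) *\<^sub>R (x + y) + (s - 1 / 2) *\<^sub>R (y - x) = (1 - s) *\<^sub>R x + s *\<^sub>R y"
      proof -
        have "x = (1 / 2) *\<^sub>R x + (1 / 2) *\<^sub>R x" by (simp add: scaleR_left_distrib[symmetric])
        then show ?thesis by (simp add: scaleR_diff_left scaleR_diff_right scaleR_add_right algebra_simps)
      qed
      finally show ?thesis .
    qed
    then have "c + \<tau> *\<^sub>R e \<in> closed_segment x y" using s unfolding closed_segment_def by blast
    then have "c + \<tau> *\<^sub>R e \<in> level m" using seg by blast
    then have sub: "ball (c + \<tau> *\<^sub>R e) (m / L) \<subseteq> D" by (rule ball_level)
    have "((p - c) - \<tau> *\<^sub>R e) \<bullet> E i = (if i = i0 then 0 else (p - c) \<bullet> E i)" for i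
      using EE[of i0 i] Ei0 by (simp add: inner_diff_left \<tau>_def)
    then have "((p - c) - \<tau> *\<^sub>R e) \<bullet> ((p - c) - \<tau> *\<^sub>R e) = (\<Sum>i\<in>UNIV. (if i = i0 then 0 else (p - c) \<bullet> E i)\<^sup>2)"
      using pars[of "(p - c) - \<tau> *\<^sub>R e"] by simp
    also have "\<dots> = (\<Sum>i\<in>UNIV-{i0}. ((p - c) \<bullet> E i)\<^sup>2)" by (subst sum.remove[of UNIV i0]) auto
    also have "\<dots> \<le> r\<^sup>2" by (rule bounds(2)[OF that])
    finally have "(norm ((p - c) - \<tau> *\<^sub>R e))\<^sup>2 \<le> r\<^sup>2" by (simp add: dot_square_norm)
    then have "norm ((p - c) - \<tau> *\<^sub>R e) \<le> r" by (rule power2_le_imp_le) (use r in simp)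
    then have "dist (c + \<tau> *\<^sub>R e) p < m / L" using r by (simp add: dist_norm norm_minus_commute algebra_simps)
    then show ?thesis using sub by (simp add: subset_iff)
  qed
  define Ell where "Ell = {p. q p \<le> K}"
  have "closed Ell" unfolding Ell_def q_def
    by (intro closed_Collect_le continuous_on_quad continuous_on_const)
  moreover have "bounded Ell"
  proof -
    have "norm p \<le> norm c + (l / 2 + r)" if "p \<in> Ell" for p
    proof -
      have "(p - c) \<bullet> (p - c) = ((p - c) \<bullet> e)\<^sup>2 + (\<Sum>i\<in>UNIV-{i0}. ((p - c) \<bullet> E i)\<^sup>2)"
        unfolding pars[symmetric] by (subst sum.remove[of UNIV i0]) (auto simp: Ei0)
      also have "\<dots> \<le> (l / 2)\<^sup>2 + r\<^sup>2" using bounds[of p] that by (simp add: Ell_def)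
      also have "\<dots> \<le> (l / 2 + r)\<^sup>2" using l r by (simp add: power2_sum)
      finally have "(norm (p - c))\<^sup>2 \<le> (l / 2 + r)\<^sup>2" by (simp add: dot_square_norm)
      then have "norm (p - c) \<le> l / 2 + r" by (rule power2_le_imp_le) (use l r in simp)
      then show ?thesis using norm_triangle_ineq[of c "p - c"] by simp
    qed
    then show ?thesis unfolding bounded_iff by blast
  qed
  ultimately have cE: "compact Ell" by (simp add: compact_eq_bounded_closed)
  have ED: "Ell \<subseteq> D" using EllD by (auto simp: Ell_def)
  have cc: "c \<in> Ell" using K by (simp add: Ell_def q)
  have "continuous_on Ell (\<lambda>p. u p - q p)"
    unfolding q_def by (intro continuous_intros continuous_on_quad continuous_on_D ED)
  moreover have "Ell \<noteq> {}" using cc by blast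
  ultimately obtain p where p: "p \<in> Ell" "\<And>p'. p' \<in> Ell \<Longrightarrow> u p' - q p' \<le> u p - q p"
    using continuous_attains_sup[OF cE, of "\<lambda>p. u p - q p"] by blast
  have pD: "p \<in> D" using p ED by blast
  have "- A \<le> u c - q c" using u_le[of c] cc ED by (auto simp: q)
  then have "q p \<le> 2 * A" using p(2)[OF cc] u_le[OF pD] by linarith
  then have qp: "q p < K" using A_pos by (simp add: K_def)
  have "open {p. q p < K}" unfolding q_def by (intro open_Collect_less continuous_on_quad continuous_on_const)
  from eventually_nhds_in_open[OF this, of p] qp
  have ev: "\<forall>\<^sub>F p' in nhds p. q p' < K" by simp
  have "\<forall>\<^sub>F p' in nhds p. u p' - quad 0 0 La c p' \<le> u p - quad 0 0 La c p"
    using ev by eventually_elim (use p(2) in \<open>auto simp: Ell_def q_def less_imp_le\<close>)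
  then have le: "dd w (dd w u) p \<le> (\<Sum>i\<in>UNIV. (La $ i \<bullet> w)\<^sup>2)" for w
    by (rule second_derivative_le_at_max[OF pD])
  have fi: "dd (E i) (dd (E i) u) p \<le> (if i = i0 then 8 * K / l\<^sup>2 else 2 * K / r\<^sup>2)" for i
  proof (cases "i = i0")
    case True
    have "(\<Sum>k\<in>UNIV-{i0}. (E i \<bullet> E k)\<^sup>2) = 0" using True EE by (intro sum.neutral) auto
    then show ?thesis using le[of "E i"] True by (simp add: La2 Ei0 e1)
  next
    case False
    have "(\<Sum>k\<in>UNIV-{i0}. (E i \<bullet> E k)\<^sup>2) = (\<Sum>k\<in>UNIV-{i0}. if k = i then 1 else 0)"
      using EE by (intro sum.cong refl) auto
    also have "\<dots> = 1" using False by simp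
    finally have "(\<Sum>k\<in>UNIV-{i0}. (E i \<bullet> E k)\<^sup>2) = 1" .
    moreover have "E i \<bullet> e = 0" using EE[of i i0] False Ei0 by simp
    ultimately show ?thesis using le[of "E i"] False by (simp add: La2)
  qed
  have "(1::real) = (det (\<chi> i. E i))\<^sup>2" using orthoframe_det[OF E(1)] by simp
  also have "\<dots> \<le> (\<Prod>i\<in>UNIV. dd (E i) (dd (E i) u) p)" by (rule det_le_prod[OF pD])
  also have "\<dots> \<le> (\<Prod>i\<in>UNIV. if i = i0 then 8 * K / l\<^sup>2 else 2 * K / r\<^sup>2)"
    by (intro prod_mono conjI form_nonneg[OF pD] fi)
  also have "\<dots> = 8 * K / l\<^sup>2 * (2 * K / r\<^sup>2) ^ (CARD('n) - 1)"
  proof -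
    have "(\<Prod>i\<in>UNIV-{i0}. if i = i0 then 8 * K / l\<^sup>2 else 2 * K / r\<^sup>2) = (\<Prod>i\<in>UNIV-{i0}. 2 * K / r\<^sup>2)"
      by (rule prod.cong) auto
    then show ?thesis by (subst prod.remove[of UNIV i0]) (auto simp: card_Diff_singleton)
  qed
  finally have f: "1 \<le> 8 * K / l\<^sup>2 * (2 * K / r\<^sup>2) ^ (CARD('n) - 1)" .
  have "l\<^sup>2 * 1 \<le> l\<^sup>2 * (8 * K / l\<^sup>2 * (2 * K / r\<^sup>2) ^ (CARD('n) - 1))" by (rule mult_left_mono[OF f]) simp
  then have "l\<^sup>2 \<le> 8 * K * (2 * K / r\<^sup>2) ^ (CARD('n) - 1)" using l by simp
  also have "2 * K / r\<^sup>2 = 24 * A * L\<^sup>2 / m\<^sup>2" using L_pos m by (simp add: K_def r_def power_divide power_mult_distrib)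
  finally have "l\<^sup>2 \<le> 24 * A * (24 * A * L\<^sup>2 / m\<^sup>2) ^ (CARD('n) - 1)" by (simp add: K_def)
  then have "l \<le> sqrt (24 * A * (24 * A * L\<^sup>2 / m\<^sup>2) ^ (CARD('n) - 1))" by (rule real_le_rsqrt)
  then show ?thesis by (simp add: segment_bound_def l_def)
qed

end

section \<open>Sections inside a superlevel set\<close>

lemma left_limit_in_closed:
  fixes \<gamma> :: "real \<Rightarrow> 'a::t2_space"
  assumes S: "closed S" and cont: "isCont \<gamma> b" and ab: "a < b"
    and inS: "\<And>s. a < s \<Longrightarrow> s < b \<Longrightarrow> \<gamma> s \<in> S"
  shows "\<gamma> b \<in> S"
proof -
  have lim: "(\<gamma> \<longlongrightarrow> \<gamma> b) (at_left b)"
    by (rule filterlim_mono[OF cont[unfolded isCont_def]]) (auto simp: at_within_le_at)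
  have "\<forall>\<^sub>F s in at_left b. \<gamma> s \<in> S"
    using eventually_at_left_real[OF ab] by eventually_elim (auto intro: inS)
  then show ?thesis using Lim_in_closed_set[OF S _ _ lim] by (simp add: trivial_limit_at_left_real)
qed

context ma_obstacle
begin

text \<open>The points of \<open>{\<eta> = m}\<close> seen from \<open>x\<close> without leaving \<open>{\<eta> \<ge> m}\<close>. Using segments rather than
  arbitrary paths makes the section below star-shaped, from which its convexity is derived.\<close>

definition visible :: "real \<Rightarrow> real^'n \<Rightarrow> (real^'n) set" where
  "visible m x = {y. \<eta> y = m \<and> closed_segment x y \<subseteq> level m}"

definition height :: "real \<Rightarrow> real^'n \<Rightarrow> real" where
  "height m x = Inf (above_tangent u x ` visible m x)"

text \<open>Asking for the whole segment makes this the part of the section that is star-shaped about \<open>x\<close>,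
  although \<open>{\<eta> > m}\<close> need not be.\<close>

definition flat_section :: "real \<Rightarrow> real^'n \<Rightarrow> (real^'n) set" where
  "flat_section m x = {y. closed_segment x y \<subseteq> interior_level m \<and> above_tangent u x y < height m x}"

lemma closed_segment_memI: "0 \<le> s \<Longrightarrow> s \<le> 1 \<Longrightarrow> x + s *\<^sub>R (y - x) \<in> closed_segment x y"
  unfolding closed_segment_def by (auto intro!: exI[of _ s] simp: algebra_simps)

lemma closed_segment_memE:
  assumes "p \<in> closed_segment x y"
  obtains s where "0 \<le> s" "s \<le> 1" "p = x + s *\<^sub>R (y - x)"
  using assms unfolding closed_segment_def by (auto simp: algebra_simps)

lemma closed_segment_shorten:
  assumes "0 \<le> s" "s \<le> 1"
  shows "closed_segment x (x + s *\<^sub>R (y - x)) \<subseteq> closed_segment x y"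
  using closed_segment_memI[OF assms, of x y] by (intro subset_closed_segment[THEN iffD2]) auto

lemma visible_dist: "0 < m \<Longrightarrow> y \<in> visible m x \<Longrightarrow> norm (y - x) \<le> segment_bound m"
  by (rule segment_length_bound) (auto simp: visible_def)

text \<open>A ray from \<open>x\<close> leaves \<open>{\<eta> > m}\<close> because segments in the level set have bounded length; its
  first exit point is visible.\<close>

lemma visible_nonempty:
  assumes m: "0 < m" and x: "x \<in> interior_level m"
  shows "visible m x \<noteq> {}"
proof -
  define T where "T = segment_bound m + 1"
  have T: "0 < T" using segment_bound_pos[of m] by (simp add: T_def)
  obtain e :: "real^'n" where e: "norm e = 1" by (metis norm_axis_1)
  define F where "F = {s \<in> {0..T}. x + s *\<^sub>R e \<notin> interior_level m}"
  have oc: "closed ((\<lambda>s. x + s *\<^sub>R e) -` (- interior_level m))"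
    by (intro closed_vimage) (auto intro!: continuous_intros simp: open_interior_level closed_Compl)
  have "F = {0..T} \<inter> (\<lambda>s. x + s *\<^sub>R e) -` (- interior_level m)" by (auto simp: F_def)
  then have cF: "compact F" using oc by (simp add: compact_Int_closed)
  have "F \<noteq> {}"
  proof
    assume "F = {}"
    then have all: "x + s *\<^sub>R e \<in> interior_level m" if "0 \<le> s" "s \<le> T" for s using that by (auto simp: F_def)
    have "closed_segment x (x + T *\<^sub>R e) \<subseteq> level m"
    proof
      fix p assume "p \<in> closed_segment x (x + T *\<^sub>R e)"
      then obtain s where s: "0 \<le> s" "s \<le> 1" "p = x + s *\<^sub>R (x + T *\<^sub>R e - x)" by (rule closed_segment_memE)
      have "p = x + (s * T) *\<^sub>R e" using s(3) by simp
      moreover have "0 \<le> s * T" "s * T \<le> T" using s T by (auto simp: mult_left_le_one_le)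
      ultimately show "p \<in> level m" using all level_sub(2) by blast
    qed
    from segment_length_bound[OF m this] have "T \<le> segment_bound m" using e T by simp
    then show False by (simp add: T_def)
  qed
  then obtain s0 where s0: "s0 \<in> F" "\<And>s. s \<in> F \<Longrightarrow> s0 \<le> s"
    using compact_attains_inf[OF cF] by blast
  have s0pos: "0 < s0" using s0(1) x by (auto simp: F_def less_le)
  have before: "x + s *\<^sub>R e \<in> interior_level m" if "0 \<le> s" "s < s0" for s
    using s0(2)[of s] that s0(1) by (force simp: F_def)
  define y where "y = x + s0 *\<^sub>R e"
  have yl: "y \<in> level m" unfolding y_def
    by (rule left_limit_in_closed[OF closed_level[OF m] _ s0pos]) (auto intro!: continuous_intros subsetD[OF level_sub(2)] before)
  have "y \<notin> interior_level m" using s0(1) by (simp add: F_def y_def)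
  then have ey: "\<eta> y = m" using yl by (auto simp: level_def interior_level_def)
  have "closed_segment x y \<subseteq> level m"
  proof
    fix p assume "p \<in> closed_segment x y"
    then obtain s where s: "0 \<le> s" "s \<le> 1" "p = x + s *\<^sub>R (y - x)" by (rule closed_segment_memE)
    then have p: "p = x + (s * s0) *\<^sub>R e" by (simp add: y_def)
    show "p \<in> level m"
    proof (cases "s = 1")
      case True then show ?thesis using yl p by (simp add: y_def)
    next
      case False
      then have "0 \<le> s * s0" "s * s0 < s0" using s s0pos by auto
      then show ?thesis using before level_sub(2) p by blast
    qed
  qed
  then show ?thesis using ey by (auto simp: visible_def)
qed

lemma compact_visible:
  assumes m: "0 < m"
  shows "compact (visible m x)"
proof -
  have eq: "visible m x = {y \<in> level m. \<eta> y = m} \<inter> (\<Inter>s\<in>{0..1}. (\<lambda>y. x + s *\<^sub>R (y - x)) -` level m)"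
  proof (intro equalityI subsetI)
    fix y assume y: "y \<in> visible m x"
    have "x + s *\<^sub>R (y - x) \<in> level m" if "s \<in> {0..1}" for s
      using y closed_segment_memI[of s x y] that by (auto simp: visible_def)
    moreover have "y \<in> level m" "\<eta> y = m" using y by (auto simp: visible_def)
    ultimately show "y \<in> {y \<in> level m. \<eta> y = m} \<inter> (\<Inter>s\<in>{0..1}. (\<lambda>y. x + s *\<^sub>R (y - x)) -` level m)" by simp
  next
    fix y assume y: "y \<in> {y \<in> level m. \<eta> y = m} \<inter> (\<Inter>s\<in>{0..1}. (\<lambda>y. x + s *\<^sub>R (y - x)) -` level m)"
    then have "x + s *\<^sub>R (y - x) \<in> level m" if "0 \<le> s" "s \<le> 1" for s using that by simp
    then have "closed_segment x y \<subseteq> level m" by (auto elim!: closed_segment_memE)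
    then show "y \<in> visible m x" using y by (simp add: visible_def)
  qed
  have "closed {y \<in> level m. \<eta> y = m}"
  proof -
    have "closed (level m \<inter> \<eta> -` {m})"
      by (intro continuous_closed_preimage closed_level m continuous_on_subset[OF continuous_eta level_sub(1)]) auto
    moreover have "{y \<in> level m. \<eta> y = m} = level m \<inter> \<eta> -` {m}" by auto
    ultimately show ?thesis by simp
  qed
  moreover have "closed (\<Inter>s\<in>{0..1}. (\<lambda>y. x + s *\<^sub>R (y - x)) -` level m)"
    by (intro closed_INT ballI closed_vimage closed_level m) (auto intro!: continuous_intros)
  ultimately have "closed (visible m x)" unfolding eq by (rule closed_Int)
  moreover have "bounded (visible m x)"
    by (rule bounded_subset[OF bounded_cball[of x "segment_bound m"]])
      (use visible_dist[OF m, of _ x] in \<open>auto simp: dist_norm norm_minus_commute\<close>)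
  ultimately show ?thesis by (simp add: compact_eq_bounded_closed)
qed

lemma visible_sub_D: "visible m x \<subseteq> D"
  using level_sub(1) by (auto simp: visible_def)

lemma height_attained:
  assumes m: "0 < m" and x: "x \<in> interior_level m"
  obtains y where "y \<in> visible m x" "above_tangent u x y = height m x"
    "\<And>z. z \<in> visible m x \<Longrightarrow> height m x \<le> above_tangent u x z"
proof -
  have "continuous_on (visible m x) (above_tangent u x)" by (rule continuous_on_above_tangent[OF visible_sub_D])
  then obtain y where y: "y \<in> visible m x" "\<And>z. z \<in> visible m x \<Longrightarrow> above_tangent u x y \<le> above_tangent u x z"
    using continuous_attains_inf[OF compact_visible[OF m] visible_nonempty[OF m x], of "above_tangent u x"] by blast
  have "height m x = above_tangent u x y" unfolding height_def
    by (rule cInf_eq_minimum) (use y in auto)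
  then show ?thesis using y that by metis
qed

lemma height_le: "0 < m \<Longrightarrow> x \<in> interior_level m \<Longrightarrow> y \<in> visible m x \<Longrightarrow> height m x \<le> above_tangent u x y"
  by (metis height_attained)

lemma height_pos:
  assumes m: "0 < m" and x: "x \<in> interior_level m"
  shows "0 < height m x"
proof -
  obtain y where y: "y \<in> visible m x" "above_tangent u x y = height m x" by (rule height_attained[OF m x])
  have "closed_segment x y \<subseteq> D" "x \<noteq> y" using y(1) x level_sub(1) by (auto simp: visible_def interior_level_def)
  then show ?thesis using above_tangent_pos y(2) by metis
qed

lemma flat_section_sub: "flat_section m x \<subseteq> interior_level m"
  by (auto simp: flat_section_def)

lemma open_flat_section:
  assumes x: "x \<in> D"
  shows "open (flat_section m x)"
proof (rule openI)
  fix y assume y: "y \<in> flat_section m x"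
  then have seg: "closed_segment x y \<subseteq> interior_level m" by (simp add: flat_section_def)
  obtain e where e: "0 < e" "(\<Union>p\<in>closed_segment x y. cball p e) \<subseteq> interior_level m"
    using compact_subset_open_imp_cball_epsilon_subset[OF compact_segment open_interior_level seg] by blast
  have yD: "y \<in> D" using seg level_sub by fastforce
  have "open (above_tangent u x -` {..<height m x} \<inter> D)"
    using continuous_on_open_vimage[OF open_D] continuous_on_above_tangent[of D x] open_lessThan by blast
  moreover have "y \<in> above_tangent u x -` {..<height m x} \<inter> D" using y yD by (simp add: flat_section_def)
  ultimately obtain e' where e': "0 < e'" "ball y e' \<subseteq> above_tangent u x -` {..<height m x} \<inter> D"
    using open_contains_ball by blast
  have "ball y (min e e') \<subseteq> flat_section m x"
  proof
    fix y' assume y': "y' \<in> ball y (min e e')"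
    have "closed_segment x y' \<subseteq> interior_level m"
    proof
      fix p assume "p \<in> closed_segment x y'"
      then obtain s where s: "0 \<le> s" "s \<le> 1" "p = x + s *\<^sub>R (y' - x)" by (rule closed_segment_memE)
      have "dist (x + s *\<^sub>R (y - x)) p = norm (s *\<^sub>R (y - y'))" by (simp add: s dist_norm algebra_simps)
      also have "\<dots> \<le> 1 * norm (y - y')" using s mult_right_mono[of s 1 "norm (y - y')"] by simp
      also have "\<dots> \<le> e" using y' by (simp add: dist_norm)
      finally have "p \<in> cball (x + s *\<^sub>R (y - x)) e" by simp
      then show "p \<in> interior_level m" using e(2) closed_segment_memI[OF s(1,2), of x y] by blast
    qed
    moreover have "above_tangent u x y' < height m x" using e'(2) y' by (auto simp: subset_iff)
    ultimately show "y' \<in> flat_section m x" by (simp add: flat_section_def)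
  qed
  then show "\<exists>e>0. ball y e \<subseteq> flat_section m x" using e(1) e'(1) by (intro exI[of _ "min e e'"]) auto
qed

text \<open>Sweep the triangle with vertices \<open>x\<close>, \<open>y1\<close>, \<open>y2\<close> by chords parallel to the side opposite to
  \<open>x\<close>: \<open>p (s, t)\<close> is the point with parameter \<open>t\<close> on the chord at fraction \<open>s\<close> from \<open>x\<close>. If some
  chord left \<open>{\<eta> > m}\<close>, then on the first such chord there would be a visible point. By convexity
  the excess over the tangent plane is below the height on that chord, which contradicts the
  definition of the height.\<close>

lemma convex_flat_section:
  assumes m: "0 < m" and x: "x \<in> interior_level m"
  shows "convex (flat_section m x)"
  unfolding convex_contains_segment
proof (intro ballI subsetI)
  fix y1 y2 q assume y: "y1 \<in> flat_section m x" "y2 \<in> flat_section m x" and q: "q \<in> closed_segment y1 y2"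
  let ?v = "above_tangent u x"
  have xD: "x \<in> D" using x by (simp add: interior_level_def)
  define p where "p = (\<lambda>a :: real \<times> real. x + fst a *\<^sub>R ((1 - snd a) *\<^sub>R y1 + snd a *\<^sub>R y2 - x))"
  have cp: "continuous_on K p" for K unfolding p_def by (intro continuous_intros)
  define Z where "Z = ({0..1} \<times> {0..1}) \<inter> p -` (- interior_level m)"
  have "compact Z" unfolding Z_def
    by (intro compact_Int_closed compact_Times) (auto intro!: closed_vimage simp: open_interior_level closed_Compl cp)
  have p1: "p (s, t) = p (s, 0) + t *\<^sub>R (p (s, 1) - p (s, 0))" for s t by (simp add: p_def algebra_simps)
  have vi: "?v (p (s, i)) < height m x" if "0 \<le> s" "s \<le> 1" "i = 0 \<or> i = 1" for s i
  proof -
    define yi where "yi = (if i = 0 then y1 else y2)"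
    have yi: "yi \<in> flat_section m x" using y by (simp add: yi_def)
    have pe: "p (s, i) = x + s *\<^sub>R (yi - x)" using that by (auto simp: p_def yi_def)
    have seg: "closed_segment x yi \<subseteq> D" using yi level_sub by (force simp: flat_section_def)
    have "?v (p (s, i)) \<le> s * ?v yi" unfolding pe by (rule above_tangent_scale_le[OF seg that(1,2)])
    also have "\<dots> \<le> 1 * ?v yi" using above_tangent_nonneg[OF seg] that by (intro mult_right_mono) auto
    also have "\<dots> < height m x" using yi by (simp add: flat_section_def)
    finally show ?thesis .
  qed
  have vcomb: "?v (p (s, t)) < height m x" if st: "0 \<le> s" "s \<le> 1" "0 \<le> t" "t \<le> 1"
    and seg: "\<And>t. 0 \<le> t \<Longrightarrow> t \<le> 1 \<Longrightarrow> p (s, t) \<in> D" for s t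
  proof -
    interpret M: ma_solution D ?v by (rule ma_above_tangent[OF xD])
    have sub: "closed_segment (p (s, 0)) (p (s, 1)) \<subseteq> D"
    proof
      fix w assume "w \<in> closed_segment (p (s, 0)) (p (s, 1))"
      then obtain r where r: "0 \<le> r" "r \<le> 1" "w = p (s, 0) + r *\<^sub>R (p (s, 1) - p (s, 0))" by (rule closed_segment_memE)
      have "w = p (s, r)" unfolding r(3) by (rule p1[symmetric])
      then show "w \<in> D" using seg[OF r(1,2)] by simp
    qed
    have "convex_on (closed_segment (p (s, 0)) (p (s, 1))) ?v" by (rule M.convex_on_subset_D[OF _ sub]) simp
    from convex_onD[OF this st(3,4), of "p (s, 0)" "p (s, 1)"]
    have "?v (p (s, t)) \<le> (1 - t) * ?v (p (s, 0)) + t * ?v (p (s, 1))" by (subst p1) (simp add: algebra_simps)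
    also have "\<dots> < height m x"
      using convex_bound_lt[OF vi[OF st(1,2), of 0] vi[OF st(1,2), of 1], of "1 - t" t] st by simp
    finally show ?thesis .
  qed
  have "Z = {}"
  proof (rule ccontr)
    assume ne: "Z \<noteq> {}"
    obtain a where a: "a \<in> Z" "\<And>b. b \<in> Z \<Longrightarrow> fst a \<le> fst b"
      using continuous_attains_inf[OF \<open>compact Z\<close> ne continuous_on_fst[OF continuous_on_id]] by blast
    define s0 t0 where "s0 = fst a" and "t0 = snd a"
    have st0: "0 \<le> s0" "s0 \<le> 1" "0 \<le> t0" "t0 \<le> 1" and nin: "p (s0, t0) \<notin> interior_level m"
      using a(1) by (auto simp: Z_def s0_def t0_def)
    have "s0 \<noteq> 0" using nin x by (auto simp: p_def)
    then have s0pos: "0 < s0" using st0 by simp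
    have before: "p (s, t) \<in> interior_level m" if "0 \<le> s" "s < s0" "0 \<le> t" "t \<le> 1" for s t
      using a(2)[of "(s, t)"] that st0 by (force simp: Z_def s0_def)
    have atl: "p (s0, t) \<in> level m" if t: "0 \<le> t" "t \<le> 1" for t
    proof (rule left_limit_in_closed[OF closed_level[OF m] _ s0pos, of "\<lambda>s. p (s, t)"])
      show "isCont (\<lambda>s. p (s, t)) s0" unfolding p_def by (intro continuous_intros)
      show "p (s, t) \<in> level m" if "0 < s" "s < s0" for s
        by (rule subsetD[OF level_sub(2)], rule before) (use that t in auto)
    qed
    have "closed_segment x (p (s0, t0)) \<subseteq> level m"
    proof
      fix w assume "w \<in> closed_segment x (p (s0, t0))"
      then obtain r where r: "0 \<le> r" "r \<le> 1" "w = x + r *\<^sub>R (p (s0, t0) - x)" by (rule closed_segment_memE)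
      then have w: "w = p (r * s0, t0)" by (simp add: p_def)
      show "w \<in> level m"
      proof (cases "r = 1")
        case True then show ?thesis using atl st0 w by simp
      next
        case False
        then have "0 \<le> r * s0" "r * s0 < s0" using r s0pos by auto
        then show ?thesis using before st0 level_sub(2) w by blast
      qed
    qed
    moreover have "\<eta> (p (s0, t0)) = m" using atl[of t0] st0 nin by (auto simp: level_def interior_level_def)
    ultimately have "p (s0, t0) \<in> visible m x" by (simp add: visible_def)
    then have "height m x \<le> ?v (p (s0, t0))" by (rule height_le[OF m x])
    moreover have "?v (p (s0, t0)) < height m x"
      by (rule vcomb[OF st0]) (use atl level_sub(1) in blast)
    ultimately show False by simp
  qed
  have allin: "p (s, t) \<in> interior_level m" if "0 \<le> s" "s \<le> 1" "0 \<le> t" "t \<le> 1" for s t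
  proof (rule ccontr)
    assume "\<not> ?thesis"
    then have "(s, t) \<in> Z" using that by (simp add: Z_def)
    then show False using \<open>Z = {}\<close> by simp
  qed
  obtain t where t: "0 \<le> t" "t \<le> 1" "q = (1 - t) *\<^sub>R y1 + t *\<^sub>R y2" using q unfolding closed_segment_def by auto
  have qp: "q = p (1, t)" by (simp add: t p_def)
  have "closed_segment x q \<subseteq> interior_level m"
  proof
    fix w assume "w \<in> closed_segment x q"
    then obtain r where r: "0 \<le> r" "r \<le> 1" "w = x + r *\<^sub>R (q - x)" by (rule closed_segment_memE)
    then have "w = p (r, t)" by (simp add: p_def t)
    then show "w \<in> interior_level m" using allin r t by simp
  qed
  moreover have "?v q < height m x" unfolding qp
    by (rule vcomb) (use t allin in \<open>auto simp: interior_level_def\<close>)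
  ultimately show "q \<in> flat_section m x" by (simp add: flat_section_def)
qed

lemma x_in_flat_section:
  assumes "0 < m" "x \<in> interior_level m"
  shows "x \<in> flat_section m x"
  using assms height_pos[OF assms] above_tangent_self[of x] level_sub by (auto simp: flat_section_def interior_level_def)

lemma segment_to_closure:
  assumes m: "0 < m" and x: "x \<in> interior_level m" and y: "y \<in> flat_section m x" and q: "q \<in> closure (flat_section m x)"
  shows "closed_segment y q \<subseteq> flat_section m x \<union> {q}" "closed_segment y q \<subseteq> level m"
proof -
  have xD: "x \<in> D" using x by (simp add: interior_level_def)
  have int: "interior (flat_section m x) = flat_section m x" by (rule interior_open[OF open_flat_section[OF xD]])
  have "open_segment y q \<subseteq> flat_section m x"
    using in_interior_closure_convex_segment[OF convex_flat_section[OF m x], of y q] y q int by simp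
  then show 1: "closed_segment y q \<subseteq> flat_section m x \<union> {q}" using y by (auto simp: closed_segment_eq_open)
  have "closure (flat_section m x) \<subseteq> level m"
    by (rule closure_minimal[OF _ closed_level[OF m]]) (use flat_section_sub level_sub in blast)
  then have "q \<in> level m" using q by (rule subsetD)
  moreover have "flat_section m x \<subseteq> level m" using flat_section_sub level_sub(2) by (rule subset_trans)
  ultimately show "closed_segment y q \<subseteq> level m" using 1 by auto
qed

lemma closure_flat_section: "0 < m \<Longrightarrow> closure (flat_section m x) \<subseteq> level m"
  by (rule closure_minimal[OF _ closed_level]) (use flat_section_sub level_sub in blast)

lemma closure_flat_section_dist:
  assumes m: "0 < m" and x: "x \<in> interior_level m" and q: "q \<in> closure (flat_section m x)"
  shows "norm (q - x) \<le> segment_bound m"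
  by (rule segment_length_bound[OF m segment_to_closure(2)[OF m x x_in_flat_section[OF m x] q]])

text \<open>A boundary point with \<open>\<eta> = m\<close> is visible, so its excess is at least the height; with \<open>\<eta> > m\<close>
  it would belong to the section if its excess were smaller.\<close>

theorem ma_section_flat_section:
  assumes m: "0 < m" and x: "x \<in> interior_level m"
  shows "ma_section D (above_tangent u x) (flat_section m x) x (height m x)"
proof -
  have xD: "x \<in> D" using x by (simp add: interior_level_def)
  let ?v = "above_tangent u x" and ?S = "flat_section m x" and ?H = "height m x"
  interpret M: ma_solution D ?v by (rule ma_above_tangent[OF xD])
  have clD: "closure ?S \<subseteq> D" using closure_flat_section[OF m] level_sub(1) by blast
  have seg: "closed_segment x q \<subseteq> level m" if "q \<in> closure ?S" for q
    by (rule segment_to_closure(2)[OF m x x_in_flat_section[OF m x] that])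
  show ?thesis
  proof
    show "open ?S" by (rule open_flat_section[OF xD])
    show "convex ?S" by (rule convex_flat_section[OF m x])
    show "bounded ?S"
      by (rule bounded_subset[OF bounded_cball[of x "segment_bound m"]])
        (use closure_flat_section_dist[OF m x] closure_subset in \<open>fastforce simp: dist_norm norm_minus_commute\<close>)
    show "closure ?S \<subseteq> D" by (rule clD)
    show "x \<in> ?S" by (rule x_in_flat_section[OF m x])
    show "0 < ?H" by (rule height_pos[OF m x])
    show "?v x = 0" by (rule above_tangent_self[OF xD])
    show "0 \<le> ?v q" if "q \<in> closure ?S" for q
      using above_tangent_nonneg seg[OF that] level_sub(1) by blast
    show "?v q < ?H" if "q \<in> ?S" for q using that by (simp add: flat_section_def)
    show "?v q = ?H" if q: "q \<in> closure ?S" "q \<notin> ?S" for q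
    proof (rule antisym)
      have "continuous_on (closure ?S) ?v" by (rule M.continuous_on_D[OF clD])
      then show "?v q \<le> ?H"
        by (rule continuous_le_on_closure[OF _ q(1)]) (auto simp: flat_section_def)
      show "?H \<le> ?v q"
      proof (cases "\<eta> q = m")
        case True
        then show ?thesis using height_le[OF m x, of q] seg[OF q(1)] by (simp add: visible_def)
      next
        case False
        then have "q \<in> interior_level m" using closure_flat_section[OF m, of x] q by (auto simp: level_def interior_level_def)
        then have "closed_segment x q \<subseteq> interior_level m"
          using segment_to_closure(1)[OF m x x_in_flat_section[OF m x] q(1)] flat_section_sub by blast
        then show ?thesis using q(2) by (auto simp: flat_section_def)
      qed
    qed
  qed
qed

end

section \<open>Lower bound for the heights\<close>

context ma_solution
begin

text \<open>The components of a frame vector are determinants with that vector in place of a coordinate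
  vector, so \<open>det_le_prod\<close> applies. This controls the contribution of the penalty \<open>|x|\<^sup>2\<close>.\<close>

lemma frame_norm_bound:
  assumes x: "x \<in> D" and K: "0 < K" "\<And>e. norm e = 1 \<Longrightarrow> dd e (dd e u) x \<le> K"
    and E: "orthoframe (hessian u x) E"
  shows "(norm (E k))\<^sup>2 \<le> real CARD('n) * K ^ (CARD('n) - 1)"
proof -
  have c: "(E k $ j)\<^sup>2 \<le> K ^ (CARD('n) - 1)" for j
  proof -
    define F where "F = (\<lambda>i. if i = j then E k else axis i 1)"
    have r: "row i (mat 1) = (axis i 1 :: real^'n)" for i
      by (simp add: row_eq_nth vec_eq_iff mat_def axis_def)
    have ek: "(\<Sum>i\<in>UNIV. E k $ i *s (axis i 1 :: real^'n)) = E k" by (rule basis_expansion)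
    have "det (\<chi> i. F i) = E k $ j"
      using cramer_lemma_transpose[of j "E k" "mat 1"] unfolding r ek F_def by simp
    then have "(E k $ j)\<^sup>2 = (det (\<chi> i. F i))\<^sup>2" by simp
    also have "\<dots> \<le> (\<Prod>i\<in>UNIV. dd (F i) (dd (F i) u) x)" by (rule det_le_prod[OF x])
    also have "\<dots> = dd (E k) (dd (E k) u) x * (\<Prod>i\<in>UNIV-{j}. dd (axis i 1) (dd (axis i 1) u) x)"
      by (subst prod.remove[of UNIV j]) (auto simp: F_def intro!: prod.cong)
    also have "\<dots> = (\<Prod>i\<in>UNIV-{j}. dd (axis i 1) (dd (axis i 1) u) x)"
      by (simp add: frame_form[OF x E])
    also have "\<dots> \<le> (\<Prod>i\<in>UNIV-{j}. K)"
      by (intro prod_mono conjI form_nonneg[OF x] K(2)) (simp add: norm_axis_1)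
    finally show ?thesis by (simp add: card_Diff_singleton)
  qed
  have "(norm (E k))\<^sup>2 = (\<Sum>j\<in>UNIV. (E k $ j)\<^sup>2)"
    by (simp add: norm_vec_def L2_set_def sum_nonneg)
  also have "\<dots> \<le> (\<Sum>j\<in>(UNIV::'n set). K ^ (CARD('n) - 1))" by (intro sum_mono c)
  finally show ?thesis by simp
qed

end

context ma_obstacle
begin

lemma hessian_le_inverse_height:
  assumes m: "0 < m" and x: "x \<in> interior_level m" and e: "norm e = 1"
  shows "dd e (dd e u) x \<le> pogorelov_const 1 (2 * A) CARD('n) / height m x"
proof -
  have xD: "x \<in> D" using x by (simp add: interior_level_def)
  interpret S: ma_section D "above_tangent u x" "flat_section m x" x "height m x"
    by (rule ma_section_flat_section[OF m x])
  have "\<bar>dd e (above_tangent u x) y\<bar> \<le> 2 * A" if "y \<in> flat_section m x" for y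
  proof -
    have yD: "y \<in> D" using that S.S_sub by blast
    show ?thesis using grad_le[OF xD, of e] grad_le[OF yD, of e] e by (simp add: dd_above_tangent[OF xD yD])
  qed
  then have "(height m x - above_tangent u x x)\<^sup>2 * dd e (dd e (above_tangent u x)) x \<le> height m x * pogorelov_const 1 (2 * A) CARD('n)"
    by (intro S.pogorelov_section) (use S.H_pos e A_pos S.x0_S S.v_x0 in auto)
  then have "height m x * (height m x * dd e (dd e u) x) \<le> height m x * pogorelov_const 1 (2 * A) CARD('n)"
    by (simp add: S.v_x0 dd2_above_tangent[OF xD xD] power2_eq_square mult.assoc)
  then have "height m x * dd e (dd e u) x \<le> pogorelov_const 1 (2 * A) CARD('n)"
    using S.H_pos by (simp only: mult_le_cancel_left_pos)
  then show ?thesis using S.H_pos by (simp add: pos_le_divide_eq mult.commute)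
qed

lemma visible_point_approached:
  assumes m: "0 < m" and x: "x \<in> interior_level m" and y: "y \<in> visible m x" "above_tangent u x y = height m x"
    and s: "0 \<le> s" "s < 1"
  shows "x + s *\<^sub>R (y - x) \<in> flat_section m x"
proof -
  have H: "0 < height m x" by (rule height_pos[OF m x])
  have seg: "closed_segment x y \<subseteq> D" using y(1) level_sub(1) by (auto simp: visible_def)
  have le: "above_tangent u x (x + r *\<^sub>R (y - x)) < height m x" if "0 \<le> r" "r < 1" for r
  proof -
    have "above_tangent u x (x + r *\<^sub>R (y - x)) \<le> r * height m x"
      using above_tangent_scale_le[OF seg, of r] that y(2) by simp
    also have "\<dots> < 1 * height m x" using that H by (intro mult_strict_right_mono) auto
    finally show ?thesis by simp
  qed
  have inl: "x + r *\<^sub>R (y - x) \<in> interior_level m" if r: "0 \<le> r" "r < 1" for r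
  proof (rule ccontr)
    assume n: "\<not> ?thesis"
    have l: "x + r *\<^sub>R (y - x) \<in> level m" using y(1) closed_segment_memI[of r x y] r by (auto simp: visible_def)
    then have "\<eta> (x + r *\<^sub>R (y - x)) = m" using n by (auto simp: level_def interior_level_def)
    moreover have "closed_segment x (x + r *\<^sub>R (y - x)) \<subseteq> level m"
      using closed_segment_shorten[of r x y] r y(1) by (auto simp: visible_def)
    ultimately have "x + r *\<^sub>R (y - x) \<in> visible m x" by (simp add: visible_def)
    then show False using height_le[OF m x] le[OF r] by fastforce
  qed
  have "closed_segment x (x + s *\<^sub>R (y - x)) \<subseteq> interior_level m"
  proof
    fix p assume "p \<in> closed_segment x (x + s *\<^sub>R (y - x))"
    then obtain r where r: "0 \<le> r" "r \<le> 1" "p = x + r *\<^sub>R (x + s *\<^sub>R (y - x) - x)" by (rule closed_segment_memE)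
    then have "p = x + (r * s) *\<^sub>R (y - x)" by simp
    moreover have "r * s < 1" using mult_right_mono[of r 1 s] r s by simp
    ultimately show "p \<in> interior_level m" using inl[of "r * s"] r s by simp
  qed
  then show ?thesis using le[OF s] by (simp add: flat_section_def)
qed

lemma visible_point_closure:
  assumes m: "0 < m" and x: "x \<in> interior_level m" and y: "y \<in> visible m x" "above_tangent u x y = height m x"
  shows "y \<in> closure (flat_section m x)"
proof -
  have "x + 1 *\<^sub>R (y - x) \<in> closure (flat_section m x)"
    by (rule left_limit_in_closed[where \<gamma> = "\<lambda>s. x + s *\<^sub>R (y - x)" and a = 0])
      (auto intro!: continuous_intros subsetD[OF closure_subset] visible_point_approached[OF m x y])
  then show ?thesis by simp
qed

text \<open>The visible point \<open>q\<close> that realises the height of \<open>x\<close> is visible from \<open>y\<close> as well, by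
  convexity of the section. Its excess over the tangent plane at \<open>y\<close> differs from that at \<open>x\<close> by
  values and derivatives of the excess at \<open>y\<close>, which are at most a multiple of the height.\<close>

lemma height_in_section:
  assumes m: "0 < m" and x: "x \<in> interior_level m" and y: "y \<in> flat_section m x" "above_tangent u x y \<le> \<theta> * height m x"
    and th: "0 < \<theta>" "\<theta> < 1"
  shows "height m y \<le> (1 + 2 * real CARD('n) * gradient_const \<theta> CARD('n)) * height m x"
proof -
  have xD: "x \<in> D" and yl: "y \<in> interior_level m" using x y flat_section_sub by (auto simp: interior_level_def)
  then have yD: "y \<in> D" by (simp add: interior_level_def)
  interpret S: ma_section D "above_tangent u x" "flat_section m x" x "height m x"
    by (rule ma_section_flat_section[OF m x])
  obtain q where q: "q \<in> visible m x" "above_tangent u x q = height m x" by (rule height_attained[OF m x])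
  have qc: "q \<in> closure (flat_section m x)" by (rule visible_point_closure[OF m x q])
  have qD: "q \<in> D" using qc S.closure_S by blast
  have yc: "y \<in> closure (flat_section m x)" using y(1) closure_subset by blast
  have "q \<in> visible m y" using segment_to_closure(2)[OF m x y(1) qc] q(1) by (simp add: visible_def)
  then have "height m y \<le> above_tangent u y q" by (rule height_le[OF m yl])
  also have "\<dots> = above_tangent u x q - above_tangent u x y - dd (q - y) (above_tangent u x) y"
  proof -
    have "dd (q - x) u x = dd (q - y) u x + dd (y - x) u x"
      using dd_add_dir[OF differentiable(1)[OF xD], of "q - y" "y - x"] by simp
    then show ?thesis by (simp add: above_tangent_eq[OF xD] above_tangent_eq[OF yD] dd_above_tangent[OF xD yD])
  qed
  also have "\<dots> \<le> height m x + 2 * real CARD('n) * gradient_const \<theta> CARD('n) * height m x"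
    using S.section_gradient_bound[OF th y(1) y(2) qc yc] S.v_nonneg[OF yc] q(2) by linarith
  finally show ?thesis by (simp add: algebra_simps)
qed

text \<open>The contradiction argument with the Harnack inequality. Small height enters twice: it makes
  points deep in the section have small height too, which bounds \<open>\<eta>\<close> from above there, and it makes
  the right-hand side \<open>C1\<close> of the differential inequality negligible.\<close>

theorem height_bounded_below:
  assumes m: "0 < m"
  shows "\<exists>h>0. \<forall>x\<in>D. 2 * m \<le> \<eta> x \<longrightarrow> h \<le> height m x"
proof (rule ccontr)
  assume no: "\<not> ?thesis"
  have all: "\<exists>x\<in>interior_level m. 2 * m \<le> \<eta> x \<and> height m x \<le> h" if "0 < h" for h
  proof -
    have "\<exists>x\<in>D. 2 * m \<le> \<eta> x \<and> height m x < h" using no that by (auto simp: not_le)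
    then obtain x where x: "x \<in> D" "2 * m \<le> \<eta> x" "height m x < h" by blast
    moreover have "x \<in> interior_level m" using x m by (simp add: interior_level_def)
    ultimately show ?thesis using less_imp_le by blast
  qed
  \<comment> \<open>\<open>Sup G\<close> is the limit superior of \<open>\<eta>\<close> as the height tends to \<open>0\<close>\<close>
  define G where "G = {a. \<forall>h>0. \<exists>x\<in>interior_level m. height m x \<le> h \<and> a \<le> \<eta> x}"
  have G2: "2 * m \<in> G" using all by (auto simp: G_def)
  have Gbd: "bdd_above G"
  proof (rule bdd_aboveI)
    fix a assume "a \<in> G"
    then obtain x where "x \<in> interior_level m" "a \<le> \<eta> x" using zero_less_one unfolding G_def by blast
    then show "a \<le> B" using eta_le[of x] by (simp add: interior_level_def)
  qed
  define M0 where "M0 = Sup G"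
  have M0: "2 * m \<le> M0" unfolding M0_def by (rule cSup_upper[OF G2 Gbd])
  let ?n = "CARD('n)"
  define T where "T = segment_bound m"
  have T: "0 < T" by (simp add: T_def segment_bound_pos)
  define \<rho> where "\<rho> = m / (4 * L)"
  have rho: "0 < \<rho>" using m L_pos by (simp add: \<rho>_def)
  \<comment> \<open>The point \<open>z\<close> will lie at the fraction \<open>1 - d\<close> of the segment from \<open>x\<close> to a visible point \<open>q\<close>:
    close enough to \<open>q\<close> for \<open>\<eta>\<close> to be at most \<open>3 m / 2\<close> on the ball of radius \<open>\<rho>\<close> around \<open>z\<close>, and
    inside the section by an amount independent of the height.\<close>
  define d where "d = min (1 / 2) (m / (4 * L * T))"
  have d: "0 < d" "d < 1" "d * T \<le> m / (4 * L)" 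
  proof -
    show "0 < d" "d < 1" using m L_pos T by (auto simp: d_def)
    have "d * T \<le> m / (4 * L * T) * T" using T by (intro mult_right_mono) (auto simp: d_def)
    then show "d * T \<le> m / (4 * L)" using T by simp
  qed
  define \<theta>\<^sub>0 where "\<theta>\<^sub>0 = 1 - d"
  have th0: "0 < \<theta>\<^sub>0" "\<theta>\<^sub>0 < 1" using d by (auto simp: \<theta>\<^sub>0_def)
  define \<theta> where "\<theta> = (1 + \<theta>\<^sub>0) / 2"
  have th: "0 < \<theta>" "\<theta> < 1" using th0 by (auto simp: \<theta>_def)
  define K1 where "K1 = harnack_height_const \<theta>\<^sub>0 (\<rho> / T) ?n"
  define K2 where "K2 = harnack_const \<theta>\<^sub>0 (\<rho> / T) ?n"
  have K: "0 < K1" "0 < K2"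
  proof -
    obtain x where x: "x \<in> interior_level m" using all[of 1] by auto
    interpret S: ma_section D "above_tangent u x" "flat_section m x" x "height m x"
      by (rule ma_section_flat_section[OF m x])
    show "0 < K1" "0 < K2" unfolding K1_def K2_def using S.harnack_consts_pos[OF th0, of "\<rho> / T"] rho T by auto
  qed
  define C4 where "C4 = 1 + 2 * real ?n * gradient_const \<theta> ?n"
  have C4: "0 < C4" using gradient_const_ge1[of \<theta> ?n] th by (simp add: C4_def add_pos_nonneg)
  define c0 where "c0 = m / 2"
  have c0: "0 < c0" using m by (simp add: c0_def)
  \<comment> \<open>the Harnack inequality will give \<open>4 * \<kappa> \<le> g x\<close>, whereas \<open>x\<close> is chosen with \<open>g x \<le> 2 * \<kappa>\<close>\<close>
  define \<kappa> where "\<kappa> = c0 * K2 / 4"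
  have kappa: "0 < \<kappa>" using c0 K by (simp add: \<kappa>_def)
  have "M0 + \<kappa> \<notin> G" using cSup_upper[OF _ Gbd, of "M0 + \<kappa>"] kappa by (auto simp: M0_def)
  then obtain h1 where h1: "0 < h1" "\<And>x. x \<in> interior_level m \<Longrightarrow> height m x \<le> h1 \<Longrightarrow> \<eta> x < M0 + \<kappa>"
  proof -
    have "\<exists>h>0. \<forall>x\<in>interior_level m. \<not> (height m x \<le> h \<and> M0 + \<kappa> \<le> \<eta> x)"
      using \<open>M0 + \<kappa> \<notin> G\<close> by (simp add: G_def)
    then show ?thesis using that by (meson not_le)
  qed
  \<comment> \<open>the first bound keeps the heights in the section of \<open>x\<close> below \<open>h1\<close>, the second one is the
    smallness required by the Harnack inequality\<close>
  define h2 where "h2 = min (h1 / C4) (c0 / (2 * (C1 + 1) * K1))"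
  have h2: "0 < h2" using h1 C4 c0 C1_nonneg K by (simp add: h2_def)
  have "M0 - \<kappa> < Sup G" using kappa by (simp add: M0_def)
  then obtain a where a: "a \<in> G" "M0 - \<kappa> < a" using less_cSupE[of "M0 - \<kappa>" G] G2 by blast
  then obtain x where x: "x \<in> interior_level m" "height m x \<le> h2" "a \<le> \<eta> x" using h2 unfolding G_def by blast
  interpret S: ma_section D "above_tangent u x" "flat_section m x" x "height m x"
    by (rule ma_section_flat_section[OF m x(1)])
  let ?v = "above_tangent u x" and ?S = "flat_section m x" and ?H = "height m x"
  have xD: "x \<in> D" using x by (simp add: interior_level_def)
  obtain q where q: "q \<in> visible m x" "?v q = ?H" by (rule height_attained[OF m x(1)])
  define z where "z = x + \<theta>\<^sub>0 *\<^sub>R (q - x)"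
  have zS: "z \<in> ?S" unfolding z_def by (rule visible_point_approached[OF m x(1) q]) (use th0 in auto)
  have qseg: "closed_segment x q \<subseteq> D" and etaq: "\<eta> q = m" using q(1) level_sub(1) by (auto simp: visible_def)
  have qD: "q \<in> D" using qseg by auto
  have vz: "?v z \<le> \<theta>\<^sub>0 * ?H" unfolding z_def using above_tangent_scale_le[OF qseg, of \<theta>\<^sub>0] th0 q(2) by simp
  have zq: "norm (z - q) \<le> m / (4 * L)"
  proof -
    have "z - q = - (d *\<^sub>R (q - x))" by (simp add: z_def \<theta>\<^sub>0_def algebra_simps)
    then have "norm (z - q) = d * norm (q - x)" using d by simp
    also have "\<dots> \<le> d * T" using visible_dist[OF m q(1)] d by (intro mult_left_mono) (auto simp: T_def)
    finally show ?thesis using d(3) by simp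
  qed
  define g where "g = (\<lambda>y. (M0 + \<kappa>) - \<eta> y)"
  have "c0 * harnack_const \<theta>\<^sub>0 (\<rho> / T) ?n \<le> g x"
  proof (rule S.section_harnack[OF th0 zS vz])
    show "norm (y - x) \<le> T" if "y \<in> closure ?S" for y
      using closure_flat_section_dist[OF m x(1) that] by (simp add: T_def)
    show "0 < T" "0 < \<rho>" "0 < c0" by (fact T rho c0)+
    show "Ck_on 2 g D" unfolding g_def by (intro Ck_on_diff open_D Ck_on_const eta_smooth)
    show "0 \<le> g y" if y: "y \<in> ?S" "?v y \<le> (1 + \<theta>\<^sub>0) / 2 * ?H" for y
    proof -
      have "height m y \<le> C4 * ?H" unfolding C4_def
        by (rule height_in_section[OF m x(1) y(1) _ th]) (use y in \<open>simp add: \<theta>_def\<close>)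
      also have "\<dots> \<le> C4 * (h1 / C4)" using x(2) C4 by (intro mult_left_mono) (auto simp: h2_def)
      finally have "height m y \<le> h1" using C4 by simp
      moreover have "y \<in> interior_level m" using y(1) flat_section_sub by blast
      ultimately show ?thesis using h1(2)[of y] by (simp add: g_def)
    qed
    show "c0 \<le> g y" if y: "y \<in> ?S" "norm (y - z) \<le> \<rho>" for y
    proof -
      have yD: "y \<in> D" using y S.S_sub by blast
      have "norm (y - q) \<le> norm (y - z) + norm (z - q)" by (rule norm_diff_triangle_le) auto
      also have "\<dots> \<le> m / (4 * L) + m / (4 * L)" using y(2) zq by (simp add: \<rho>_def)
      finally have "L * norm (y - q) \<le> L * (m / (4 * L) + m / (4 * L))" using L_pos by (intro mult_left_mono) auto
      also have "\<dots> = m / 2" using L_pos by (simp add: field_simps)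
      finally have "\<eta> y \<le> m + m / 2" using eta_lip[OF yD qD] etaq by linarith
      then show ?thesis using M0 kappa by (simp add: g_def c0_def)
    qed
    show "(\<Sum>k\<in>UNIV. dd (E k) (dd (E k) g) y) \<le> C1" if y: "y \<in> ?S" "orthoframe (hessian ?v y) E" for y E
    proof -
      have yD: "y \<in> D" using y S.S_sub by blast
      have "orthoframe (hessian u y) E" using y(2) by (simp add: hessian_above_tangent[OF xD yD])
      from eta_super[OF yD this] show ?thesis
        unfolding g_def by (simp add: dd2_const_minus[OF open_D eta_smooth yD] sum_negf)
    qed
    have "C1 * ?H * K1 \<le> (C1 + 1) * h2 * K1"
      using x(2) C1_nonneg K S.H_pos by (intro mult_right_mono mult_mono) auto
    also have "\<dots> \<le> (C1 + 1) * (c0 / (2 * (C1 + 1) * K1)) * K1"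
      using C1_nonneg K by (intro mult_right_mono mult_left_mono) (auto simp: h2_def)
    also have "\<dots> = c0 / 2"
    proof -
      have "s * (c / (2 * s * k)) * k = c / 2" if "0 < s" "0 < k" for s c k :: real
        using that by simp
      moreover have "0 < C1 + 1" using C1_nonneg by simp
      ultimately show ?thesis using K by blast
    qed
    also have "\<dots> < c0" using c0 by simp
    finally show "C1 * ?H * harnack_height_const \<theta>\<^sub>0 (\<rho> / T) ?n < c0" by (simp add: K1_def)
  qed
  then have "c0 * K2 \<le> 2 * \<kappa>" using a(2) x(3) by (simp add: g_def K2_def)
  then show False using c0 K by (simp add: \<kappa>_def)
qed

corollary hessian_bounded_on_level:
  assumes m: "0 < m"
  shows "\<exists>K>0. \<forall>x\<in>D. 2 * m \<le> \<eta> x \<longrightarrow> (\<forall>e. norm e = 1 \<longrightarrow> dd e (dd e u) x \<le> K)"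
proof -
  obtain h where h: "0 < h" "\<And>x. x \<in> D \<Longrightarrow> 2 * m \<le> \<eta> x \<Longrightarrow> h \<le> height m x"
    using height_bounded_below[OF m] by blast
  let ?P = "pogorelov_const 1 (2 * A) CARD('n)"
  have P: "0 < ?P" unfolding pogorelov_const_def using A_pos by (intro mult_pos_pos add_pos_pos) auto
  have "dd e (dd e u) x \<le> ?P / h" if "x \<in> D" "2 * m \<le> \<eta> x" "norm e = 1" for x e
  proof -
    have "x \<in> interior_level m" using that m by (simp add: interior_level_def)
    then have "dd e (dd e u) x \<le> ?P / height m x" by (rule hessian_le_inverse_height[OF m _ that(3)])
    also have "\<dots> \<le> ?P / h" using h(2)[OF that(1,2)] h(1) P by (intro divide_left_mono) auto
    finally show ?thesis .
  qed
  then show ?thesis using P h(1) by (intro exI[of _ "?P / h"]) auto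
qed

end

section \<open>The penalised maximum\<close>

lemma dd_minus_const:
  assumes "f differentiable (at x)"
  shows "dd w (\<lambda>y. f y - c) x = dd w f x"
  using dd_diff[OF assms, of "\<lambda>_. c"] by (simp add: dd_const)

lemma lipschitz_dd_le:
  assumes S: "open S" and x: "x \<in> S" and d: "f differentiable (at x)"
    and lip: "\<And>y. y \<in> S \<Longrightarrow> \<bar>f y - f x\<bar> \<le> L * norm (y - x)"
  shows "\<bar>dd e f x\<bar> \<le> L * norm e"
proof -
  have "((\<lambda>s. f (x + s *\<^sub>R e)) has_real_derivative dd e f x) (at 0)"
    using DERIV_line[of f x 0 e] d by simp
  then have "((\<lambda>h. (f (x + h *\<^sub>R e) - f x) / h) \<longlongrightarrow> dd e f x) (at 0)"
    by (simp add: DERIV_def)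
  then have lim: "((\<lambda>h. \<bar>(f (x + h *\<^sub>R e) - f x) / h\<bar>) \<longlongrightarrow> \<bar>dd e f x\<bar>) (at 0)" by (rule tendsto_rabs)
  have "\<forall>\<^sub>F h in nhds (0::real). x + h *\<^sub>R e \<in> S" by (rule eventually_line_in[OF S x])
  then have "\<forall>\<^sub>F h in at (0::real). x + h *\<^sub>R e \<in> S \<and> h \<noteq> 0"
    unfolding eventually_at_filter by eventually_elim simp
  then have "\<forall>\<^sub>F h in at (0::real). \<bar>(f (x + h *\<^sub>R e) - f x) / h\<bar> \<le> L * norm e"
  proof eventually_elim
    case (elim h)
    have "\<bar>f (x + h *\<^sub>R e) - f x\<bar> \<le> L * norm e * \<bar>h\<bar>" using lip[of "x + h *\<^sub>R e"] elim by (simp add: mult_ac)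
    then show ?case using elim by (simp add: abs_divide pos_divide_le_eq)
  qed
  then show ?thesis by (rule tendsto_upperbound[OF lim]) simp
qed

lemma jet2_minus_norm_sq:
  "jet2 (\<lambda>s. - \<sigma> * ((x + s *\<^sub>R w) \<bullet> (x + s *\<^sub>R w))) (- \<sigma> * (x \<bullet> x)) (- 2 * \<sigma> * (x \<bullet> w)) (- 2 * \<sigma> * (w \<bullet> w))"
proof -
  have "(\<lambda>s. - \<sigma> * ((x + s *\<^sub>R w) \<bullet> (x + s *\<^sub>R w))) = (\<lambda>s. - \<sigma> * (x \<bullet> x) + (- 2 * \<sigma> * (x \<bullet> w)) * s + (- 2 * \<sigma> * (w \<bullet> w)) / 2 * s\<^sup>2)"
    by (rule ext) (simp add: inner_add_left inner_add_right inner_commute power2_eq_square algebra_simps)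
  then show ?thesis by (simp only: jet2_poly)
qed

context ma_obstacle
begin

lemma eta_grad_le: "x \<in> D \<Longrightarrow> norm e = 1 \<Longrightarrow> \<bar>dd e \<eta> x\<bar> \<le> L"
  using lipschitz_dd_le[where f = \<eta> and L = L and e = e, OF open_D _ Ck_on_differentiable_le[OF eta_smooth]] eta_lip
  by fastforce

text \<open>The number \<open>\<Gamma>\<close> depends on the qualitative bound for the second derivatives on \<open>{\<eta> \<ge> \<epsilon>}\<close>, but
  not on \<open>\<sigma>\<close>. This holds because \<open>\<sigma> |y|\<^sup>2\<close> is bounded by a number \<open>\<Lambda>\<close> independent of \<open>\<sigma>\<close> at every
  point \<open>y\<close> where the penalised function is no smaller than at \<open>x\<close>; the same observation confines
  the search for a maximum to a compact set.\<close>

lemma penalized_estimate: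
  assumes eps: "0 < \<epsilon>" and e: "norm e = 1" and x: "x \<in> interior_level \<epsilon>"
  defines "\<Phi> \<equiv> \<lambda>y. (\<eta> y - \<epsilon>)\<^sup>2 * dd e (dd e u) y * exp ((dd e u y)\<^sup>2 / 2)"
  shows "\<exists>\<Gamma>. \<forall>\<sigma>. 0 < \<sigma> \<and> \<sigma> \<le> 1 \<longrightarrow>
     \<Phi> x * exp (- \<sigma> * (x \<bullet> x)) \<le> B * (2 * C1 + 2 * L + \<sigma> * \<Gamma> * B) * exp (A\<^sup>2 / 2)"
proof -
  let ?n = "CARD('n)"
  have e0: "e \<noteq> 0" using e by auto
  define U where "U = dd e (dd e u)"
  obtain K where K: "0 < K" "\<And>y e. y \<in> D \<Longrightarrow> \<epsilon> \<le> \<eta> y \<Longrightarrow> norm e = 1 \<Longrightarrow> dd e (dd e u) y \<le> K"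
    using hessian_bounded_on_level[of "\<epsilon> / 2"] eps by auto
  have xD: "x \<in> D" and xe: "\<epsilon> < \<eta> x" and xl: "x \<in> level \<epsilon>" using x by (auto simp: interior_level_def level_def)
  have B0: "0 < B" using eta_pos[OF xD] eta_le[OF xD] by simp
  have Upos: "0 < U y" if "y \<in> D" for y unfolding U_def by (rule form_pos[OF that e0])
  have Phi: "\<Phi> y = (\<eta> y - \<epsilon>)\<^sup>2 * U y * exp ((dd e u y)\<^sup>2 / 2)" for y by (simp add: \<Phi>_def U_def)
  have p2: "(dd e u y)\<^sup>2 \<le> A\<^sup>2" if "y \<in> D" for y
    using grad_le[OF that, of e] e A_pos by (simp add: abs_le_square_iff[symmetric])
  define M1 where "M1 = B\<^sup>2 * K * exp (A\<^sup>2 / 2)"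
  have PhiM: "\<Phi> y \<le> M1" if y: "y \<in> level \<epsilon>" for y
  proof -
    have yD: "y \<in> D" and "\<epsilon> \<le> \<eta> y" using y by (auto simp: level_def)
    then have "(\<eta> y - \<epsilon>)\<^sup>2 \<le> B\<^sup>2" using eta_le[OF yD] eps by (intro power_mono) auto
    then show ?thesis unfolding Phi M1_def
      using K(2)[OF yD \<open>\<epsilon> \<le> \<eta> y\<close> e] Upos[OF yD] p2[OF yD] K(1)
      by (intro mult_mono) (auto simp: U_def)
  qed
  have Px: "0 < \<Phi> x" unfolding Phi using Upos[OF xD] xe by simp
  have M1: "0 < M1" using PhiM[OF xl] Px by simp
  \<comment> \<open>\<open>M1\<close> bounds \<open>\<Phi>\<close> on the level set; \<open>\<Lambda>\<close> bounds \<open>\<sigma> |y|\<^sup>2\<close> for competitors \<open>y\<close> when \<open>\<sigma> \<le> 1\<close>\<close>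
  define \<Lambda> where "\<Lambda> = ln (M1 / \<Phi> x) + x \<bullet> x"
  \<comment> \<open>bound for the sum of the squared norms of the frame vectors\<close>
  define Q where "Q = real ?n * (real ?n * K ^ (?n - 1))"
  have Q0: "0 \<le> Q" using K(1) by (simp add: Q_def)
  define \<Gamma> where "\<Gamma> = (4 * \<Lambda> + 2) * Q"
  have La0: "0 \<le> \<Lambda>"
    using PhiM[OF xl] Px by (simp add: \<Lambda>_def)
  have Ga0: "0 \<le> \<Gamma>" using La0 Q0 by (simp add: \<Gamma>_def)
  have "\<Phi> x * exp (- \<sigma> * (x \<bullet> x)) \<le> B * (2 * C1 + 2 * L + \<sigma> * \<Gamma> * B) * exp (A\<^sup>2 / 2)"
    if sg: "0 < \<sigma>" "\<sigma> \<le> 1" for \<sigma>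
  proof -
    define \<Psi> where "\<Psi> = (\<lambda>y. \<Phi> y * exp (- \<sigma> * (y \<bullet> y)))"
    define P where "P = \<Psi> x"
    have P0: "0 < P" using Px by (simp add: P_def \<Psi>_def)
    have PsiM: "\<Psi> y \<le> M1 * exp (- \<sigma> * (y \<bullet> y))" if "y \<in> level \<epsilon>" for y
      unfolding \<Psi>_def using PhiM[OF that] by (intro mult_right_mono) auto
    have key: "\<sigma> * (y \<bullet> y) \<le> \<Lambda>" if y: "y \<in> level \<epsilon>" "P \<le> \<Psi> y" for y
    proof -
      have "\<Phi> x * exp (- \<sigma> * (x \<bullet> x)) \<le> M1 * exp (- \<sigma> * (y \<bullet> y))"
        using order_trans[OF y(2) PsiM[OF y(1)]] unfolding P_def \<Psi>_def .
      then have "ln (\<Phi> x * exp (- \<sigma> * (x \<bullet> x))) \<le> ln (M1 * exp (- \<sigma> * (y \<bullet> y)))"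
        using Px M1 by (subst ln_le_cancel_iff) auto
      then have "ln (\<Phi> x) - \<sigma> * (x \<bullet> x) \<le> ln M1 - \<sigma> * (y \<bullet> y)"
        using Px M1 by (simp add: ln_mult)
      moreover have "ln (M1 / \<Phi> x) = ln M1 - ln (\<Phi> x)" using Px M1 by (simp add: ln_div)
      moreover have "\<sigma> * (x \<bullet> x) \<le> 1 * (x \<bullet> x)" using sg by (intro mult_right_mono) auto
      ultimately show ?thesis by (simp add: \<Lambda>_def)
    qed
    define Kc where "Kc = level \<epsilon> \<inter> {y. \<sigma> * (y \<bullet> y) \<le> \<Lambda>}"
    have "closed {y :: real^'n. \<sigma> * (y \<bullet> y) \<le> \<Lambda>}" by (intro closed_Collect_le continuous_intros)
    then have "closed Kc" unfolding Kc_def by (intro closed_Int closed_level eps)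
    moreover have "bounded Kc"
    proof -
      have "norm y \<le> sqrt (\<Lambda> / \<sigma>)" if "y \<in> Kc" for y
      proof -
        have "(norm y)\<^sup>2 \<le> \<Lambda> / \<sigma>" using that sg by (simp add: Kc_def pos_le_divide_eq mult.commute dot_square_norm)
        then show ?thesis by (rule real_le_rsqrt)
      qed
      then show ?thesis unfolding bounded_iff by blast
    qed
    ultimately have cK: "compact Kc" by (simp add: compact_eq_bounded_closed)
    have KD: "Kc \<subseteq> D" by (auto simp: Kc_def level_def)
    have xK: "x \<in> Kc" using key[OF xl] xl by (simp add: Kc_def P_def)
    have "continuous_on Kc \<Psi>" unfolding \<Psi>_def Phi[abs_def] U_def
      by (intro continuous_intros continuous_on_D KD continuous_on_subset[OF continuous_eta KD]) auto
    moreover have "Kc \<noteq> {}" using xK by blast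
    ultimately obtain y where y: "y \<in> Kc" "\<And>z. z \<in> Kc \<Longrightarrow> \<Psi> z \<le> \<Psi> y"
      using continuous_attains_sup[OF cK, of \<Psi>] by blast
    have Py: "P \<le> \<Psi> y" using y(2)[OF xK] by (simp add: P_def)
    have ymax: "\<Psi> z \<le> \<Psi> y" if "z \<in> level \<epsilon>" for z
    proof (cases "P \<le> \<Psi> z")
      case True
      then show ?thesis using key[OF that] that y(2) by (simp add: Kc_def)
    qed (use Py in simp)
    have yl: "y \<in> level \<epsilon>" and yD: "y \<in> D" using y(1) KD by (auto simp: Kc_def)
    have "\<eta> y \<noteq> \<epsilon>" using Py P0 by (auto simp: \<Psi>_def Phi)
    then have ye: "\<epsilon> < \<eta> y" using yl by (simp add: level_def)
    then have yi: "y \<in> interior_level \<epsilon>" using yD by (simp add: interior_level_def)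
    define t where "t = (\<lambda>z. \<eta> z - \<epsilon>)"
    have tC: "Ck_on 2 t D" unfolding t_def by (intro Ck_on_diff open_D eta_smooth Ck_on_const)
    have ty: "0 < t y" using ye by (simp add: t_def)
    obtain E where E: "orthoframe (hessian u y) E" "E undefined = (1 / sqrt (dd e (dd e u) y)) *\<^sub>R e"
      using frame_exists[OF yD e0, of undefined] by blast
    have Lt: "- C1 \<le> (\<Sum>k\<in>UNIV. dd (E k) (dd (E k) t) y)"
      unfolding t_def using eta_super[OF yD E(1)] by (simp add: dd2_minus_const[OF open_D eta_smooth yD])
    have mx: "\<forall>\<^sub>F z in nhds y. 2 * ln (t z) + ln (dd e (dd e u) z) + 1 / 2 * (dd e u z - 0)\<^sup>2 + - \<sigma> * (z \<bullet> z)
        \<le> 2 * ln (t y) + ln (dd e (dd e u) y) + 1 / 2 * (dd e u y - 0)\<^sup>2 + - \<sigma> * (y \<bullet> y)"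
      using eventually_nhds_in_open[OF open_interior_level yi]
    proof eventually_elim
      case (elim z)
      have ln: "0 < \<Psi> z \<and> ln (\<Psi> z) = 2 * ln (t z) + ln (U z) + 1 / 2 * (dd e u z)\<^sup>2 + - \<sigma> * (z \<bullet> z)"
        if z: "z \<in> interior_level \<epsilon>" for z
      proof -
        have "0 < t z" "0 < U z" using z Upos[of z] by (auto simp: interior_level_def t_def)
        then show ?thesis unfolding \<Psi>_def Phi t_def[symmetric] by (simp add: ln_mult ln_realpow t_def)
      qed
      have "\<Psi> z \<le> \<Psi> y" using ymax elim level_sub(2) by blast
      then have "ln (\<Psi> z) \<le> ln (\<Psi> y)"
        using ln_mono[of "\<Psi> z" "\<Psi> y"] conjunct1[OF ln[OF elim]] by blast
      then show ?case using ln[OF elim] ln[OF yi] by (simp add: U_def)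
    qed
    have P1: "1 * dd e (dd e u) y \<le> 2 * C1 / t y + 2 * (dd e t y)\<^sup>2 / ((t y)\<^sup>2 * dd e (dd e u) y)
        + (\<Sum>k\<in>UNIV. (- 2 * \<sigma> * (y \<bullet> E k))\<^sup>2) - (\<Sum>k\<in>UNIV. - 2 * \<sigma> * (E k \<bullet> E k))"
      by (rule pogorelov_at_max[OF yD e0 E open_D yD tC ty Lt, where \<rho> = "\<lambda>z. - \<sigma> * (z \<bullet> z)" and a = 1 and \<kappa> = 0])
        (use jet2_minus_norm_sq mx in simp_all)
    have SE: "(\<Sum>k\<in>UNIV. E k \<bullet> E k) \<le> Q"
    proof -
      have "(\<Sum>k\<in>UNIV. E k \<bullet> E k) \<le> (\<Sum>k\<in>(UNIV::'n set). real ?n * K ^ (?n - 1))"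
        by (intro sum_mono) (use frame_norm_bound[OF yD K(1) K(2)[OF yD] E(1)] ye in \<open>simp add: dot_square_norm\<close>)
      then show ?thesis by (simp add: Q_def)
    qed
    have SE0: "0 \<le> (\<Sum>k\<in>UNIV. E k \<bullet> E k)" by (intro sum_nonneg) simp
    have ex1: "(\<Sum>k\<in>UNIV. (- 2 * \<sigma> * (y \<bullet> E k))\<^sup>2) \<le> 4 * \<sigma> * \<Lambda> * Q"
    proof -
      have "(\<Sum>k\<in>UNIV. (- 2 * \<sigma> * (y \<bullet> E k))\<^sup>2) \<le> (\<Sum>k\<in>UNIV. 4 * \<sigma>\<^sup>2 * ((y \<bullet> y) * (E k \<bullet> E k)))"
      proof (intro sum_mono)
        fix k
        have "(y \<bullet> E k)\<^sup>2 \<le> (y \<bullet> y) * (E k \<bullet> E k)" by (rule Cauchy_Schwarz_ineq)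
        then show "(- 2 * \<sigma> * (y \<bullet> E k))\<^sup>2 \<le> 4 * \<sigma>\<^sup>2 * ((y \<bullet> y) * (E k \<bullet> E k))"
          by (simp add: power_mult_distrib mult_left_mono)
      qed
      also have "\<dots> = 4 * \<sigma> * (\<sigma> * (y \<bullet> y)) * (\<Sum>k\<in>UNIV. E k \<bullet> E k)"
        by (simp add: sum_distrib_left power2_eq_square mult_ac)
      also have "\<dots> \<le> 4 * \<sigma> * \<Lambda> * Q"
        using key[OF yl Py] SE SE0 sg La0 by (intro mult_mono mult_left_mono) auto
      finally show ?thesis .
    qed
    have ex2: "- (\<Sum>k\<in>UNIV. - 2 * \<sigma> * (E k \<bullet> E k)) \<le> 2 * \<sigma> * Q"
    proof -
      have "- (\<Sum>k\<in>UNIV. - 2 * \<sigma> * (E k \<bullet> E k)) = 2 * \<sigma> * (\<Sum>k\<in>UNIV. E k \<bullet> E k)"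
        by (simp add: sum_negf[symmetric] sum_distrib_left)
      then show ?thesis using SE sg by simp
    qed
    \<comment> \<open>multiplied by \<open>t\<^sup>2 U\<close>, the inequality at the maximum becomes quadratic in \<open>X\<close>\<close>
    define X where "X = t y * U y"
    have Uy: "0 < U y" by (rule Upos[OF yD])
    have X0: "0 < X" using ty Uy by (simp add: X_def)
    have tB: "t y \<le> B" using eta_le[OF yD] eps by (simp add: t_def)
    have "\<bar>dd e t y\<bar> \<le> L"
      unfolding t_def using eta_grad_le[OF yD e] dd_minus_const[OF Ck_on_differentiable_le[OF eta_smooth _ yD]] by simp
    then have t2: "(dd e t y)\<^sup>2 \<le> L\<^sup>2" using L_pos by (simp add: abs_le_square_iff[symmetric])
    have "U y \<le> 2 * C1 / t y + 2 * (dd e t y)\<^sup>2 / ((t y)\<^sup>2 * U y) + \<sigma> * \<Gamma>"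
    proof -
      have "4 * \<sigma> * \<Lambda> * Q + 2 * \<sigma> * Q = \<sigma> * \<Gamma>" by (simp add: \<Gamma>_def algebra_simps)
      then show ?thesis using P1 ex1 ex2 by (simp add: U_def)
    qed
    then have "(t y)\<^sup>2 * U y * U y \<le> (t y)\<^sup>2 * U y * (2 * C1 / t y + 2 * (dd e t y)\<^sup>2 / ((t y)\<^sup>2 * U y) + \<sigma> * \<Gamma>)"
      using Uy by (intro mult_left_mono) auto
    also have "\<dots> = 2 * C1 * X + 2 * (dd e t y)\<^sup>2 + \<sigma> * \<Gamma> * t y * X"
      using ty Uy by (simp add: X_def field_simps power2_eq_square)
    also have "\<dots> \<le> 2 * C1 * X + 2 * L\<^sup>2 + \<sigma> * \<Gamma> * B * X"
      using t2 tB sg Ga0 X0 by (intro add_mono mult_right_mono mult_left_mono) auto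
    finally have XX: "X * X \<le> (2 * C1 + \<sigma> * \<Gamma> * B) * X + 2 * L\<^sup>2"
      by (simp add: X_def power2_eq_square algebra_simps)
    have "X \<le> (2 * C1 + \<sigma> * \<Gamma> * B) + 2 * L"
    proof (rule le_of_square_le)
      have "2 * L\<^sup>2 \<le> 2 * L * (2 * L)" by (simp add: power2_eq_square)
      then show "X * X \<le> (2 * C1 + \<sigma> * \<Gamma> * B) * X + 2 * L * (2 * L)" using XX by linarith
    qed (use C1_nonneg sg Ga0 B0 L_pos in auto)
    then have XB: "X \<le> 2 * C1 + 2 * L + \<sigma> * \<Gamma> * B" by simp
    have "\<Phi> x * exp (- \<sigma> * (x \<bullet> x)) \<le> \<Psi> y" using Py by (simp add: P_def \<Psi>_def)
    also have "\<dots> \<le> \<Phi> y * 1" unfolding \<Psi>_def using sg Uy by (intro mult_left_mono) (auto simp: Phi)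
    also have "\<dots> = t y * X * exp ((dd e u y)\<^sup>2 / 2)" by (simp add: Phi X_def t_def power2_eq_square)
    also have "\<dots> \<le> B * (2 * C1 + 2 * L + \<sigma> * \<Gamma> * B) * exp (A\<^sup>2 / 2)"
      using tB XB X0 ty B0 p2[OF yD] by (intro mult_mono) auto
    finally show ?thesis .
  qed
  then show ?thesis by blast
qed

text \<open>First \<open>\<sigma>\<close> tends to \<open>0\<close>, which removes \<open>\<Gamma>\<close>, then \<open>\<epsilon>\<close>.\<close>

theorem second_derivative_estimate:
  assumes x: "x \<in> D" and e: "norm e = 1"
  shows "(\<eta> x)\<^sup>2 * dd e (dd e u) x \<le> B * (2 * C1 + 2 * L) * exp (A\<^sup>2 / 2)"
proof -
  define R where "R = B * (2 * C1 + 2 * L) * exp (A\<^sup>2 / 2)"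
  have step: "(\<eta> x - \<epsilon>)\<^sup>2 * dd e (dd e u) x \<le> R" if eps: "0 < \<epsilon>" "\<epsilon> < \<eta> x" for \<epsilon>
  proof -
    have xi: "x \<in> interior_level \<epsilon>" using x eps by (simp add: interior_level_def)
    define \<Phi> where "\<Phi> = (\<eta> x - \<epsilon>)\<^sup>2 * dd e (dd e u) x * exp ((dd e u x)\<^sup>2 / 2)"
    obtain \<Gamma> where G: "\<And>\<sigma>. 0 < \<sigma> \<Longrightarrow> \<sigma> \<le> 1 \<Longrightarrow> \<Phi> * exp (- \<sigma> * (x \<bullet> x)) \<le> B * (2 * C1 + 2 * L + \<sigma> * \<Gamma> * B) * exp (A\<^sup>2 / 2)"
      using penalized_estimate[OF eps(1) e xi] unfolding \<Phi>_def by blast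
    have l1: "((\<lambda>\<sigma>. \<Phi> * exp (- \<sigma> * (x \<bullet> x))) \<longlongrightarrow> \<Phi> * exp (- 0 * (x \<bullet> x))) (at_right 0)"
      by (intro tendsto_intros)
    have l2: "((\<lambda>\<sigma>. B * (2 * C1 + 2 * L + \<sigma> * \<Gamma> * B) * exp (A\<^sup>2 / 2)) \<longlongrightarrow> B * (2 * C1 + 2 * L + 0 * \<Gamma> * B) * exp (A\<^sup>2 / 2)) (at_right 0)"
      by (intro tendsto_intros)
    have "\<forall>\<^sub>F \<sigma> in at_right (0::real). \<sigma> \<in> {0<..<1}" by (rule eventually_at_right_real) simp
    then have "\<forall>\<^sub>F \<sigma> in at_right 0. \<Phi> * exp (- \<sigma> * (x \<bullet> x)) \<le> B * (2 * C1 + 2 * L + \<sigma> * \<Gamma> * B) * exp (A\<^sup>2 / 2)"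
      by eventually_elim (use G in auto)
    from tendsto_le[OF _ l2 l1 this] have "\<Phi> \<le> R" by (simp add: R_def)
    moreover have "(\<eta> x - \<epsilon>)\<^sup>2 * dd e (dd e u) x * 1 \<le> \<Phi>"
      unfolding \<Phi>_def using form_nonneg[OF x] by (intro mult_left_mono) auto
    ultimately show ?thesis by simp
  qed
  have lim: "((\<lambda>\<epsilon>. (\<eta> x - \<epsilon>)\<^sup>2 * dd e (dd e u) x) \<longlongrightarrow> (\<eta> x - 0)\<^sup>2 * dd e (dd e u) x) (at_right 0)"
    by (intro tendsto_intros)
  have "\<forall>\<^sub>F \<epsilon> in at_right (0::real). \<epsilon> \<in> {0<..<\<eta> x}" by (rule eventually_at_right_real) (rule eta_pos[OF x])
  then have "\<forall>\<^sub>F \<epsilon> in at_right 0. (\<eta> x - \<epsilon>)\<^sup>2 * dd e (dd e u) x \<le> R" by eventually_elim (use step in auto)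
  from tendsto_upperbound[OF lim this] show ?thesis by (simp add: R_def)
qed

end

section \<open>Convexity, Lipschitz bounds and boundary values\<close>

text \<open>A semidefinite form vanishes on \<open>v\<close> only if \<open>A *v v = 0\<close>: otherwise a small step from \<open>v\<close> in
  the direction opposite to \<open>A *v v\<close> makes it negative.\<close>

lemma sym_posdef_of_nonneg:
  fixes A :: "real^'n^'n"
  assumes sym: "transpose A = A" and nonneg: "\<And>v. 0 \<le> v \<bullet> (A *v v)" and det: "det A \<noteq> 0"
  shows "sym_posdef A"
proof -
  have "0 < v \<bullet> (A *v v)" if v: "v \<noteq> 0" for v
  proof (rule ccontr)
    assume "\<not> ?thesis"
    then have v0: "v \<bullet> (A *v v) = 0" using nonneg[of v] by simp
    define w where "w = A *v v"
    define a b where "a = w \<bullet> w" and "b = w \<bullet> (A *v w)"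
    have b: "0 \<le> b" using nonneg by (simp add: b_def)
    have "0 \<le> 2 * t * a + t\<^sup>2 * b" for t
    proof -
      have "(v + t *\<^sub>R w) \<bullet> (A *v (v + t *\<^sub>R w)) = 2 * t * a + t\<^sup>2 * b"
        using v0 sym_form_commute[OF sym, of v w]
        by (simp add: matrix_vector_right_distrib matrix_vector_mult_scaleR inner_add_left inner_add_right
            a_def b_def w_def power2_eq_square algebra_simps)
      then show ?thesis using nonneg[of "v + t *\<^sub>R w"] by simp
    qed
    note quadratic = this
    define t where "t = - a / (b + 1)"
    have t: "t * (b + 1) = - a" using b by (simp add: t_def)
    have "0 \<le> (b + 1)\<^sup>2 * (2 * t * a + t\<^sup>2 * b)" using quadratic[of t] by simp
    also have "\<dots> = 2 * (t * (b + 1)) * (a * (b + 1)) + (t * (b + 1))\<^sup>2 * b"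
      by (simp add: power2_eq_square algebra_simps)
    also have "\<dots> = - (a\<^sup>2 * (b + 2))" unfolding t by (simp add: power2_eq_square algebra_simps)
    finally have "a\<^sup>2 * (b + 2) \<le> 0" by simp
    then have "a = 0" using b by (simp add: mult_le_0_iff)
    then have "A *v v = 0" by (simp add: a_def w_def)
    then show False using v det invertible_det_nz[of A] matrix_left_invertible_ker[of A] unfolding invertible_def by blast
  qed
  then show ?thesis using sym by (simp add: sym_posdef_def)
qed

text \<open>The sum of the values at \<open>x + s v\<close> and \<open>x - s v\<close> is minimal at \<open>s = 0\<close>.\<close>

lemma convex_within_second_derivative_nonneg:
  assumes S: "open S" and f: "Ck_on 2 f S" and conv: "convex_within S f" and x: "x \<in> S"
  shows "0 \<le> dd v (dd v f) x"
proof -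
  obtain r where r: "0 < r" "ball x r \<subseteq> S" using S x open_contains_ball by blast
  have cb: "convex_on (ball x r) f" using conv r unfolding convex_within_def by blast
  have "jet2 (\<lambda>s. f (x + s *\<^sub>R v) + f (x + s *\<^sub>R (- v))) (f x + f x) (dd v f x + dd (- v) f x)
      (dd v (dd v f) x + dd (- v) (dd (- v) f) x)"
    by (intro jet2_add jet2_line[OF S f x])
  moreover have "\<forall>\<^sub>F s in nhds 0. f x + f x \<le> f (x + s *\<^sub>R v) + f (x + s *\<^sub>R (- v))"
  proof -
    have "\<forall>\<^sub>F s in nhds 0. x + s *\<^sub>R v \<in> ball x r" "\<forall>\<^sub>F s in nhds 0. x + s *\<^sub>R (- v) \<in> ball x r"
      using r(1) by (simp_all only: eventually_line_in open_ball centre_in_ball)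
    then show ?thesis
    proof eventually_elim
      case (elim s)
      have "f ((1 - 1/2) *\<^sub>R (x + s *\<^sub>R v) + (1/2) *\<^sub>R (x + s *\<^sub>R (- v)))
          \<le> (1 - 1/2) * f (x + s *\<^sub>R v) + 1/2 * f (x + s *\<^sub>R (- v))"
        using elim by (intro convex_onD[OF cb]) auto
      moreover have "(1 - 1/2) *\<^sub>R (x + s *\<^sub>R v) + (1/2) *\<^sub>R (x + s *\<^sub>R (- v)) = x"
        by (simp add: vec_eq_iff field_simps)
      ultimately show ?case by simp
    qed
  qed
  ultimately have "0 \<le> dd v (dd v f) x + dd (- v) (dd (- v) f) x" by (rule jet2_local_min(2))
  moreover have "dd (- v) (dd (- v) f) x = dd v (dd v f) x"
    unfolding hessian_form[OF S f x, symmetric]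
    using matrix_vector_mult_scaleR[of "hessian f x" "-1" v] by simp
  ultimately show ?thesis by simp
qed

text \<open>The infimum of all Lipschitz constants is itself one, and both summands of the norm are
  nonnegative, so the norm bounds the values and the difference quotients.\<close>

lemma C01_norm_bounds:
  assumes f: "C01_on S f" and x: "x \<in> S"
  shows "\<bar>f x\<bar> \<le> C01_norm S f" and "y \<in> S \<Longrightarrow> \<bar>f x - f y\<bar> \<le> C01_norm S f * norm (x - y)"
proof -
  define l where "l = lipschitz_const S f"
  obtain L0 where L0: "L0-lipschitz_on S f" using f by (auto simp: C01_on_def)
  have ne: "{L. L-lipschitz_on S f} \<noteq> {}" using L0 by blast
  have l0: "0 \<le> l"
    unfolding l_def lipschitz_const_def by (rule cInf_greatest[OF ne]) (auto intro: lipschitz_on_nonneg)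
  have bdd: "bdd_above ((\<lambda>x. \<bar>f x\<bar>) ` S)"
    using f by (auto simp: C01_on_def bounded_iff bdd_above_def)
  have sup: "\<bar>f x\<bar> \<le> (SUP x\<in>S. \<bar>f x\<bar>)" by (rule cSUP_upper[OF x bdd])
  have N: "C01_norm S f = (SUP x\<in>S. \<bar>f x\<bar>) + l" by (simp add: C01_norm_def l_def)
  show "\<bar>f x\<bar> \<le> C01_norm S f" using sup l0 N by simp
  show "\<bar>f x - f y\<bar> \<le> C01_norm S f * norm (x - y)" if y: "y \<in> S"
  proof (cases "x = y")
    case False
    have "\<bar>f x - f y\<bar> / norm (x - y) \<le> l"
      unfolding l_def lipschitz_const_def
    proof (rule cInf_greatest[OF ne])
      fix L assume "L \<in> {L. L-lipschitz_on S f}"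
      then have "\<bar>f x - f y\<bar> \<le> L * norm (x - y)"
        using lipschitz_onD[of L S f x y] x y by (simp add: dist_norm)
      then show "\<bar>f x - f y\<bar> / norm (x - y) \<le> L" using False by (simp add: pos_divide_le_eq)
    qed
    then have "\<bar>f x - f y\<bar> \<le> l * norm (x - y)" using False by (simp add: pos_divide_le_eq)
    also have "\<dots> \<le> C01_norm S f * norm (x - y)" using sup N by (intro mult_right_mono) auto
    finally show ?thesis .
  qed simp
qed

lemma C01_tendsto_continuous_ext:
  assumes S: "open S" and f: "C01_on S f" and p: "p \<in> frontier S"
  shows "(f \<longlongrightarrow> continuous_ext S f p) (at p within S)" and "at p within S \<noteq> bot"
proof -
  have pc: "p \<in> closure S" "p \<notin> S" using p S by (auto simp: frontier_def interior_open)
  then have "p islimpt S" by (simp add: closure_def)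
  then show nb: "at p within S \<noteq> bot" by (simp add: trivial_limit_within)
  obtain L where "L-lipschitz_on S f" using f by (auto simp: C01_on_def)
  then have "uniformly_continuous_on S f" by (rule lipschitz_on_uniformly_continuous)
  then obtain l where l: "(f \<longlongrightarrow> l) (at p within S)"
    using uniformly_continuous_on_extension_at_closure pc(1) by blast
  then show "(f \<longlongrightarrow> continuous_ext S f p) (at p within S)"
    using tendsto_Lim[OF nb l] by (simp add: continuous_ext_def)
qed

text \<open>A point outside \<open>S\<close> would produce a boundary point on the segment to \<open>x\<close>. There the Lipschitz
  estimate survives in the limit, with \<open>0\<close> as the second value.\<close>

lemma ball_subset_of_zero_boundary_values:
  assumes x: "x \<in> S" and L: "0 < L"
    and lip: "\<And>y. y \<in> S \<Longrightarrow> \<bar>\<eta> x - \<eta> y\<bar> \<le> L * norm (x - y)"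
    and lim: "\<And>p. p \<in> frontier S \<Longrightarrow> (\<eta> \<longlongrightarrow> 0) (at p within S) \<and> at p within S \<noteq> bot"
  shows "ball x (\<eta> x / L) \<subseteq> (S :: (real^'n) set)"
proof
  fix y assume y: "y \<in> ball x (\<eta> x / L)"
  show "y \<in> S"
  proof (rule ccontr)
    assume "y \<notin> S"
    then have "closed_segment x y \<inter> frontier S \<noteq> {}"
      using x by (intro connected_Int_frontier connected_segment) auto
    then obtain p where p: "p \<in> closed_segment x y" "p \<in> frontier S" by blast
    have "norm (x - p) \<le> norm (x - y)" using segment_bound(1)[of p x y] p(1) by (simp add: norm_minus_commute)
    also have "\<dots> < \<eta> x / L" using y by (simp add: dist_norm)
    finally have lt: "L * norm (x - p) < \<eta> x" using L by (simp add: field_simps)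
    have l1: "((\<lambda>z. \<bar>\<eta> x - \<eta> z\<bar>) \<longlongrightarrow> \<bar>\<eta> x - 0\<bar>) (at p within S)"
      using lim[OF p(2)] by (intro tendsto_intros) auto
    have l2: "((\<lambda>z. L * norm (x - z)) \<longlongrightarrow> L * norm (x - p)) (at p within S)"
      by (intro tendsto_intros)
    have "\<forall>\<^sub>F z in at p within S. \<bar>\<eta> x - \<eta> z\<bar> \<le> L * norm (x - z)"
      unfolding eventually_at_filter using lip by simp
    from tendsto_le[OF _ l2 l1 this] lim[OF p(2)] have "\<bar>\<eta> x\<bar> \<le> L * norm (x - p)" by simp
    then show False using lt by simp
  qed
qed

context ma_solution
begin

text \<open>Polarisation bounds every entry of the Hessian by \<open>K\<close>, since the form takes values between \<open>0\<close>
  and \<open>4 K\<close> on vectors of length at most 2.\<close>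

lemma hessian_norm_le:
  assumes x: "x \<in> D" and K: "\<And>e. norm e = 1 \<Longrightarrow> dd e (dd e u) x \<le> K"
  shows "norm (hessian u x) \<le> (real CARD('n))\<^sup>2 * K"
proof -
  have K0: "0 \<le> K" using K[of "axis undefined 1"] form_nonneg[OF x] order_trans by (auto simp: norm_axis_1)
  have q: "dd v (dd v u) x \<le> K * (norm v)\<^sup>2" for v
  proof (cases "v = 0")
    case False
    have "dd v (dd v u) x = (norm v)\<^sup>2 * dd (v /\<^sub>R norm v) (dd (v /\<^sub>R norm v) u) x"
      using False by (simp add: form_scaleR[OF x] power2_eq_square field_simps)
    also have "\<dots> \<le> (norm v)\<^sup>2 * K" using K[of "v /\<^sub>R norm v"] False by (intro mult_left_mono) auto
    finally show ?thesis by (simp add: mult.commute)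
  qed (use form[OF x, of 0 0] in simp)
  have h: "\<bar>hessian u x $ i $ j\<bar> \<le> K" for i j
  proof -
    define a b :: "real^'n" where "a = axis i 1" and "b = axis j 1"
    have ab: "hessian u x $ i $ j = a \<bullet> (hessian u x *v b)"
      by (simp add: a_def b_def inner_axis' matrix_vector_mult_basis column_def)
    have sq: "(norm v)\<^sup>2 \<le> 4" if "norm v \<le> 2" for v :: "real^'n"
      using power_mono[OF that, of 2] by simp
    have n: "norm (a + b) \<le> 2" "norm (a - b) \<le> 2"
      using norm_triangle_ineq[of a b] norm_triangle_ineq4[of a b] by (simp_all add: a_def b_def norm_axis_1)
    have le: "dd v (dd v u) x \<le> 4 * K" if "norm v \<le> 2" for v
      using order_trans[OF q mult_left_mono[OF sq[OF that] K0]] by (simp add: mult.commute)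
    have "4 * hessian u x $ i $ j = dd (a + b) (dd (a + b) u) x - dd (a - b) (dd (a - b) u) x"
      unfolding form[OF x, symmetric] ab using sym_form_commute[OF symmetric[OF x], of a b]
      by (simp add: matrix_vector_right_distrib matrix_vector_mult_diff_distrib inner_add_left inner_add_right
          inner_diff_left inner_diff_right)
    then show ?thesis
      using le[OF n(1)] le[OF n(2)] form_nonneg[OF x, of "a + b"] form_nonneg[OF x, of "a - b"] by linarith
  qed
  have "norm (hessian u x) \<le> (\<Sum>i\<in>UNIV. norm (hessian u x $ i))"
    unfolding norm_vec_def[of "hessian u x"] by (rule L2_set_le_sum) simp
  also have "\<dots> \<le> (\<Sum>i\<in>(UNIV::'n set). real CARD('n) * K)"
  proof (intro sum_mono)
    fix i
    have "norm (hessian u x $ i) \<le> (\<Sum>j\<in>UNIV. \<bar>hessian u x $ i $ j\<bar>)" by (rule norm_le_l1_cart)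
    also have "\<dots> \<le> (\<Sum>j\<in>(UNIV::'n set). K)" by (intro sum_mono h)
    finally show "norm (hessian u x $ i) \<le> real CARD('n) * K" by simp
  qed
  finally show ?thesis by (simp add: power2_eq_square mult_ac)
qed

end

lemma ma_solution_of_convex_within:
  assumes S: "open S" and u: "Ck_on 4 u S" and conv: "convex_within S u"
    and det: "\<And>x. x \<in> S \<Longrightarrow> det (hessian u x) = 1"
  shows "ma_solution S u"
proof
  fix x assume x: "x \<in> S"
  have u2: "Ck_on 2 u S" by (rule Ck_on_mono[OF _ u]) simp
  show "sym_posdef (hessian u x)"
    using hessian_symmetric[OF S u2 x] convex_within_second_derivative_nonneg[OF S u2 conv x] det[OF x]
    by (intro sym_posdef_of_nonneg) (auto simp: hessian_form[OF S u2 x])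
qed (use assms in auto)

theorem theorem1p1:
  fixes A B C0 :: real
  shows "\<exists>C::real. \<forall>(\<Omega>::(real^'n::finite) set) u w.
    open \<Omega> \<and> connected \<Omega> \<and> \<Omega> \<noteq> {} \<and>
    Ck_on 4 u \<Omega> \<and> convex_within \<Omega> u \<and> (\<forall>x\<in>\<Omega>. det (hessian u x) = 1) \<and>
    Ck_on 2 w \<Omega> \<and> (\<forall>x\<in>\<Omega>. w x > u x) \<and>
    C01_on \<Omega> u \<and> C01_norm \<Omega> u = A \<and> C01_on \<Omega> w \<and> C01_norm \<Omega> w = B \<and>
    (\<forall>y\<in>frontier \<Omega>. continuous_ext \<Omega> w y = continuous_ext \<Omega> u y) \<and>
    (\<forall>x\<in>\<Omega>. (\<Sum>i\<in>UNIV. \<Sum>j\<in>UNIV. matrix_inv (hessian u x) $ i $ j * hessian w x $ i $ j) \<ge> - C0)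
    \<longrightarrow> (\<forall>x\<in>\<Omega>. (w x - u x) ^ ((2 ^ CARD('n) + 1) * (2 * CARD('n) + 1)) * norm (hessian u x) \<le> C)"
proof -
  \<comment> \<open>the summand 1 makes the constants positive; the summand \<open>n\<close> in \<open>C1\<close> is the frame sum of \<open>u\<close>
    itself\<close>
  define A1 where "A1 = \<bar>A\<bar> + 1"
  define L where "L = \<bar>A\<bar> + \<bar>B\<bar> + 1"
  define C1 where "C1 = \<bar>C0\<bar> + real CARD('n)"
  define K where "K = L * (2 * C1 + 2 * L) * exp (A1\<^sup>2 / 2)"
  define p where "p = (2 ^ CARD('n) + 1) * (2 * CARD('n) + 1)"
  define C where "C = L ^ (p - 2) * ((real CARD('n))\<^sup>2 * K)"
  have "1 * 2 \<le> p" unfolding p_def by (intro mult_mono) (auto simp: Suc_le_eq)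
  then have p2: "2 \<le> p" by simp
  have pos: "0 < A1" "0 < L" "0 \<le> C1" by (auto simp: A1_def L_def C1_def)
  have main: "(w x - u x) ^ p * norm (hessian u x) \<le> C"
    if S: "open \<Omega>" and u4: "Ck_on 4 u \<Omega>" and conv: "convex_within \<Omega> u"
      and det: "\<And>x. x \<in> \<Omega> \<Longrightarrow> det (hessian u x) = 1"
      and w2: "Ck_on 2 w \<Omega>" and gt: "\<And>x. x \<in> \<Omega> \<Longrightarrow> w x > u x"
      and uC: "C01_on \<Omega> u" "C01_norm \<Omega> u = A" and wC: "C01_on \<Omega> w" "C01_norm \<Omega> w = B"
      and bd: "\<And>y. y \<in> frontier \<Omega> \<Longrightarrow> continuous_ext \<Omega> w y = continuous_ext \<Omega> u y"
      and super: "\<And>x. x \<in> \<Omega> \<Longrightarrow> - C0 \<le> (\<Sum>i\<in>UNIV. \<Sum>j\<in>UNIV. matrix_inv (hessian u x) $ i $ j * hessian w x $ i $ j)"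
      and x: "x \<in> \<Omega>" for \<Omega> :: "(real^'n) set" and u w x
  proof -
    define \<eta> where "\<eta> = (\<lambda>x. w x - u x)"
    interpret ma_solution \<Omega> u by (rule ma_solution_of_convex_within[OF S u4 conv det])
    note ub = C01_norm_bounds[OF uC(1), unfolded uC(2)] and wb = C01_norm_bounds[OF wC(1), unfolded wC(2)]
    have eta2: "Ck_on 2 \<eta> \<Omega>" unfolding \<eta>_def by (intro Ck_on_diff S w2 smooth2)
    have lip: "\<bar>\<eta> y - \<eta> z\<bar> \<le> L * norm (y - z)" if "y \<in> \<Omega>" "z \<in> \<Omega>" for y z
    proof -
      have "\<bar>\<eta> y - \<eta> z\<bar> \<le> \<bar>w y - w z\<bar> + \<bar>u y - u z\<bar>" by (simp add: \<eta>_def)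
      also have "\<dots> \<le> (B + A) * norm (y - z)"
        using ub(2)[OF that] wb(2)[OF that] by (simp add: distrib_right)
      also have "\<dots> \<le> L * norm (y - z)" by (intro mult_right_mono) (auto simp: L_def)
      finally show ?thesis .
    qed
    have lim: "(\<eta> \<longlongrightarrow> 0) (at q within \<Omega>) \<and> at q within \<Omega> \<noteq> bot" if q: "q \<in> frontier \<Omega>" for q
    proof -
      have "(\<eta> \<longlongrightarrow> continuous_ext \<Omega> w q - continuous_ext \<Omega> u q) (at q within \<Omega>)"
        unfolding \<eta>_def by (intro tendsto_diff C01_tendsto_continuous_ext[OF S _ q] wC uC)
      then show ?thesis using bd[OF q] C01_tendsto_continuous_ext(2)[OF S uC(1) q] by simp
    qed
    interpret ma_obstacle \<Omega> u \<eta> L A1 L C1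
    proof
      show "Ck_on 2 \<eta> \<Omega>" "0 < L" "0 < A1" "0 \<le> C1" by (fact eta2 pos)+
    next
      fix y assume y: "y \<in> \<Omega>"
      show "0 < \<eta> y" using gt[OF y] by (simp add: \<eta>_def)
      show "\<eta> y \<le> L" using ub(1)[OF y] wb(1)[OF y] by (simp add: \<eta>_def L_def)
      show "ball y (\<eta> y / L) \<subseteq> \<Omega>"
        by (rule ball_subset_of_zero_boundary_values[OF y pos(2) lip[OF y] lim])
      show "\<bar>u y\<bar> \<le> A1" using ub(1)[OF y] by (simp add: A1_def)
      have up: "\<bar>u z - u y\<bar> \<le> A1 * norm (z - y)" if "z \<in> \<Omega>" for z
      proof -
        have "A * norm (z - y) \<le> A1 * norm (z - y)" by (intro mult_right_mono) (auto simp: A1_def)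
        then show ?thesis using ub(2)[OF that y] by simp
      qed
      show "\<bar>dd e u y\<bar> \<le> A1 * norm e" for e by (rule lipschitz_dd_le[OF S y differentiable(1)[OF y] up])
      show "\<bar>\<eta> y - \<eta> z\<bar> \<le> L * norm (y - z)" if "z \<in> \<Omega>" for z by (rule lip[OF y that])
      fix E assume E: "orthoframe (hessian u y) E"
      have "(\<Sum>k\<in>UNIV. dd (E k) (dd (E k) \<eta>) y)
          = (\<Sum>k\<in>UNIV. dd (E k) (dd (E k) w) y) - (\<Sum>k\<in>UNIV. dd (E k) (dd (E k) u) y)"
        unfolding \<eta>_def by (simp add: dd2_diff[OF S w2 smooth2 y] sum_subtractf)
      moreover have "(\<Sum>k\<in>UNIV. dd (E k) (dd (E k) u) y) = real CARD('n)"
        by (simp add: frame_form[OF y E])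
      ultimately show "- C1 \<le> (\<Sum>k\<in>UNIV. dd (E k) (dd (E k) \<eta>) y)"
        using super[OF y] unfolding inverse_hessian_trace_eq_frame_sum[OF S w2 y E] by (simp add: C1_def)
    qed
    have e0: "0 < \<eta> x" "\<eta> x \<le> L" using eta_pos[OF x] eta_le[OF x] by auto
    have K0: "0 \<le> K" using pos by (simp add: K_def)
    have "dd e (dd e u) x \<le> K / (\<eta> x)\<^sup>2" if "norm e = 1" for e
      using second_derivative_estimate[OF x that] e0 by (simp add: K_def pos_le_divide_eq mult.commute)
    from hessian_norm_le[OF x this]
    have "(\<eta> x)\<^sup>2 * norm (hessian u x) \<le> (\<eta> x)\<^sup>2 * ((real CARD('n))\<^sup>2 * (K / (\<eta> x)\<^sup>2))"
      by (intro mult_left_mono) auto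
    also have "\<dots> = (real CARD('n))\<^sup>2 * K" using e0 by simp
    finally have le: "(\<eta> x)\<^sup>2 * norm (hessian u x) \<le> (real CARD('n))\<^sup>2 * K" .
    have "\<eta> x ^ p = \<eta> x ^ (p - 2) * (\<eta> x)\<^sup>2" using p2 by (metis le_add_diff_inverse2 power_add)
    then have "\<eta> x ^ p * norm (hessian u x) = \<eta> x ^ (p - 2) * ((\<eta> x)\<^sup>2 * norm (hessian u x))" by simp
    also have "\<dots> \<le> C" unfolding C_def
      using e0 le pos(2) by (intro mult_mono[OF power_mono le]) auto
    finally show ?thesis by (simp add: \<eta>_def)
  qed
  show ?thesis
    unfolding p_def[symmetric] by (rule exI[of _ C]) (use main in blast)
qed

end
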